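(* Let $\tilde{L}$ be a locally conformal almost cosymplectic manifold with structure $(\Phi,\xi,\eta,g)$ and function $\beta$, and let $L=L_T\times_{\phi_1}L_\perp\times_{\phi_2}L_\nu$ be a bi-warped product submanifold of $\tilde{L}$, where $L_T$ is invariant, $L_\perp$ is anti-invariant, $L_\nu$ is proper slant with slant angle $\nu$, and $\xi$ is tangent to $L_T$. Assume that $L$ is $\mathfrak{D}^\perp$-$\mathfrak{D}^\nu$ mixed totally geodesic. Put $t_2=\dim L_\perp$ and $2t_3=\dim L_\nu$. Then: (i) The squared norm of the second fundamental form $\Sigma$ of $L$ in $\tilde L$ satisfies $$\|\Sigma\|^2\ \ge\ 2t_2\big(\|\vec\nabla(\ln\phi_1)\|^2-\beta^2\big)+4t_3\csc^2\nu\,(\sin^2\nu+2\cos^2\nu)\big(\|\vec\nabla(\ln\phi_2)\|^2-\beta^2\big).$$ (ii) If equality holds identically in (i), then $L_T$ is a totally geodesic submanifold of $\tilde L$, and $L_\perp$ and $L_\nu$ are totally umbilical submanifolds of $\tilde L$ with mean curvature vectors $-\vec\nabla(\ln\phi_1)$ and $-\vec\nabla(\ln\phi_2)$, respectively.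
   Context: An almost contact metric manifold $(\tilde L,\Phi,\xi,\eta,g)$ of odd dimension is a Riemannian manifold with a $(1,1)$-tensor $\Phi$, a vector field $\xi$ and a 1-form $\eta$ such that $\Phi^2=-I+\eta\otimes\xi$, $\eta(\xi)=1$, $\Phi\xi=0$, $\eta\circ\Phi=0$ and $g(\Phi X,\Phi Y)=g(X,Y)-\eta(X)\eta(Y)$. It is locally conformal almost cosymplectic, with smooth function $\beta$, if $(\tilde\nabla_X\Phi)Y=\beta\big(g(\Phi X,Y)\xi-\eta(Y)\Phi X\big)$ and $\tilde\nabla_X\xi=\beta(X-\eta(X)\xi)$ for all vector fields $X,Y$, where $\tilde\nabla$ is the Levi-Civita connection of $g$. For a submanifold $L$ of $\tilde L$ the second fundamental form $\Sigma$ is given by $\tilde\nabla_XY=\nabla_XY+\Sigma(X,Y)$ ($X,Y$ tangent to $L$, $\nabla$ the Levi-Civita connection of $L$), and $\|\Sigma\|^2=\sum_{i,j}g(\Sigma(e_i,e_j),\Sigma(e_i,e_j))$ for a local orthonormal frame $\{e_i\}$ of $TL$. A submanifold with second fundamental form $\Sigma'$ is totally umbilical with mean curvature vector $H$ if $\Sigma'(X,Y)=g(X,Y)H$ for all tangent $X,Y$. Slant: a submanifold tangent to $\xi$ is $\nu$-slant if for every point $x$ and every tangent vector $X$ at $x$ linearly independent of $\xi$, the angle between $\Phi X$ and the tangent space is the constant $\nu\in[0,\pi/2]$. It is invariant if $\nu=0$, anti-invariant if $\nu=\pi/2$, proper slant if $0<\nu<\pi/2$. The same terms are used for submanifolds orthogonal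 to $\xi$, with the condition imposed on all nonzero tangent vectors. Bi-warped product: given Riemannian manifolds $L_1,L_2,L_3$ and smooth functions $f_2,f_3:L_1\to(0,\infty)$, the bi-warped product $L_1\times_{f_2}L_2\times_{f_3}L_3$ is $L_1\times L_2\times L_3$ with metric $\pi_1^*g_{1}+(f_2\circ\pi_1)^2\pi_2^*g_{2}+(f_3\circ\pi_1)^2\pi_3^*g_{3}$. Warping functions are non-constant. Here the base is $L_T$, so $\phi_1,\phi_2:L_T\to(0,\infty)$, and $L$ with this metric is isometrically immersed in $\tilde L$, the factors being identified with the corresponding leaves in $L$. Distributions: $\mathfrak{D}$ (containing $\xi$), $\mathfrak{D}^\perp$, $\mathfrak{D}^\nu$ are the distributions on $L$ tangent to $L_T$, $L_\perp$, $L_\nu$, so $TL=\mathfrak{D}\oplus\mathfrak{D}^\perp\oplus\mathfrak{D}^\nu$ orthogonally. Write $\Phi X=TX+FX$ for $X$ tangent to $L$, with $TX$ tangent and $FX$ normal to $L$. One has $\Phi\mathfrak{D}\subseteq\mathfrak{D}$, $\Phi\mathfrak{D}^\perp\subset T^\perp L$, and $T^\perp L=\Phi\mathfrak{D}^\perp\oplus F\mathfrak{D}^\nu\oplus\mu$ (orthogonal) with $\mu$ a $\Phi$-invariant normal subbundle. $L$ is $\mathfrak{D}^\perp$-$\mathfrak{D}^\nu$ mixed totally geodesic if $\Sigma(V,Z)=0$ for all $V\in\mathfrak{D}^\perp$, $Z\in\mathfrak{D}^\nu$. $\vec\nabla(\ln\phi_i)$ is the gradient of $\ln\phi_i$ on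 $L$, with $\|\vec\nabla f\|^2=\sum_i(e_i f)^2$. *)

theory Defs
  imports "HOL-Analysis.Analysis"
begin

section \<open>Smooth manifolds\<close>

text \<open>
  An atlas is indexed by the points of the manifold: \<open>chart M p\<close> is a chart whose domain
  \<open>cdom M p\<close> contains \<open>p\<close>. The smooth structure is the one generated by all these charts; every
  smooth manifold arises this way. The tangent space at \<open>p\<close> is the model space \<open>'e\<close>, a vector of
  \<open>'e\<close> being read as the components of a tangent vector in the chart \<open>chart M p\<close>. Hence vector
  fields are functions \<open>'m \<Rightarrow> 'e\<close>, but they may be differentiated only after a change to the
  components in one fixed chart. The dimension of the manifold is \<open>DIM('e)\<close>.
\<close>

record ('m, 'e) charts =
  cdom :: "'m \<Rightarrow> 'm set"
  chart :: "'m \<Rightarrow> 'm \<Rightarrow> 'e"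

definition inv_chart :: "('m, 'e) charts \<Rightarrow> 'm \<Rightarrow> 'e \<Rightarrow> 'm" where
  "inv_chart M p = inv_into (cdom M p) (chart M p)"

text \<open>\<open>Ck_on k S f\<close> and \<open>smooth_on S f\<close> are meant for open sets \<open>S\<close> only.\<close>

primrec Ck_on :: "nat \<Rightarrow> 'e::euclidean_space set \<Rightarrow> ('e \<Rightarrow> 'f::euclidean_space) \<Rightarrow> bool" where
  "Ck_on 0 S f \<longleftrightarrow> continuous_on S f"
| "Ck_on (Suc k) S f \<longleftrightarrow> (\<forall>x\<in>S. f differentiable (at x)) \<and>
     (\<forall>v. Ck_on k S (\<lambda>x. frechet_derivative f (at x) v))"

definition smooth_on :: "'e::euclidean_space set \<Rightarrow> ('e \<Rightarrow> 'f::euclidean_space) \<Rightarrow> bool" where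
  "smooth_on S f \<longleftrightarrow> (\<forall>k. Ck_on k S f)"

definition smooth_manifold ::
    "('m::{t2_space,second_countable_topology}, 'e::euclidean_space) charts \<Rightarrow> bool" where
  "smooth_manifold M \<longleftrightarrow>
     (\<forall>p. p \<in> cdom M p \<and> open (cdom M p) \<and> open (chart M p ` cdom M p) \<and>
        homeomorphism (cdom M p) (chart M p ` cdom M p) (chart M p) (inv_chart M p)) \<and>
     (\<forall>p q. smooth_on (chart M p ` (cdom M p \<inter> cdom M q)) (chart M q \<circ> inv_chart M p))"

definition prod_charts :: "('a, 'e) charts \<Rightarrow> ('b, 'f) charts \<Rightarrow> ('a \<times> 'b, 'e \<times> 'f) charts" where
  "prod_charts M N = \<lparr>cdom = (\<lambda>(x, y). cdom M x \<times> cdom N y),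
                      chart = (\<lambda>(x, y). map_prod (chart M x) (chart N y))\<rparr>"

section \<open>Smooth functions, maps, vector fields and tensors\<close>

definition smooth_fun_on ::
    "('m, 'e::euclidean_space) charts \<Rightarrow> 'm set \<Rightarrow> ('m \<Rightarrow> 'f::euclidean_space) \<Rightarrow> bool" where
  "smooth_fun_on M U f \<longleftrightarrow> (\<forall>p. smooth_on (chart M p ` (U \<inter> cdom M p)) (f \<circ> inv_chart M p))"

text \<open>Differential at \<open>p\<close>, applied to the tangent vector \<open>v\<close>, of a function with values in a
  Euclidean space, and of a map between manifolds.\<close>

definition dfun ::
    "('m, 'e::euclidean_space) charts \<Rightarrow> ('m \<Rightarrow> 'f::euclidean_space) \<Rightarrow> 'm \<Rightarrow> 'e \<Rightarrow> 'f" where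
  "dfun M f p v = frechet_derivative (f \<circ> inv_chart M p) (at (chart M p p)) v"

definition dmap ::
    "('m, 'e::euclidean_space) charts \<Rightarrow> ('p, 'n::euclidean_space) charts \<Rightarrow> ('m \<Rightarrow> 'p)
      \<Rightarrow> 'm \<Rightarrow> 'e \<Rightarrow> 'n" where
  "dmap M N F p v = dfun M (chart N (F p) \<circ> F) p v"

definition smooth_map ::
    "('m::topological_space, 'e::euclidean_space) charts
      \<Rightarrow> ('p::topological_space, 'n::euclidean_space) charts \<Rightarrow> ('m \<Rightarrow> 'p) \<Rightarrow> bool" where
  "smooth_map M N F \<longleftrightarrow> continuous_on UNIV F \<and>
     (\<forall>p. smooth_fun_on M (F -` cdom N p) (chart N p \<circ> F))"

text \<open>Components, in the chart \<open>chart M p\<close>, of the tangent vector \<open>v\<close> at the point \<open>q\<close>; and the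
  tangent vector at \<open>q\<close> whose components in the chart \<open>chart M p\<close> are \<open>v\<close>
  (so \<open>coord_field M p v\<close> is the coordinate vector field with constant components \<open>v\<close>).\<close>

definition components ::
    "('m, 'e::euclidean_space) charts \<Rightarrow> 'm \<Rightarrow> 'm \<Rightarrow> 'e \<Rightarrow> 'e" where
  "components M p q v = dfun M (chart M p) q v"

definition coord_field ::
    "('m, 'e::euclidean_space) charts \<Rightarrow> 'm \<Rightarrow> 'e \<Rightarrow> 'm \<Rightarrow> 'e" where
  "coord_field M p v q = frechet_derivative (chart M q \<circ> inv_chart M p) (at (chart M p q)) v"

definition smooth_vf_on ::
    "('m, 'e::euclidean_space) charts \<Rightarrow> 'm set \<Rightarrow> ('m \<Rightarrow> 'e) \<Rightarrow> bool" where
  "smooth_vf_on M U X \<longleftrightarrow> (\<forall>p. smooth_fun_on M (U \<inter> cdom M p) (\<lambda>q. components M p q (X q)))"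

definition smooth_one_form ::
    "('m::topological_space, 'e::euclidean_space) charts \<Rightarrow> ('m \<Rightarrow> 'e \<Rightarrow> real) \<Rightarrow> bool" where
  "smooth_one_form M \<omega> \<longleftrightarrow> (\<forall>p. linear (\<omega> p)) \<and>
     (\<forall>U X. open U \<longrightarrow> smooth_vf_on M U X \<longrightarrow> smooth_fun_on M U (\<lambda>q. \<omega> q (X q)))"

definition smooth_11_tensor ::
    "('m::topological_space, 'e::euclidean_space) charts \<Rightarrow> ('m \<Rightarrow> 'e \<Rightarrow> 'e) \<Rightarrow> bool" where
  "smooth_11_tensor M \<Phi> \<longleftrightarrow> (\<forall>p. linear (\<Phi> p)) \<and>
     (\<forall>U X. open U \<longrightarrow> smooth_vf_on M U X \<longrightarrow> smooth_vf_on M U (\<lambda>q. \<Phi> q (X q)))"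

section \<open>Riemannian geometry\<close>

type_synonym ('m, 'e) metric = "'m \<Rightarrow> 'e \<Rightarrow> 'e \<Rightarrow> real"

definition riemannian_manifold ::
    "('m::{t2_space,second_countable_topology}, 'e::euclidean_space) charts
      \<Rightarrow> ('m, 'e) metric \<Rightarrow> bool" where
  "riemannian_manifold M g \<longleftrightarrow> smooth_manifold M \<and>
     (\<forall>p. bilinear (g p) \<and> (\<forall>u v. g p u v = g p v u) \<and> (\<forall>v. v \<noteq> 0 \<longrightarrow> 0 < g p v v)) \<and>
     (\<forall>U X Y. open U \<longrightarrow> smooth_vf_on M U X \<longrightarrow> smooth_vf_on M U Y \<longrightarrow>
        smooth_fun_on M U (\<lambda>q. g q (X q) (Y q)))"

text \<open>The Levi-Civita connection at \<open>p\<close>, in the chart \<open>chart M p\<close>, is the ordinary derivative of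
  components plus the Christoffel map \<open>\<Gamma> u v = \<nabla>\<^sub>u E\<^sub>v\<close>, where \<open>E\<^sub>v\<close> is the coordinate field with
  components \<open>v\<close>. It is singled out by being torsion-free (\<open>\<Gamma>\<close> symmetric, as coordinate fields
  commute) and metric (\<open>u (g(E\<^sub>v, E\<^sub>w)) = g(\<nabla>\<^sub>u E\<^sub>v, E\<^sub>w) + g(E\<^sub>v, \<nabla>\<^sub>u E\<^sub>w)\<close>).\<close>

definition christoffel ::
    "('m, 'e::euclidean_space) charts \<Rightarrow> ('m, 'e) metric \<Rightarrow> 'm \<Rightarrow> 'e \<Rightarrow> 'e \<Rightarrow> 'e" where
  "christoffel M g p = (THE \<Gamma>. bilinear \<Gamma> \<and> (\<forall>u v. \<Gamma> u v = \<Gamma> v u) \<and>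
     (\<forall>u v w. dfun M (\<lambda>q. g q (coord_field M p v q) (coord_field M p w q)) p u
        = g p (\<Gamma> u v) w + g p v (\<Gamma> u w)))"

text \<open>\<open>cov_along M N h F W p u\<close> is the covariant derivative at \<open>p\<close>, in the direction \<open>u\<close> tangent to
  \<open>M\<close>, of a field \<open>W\<close> along the map \<open>F\<close> from \<open>M\<close> to \<open>N\<close> (\<open>W q\<close> is tangent to \<open>N\<close> at \<open>F q\<close>), for the
  Levi-Civita connection of the metric \<open>h\<close> of \<open>N\<close>. If \<open>W\<close> is tangent along an immersion \<open>F\<close>, this is the
  derivative \<open>\<nabla>\<^sub>X Y\<close> in the ambient manifold of any local extensions.\<close>

definition cov_along ::
    "('m, 'e::euclidean_space) charts \<Rightarrow> ('p, 'n::euclidean_space) charts \<Rightarrow> ('p, 'n) metric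
      \<Rightarrow> ('m \<Rightarrow> 'p) \<Rightarrow> ('m \<Rightarrow> 'n) \<Rightarrow> 'm \<Rightarrow> 'e \<Rightarrow> 'n" where
  "cov_along M N h F W p u =
     dfun M (\<lambda>q. components N (F p) (F q) (W q)) p u
     + christoffel N h (F p) (dmap M N F p u) (W p)"

definition cov ::
    "('m, 'e::euclidean_space) charts \<Rightarrow> ('m, 'e) metric \<Rightarrow> ('m \<Rightarrow> 'e) \<Rightarrow> 'm \<Rightarrow> 'e \<Rightarrow> 'e" where
  "cov M g Y p u = dfun M (\<lambda>q. components M p q (Y q)) p u + christoffel M g p u (Y p)"

definition grad ::
    "('m, 'e::euclidean_space) charts \<Rightarrow> ('m, 'e) metric \<Rightarrow> ('m \<Rightarrow> real) \<Rightarrow> 'm \<Rightarrow> 'e" where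
  "grad M g f p = (THE w. \<forall>v. g p w v = dfun M f p v)"

definition orthonormal_frame :: "('e::euclidean_space \<Rightarrow> 'e \<Rightarrow> real) \<Rightarrow> 'e set \<Rightarrow> bool" where
  "orthonormal_frame b B \<longleftrightarrow> finite B \<and> card B = DIM('e) \<and>
     (\<forall>u\<in>B. \<forall>v\<in>B. b u v = (if u = v then 1 else 0))"

section \<open>Submanifolds\<close>

text \<open>A submanifold of \<open>N\<close> is given by an immersion \<open>j\<close> of a manifold \<open>M\<close>.\<close>

definition pullback_metric ::
    "('m, 'e::euclidean_space) charts \<Rightarrow> ('p, 'n::euclidean_space) charts \<Rightarrow> ('p, 'n) metric
      \<Rightarrow> ('m \<Rightarrow> 'p) \<Rightarrow> ('m, 'e) metric" where
  "pullback_metric M N h j = (\<lambda>p u v. h (j p) (dmap M N j p u) (dmap M N j p v))"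

definition isometric_immersion ::
    "('m::topological_space, 'e::euclidean_space) charts \<Rightarrow> ('m, 'e) metric
      \<Rightarrow> ('p::topological_space, 'n::euclidean_space) charts \<Rightarrow> ('p, 'n) metric
      \<Rightarrow> ('m \<Rightarrow> 'p) \<Rightarrow> bool" where
  "isometric_immersion M g N h j \<longleftrightarrow> smooth_map M N j \<and> (\<forall>p. inj (dmap M N j p)) \<and>
     (\<forall>p u v. h (j p) (dmap M N j p u) (dmap M N j p v) = g p u v)"

definition tangent_space ::
    "('m, 'e::euclidean_space) charts \<Rightarrow> ('p, 'n::euclidean_space) charts \<Rightarrow> ('m \<Rightarrow> 'p)
      \<Rightarrow> 'm \<Rightarrow> 'n set" where
  "tangent_space M N j p = range (dmap M N j p)"

text \<open>Second fundamental form of \<open>j\<close> for the induced metric, from the Gauss formula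
  \<open>\<nabla>'\<^sub>X Y = \<nabla>\<^sub>X Y + \<Sigma>(X, Y)\<close>. It is tensorial, so at \<open>p\<close> the vector \<open>v\<close> is extended by the
  field with constant components in the chart at \<open>p\<close>.\<close>

definition second_ff ::
    "('m, 'e::euclidean_space) charts \<Rightarrow> ('p, 'n::euclidean_space) charts \<Rightarrow> ('p, 'n) metric
      \<Rightarrow> ('m \<Rightarrow> 'p) \<Rightarrow> 'm \<Rightarrow> 'e \<Rightarrow> 'e \<Rightarrow> 'n" where
  "second_ff M N h j p u v =
     (let Y = coord_field M p v
      in cov_along M N h j (\<lambda>q. dmap M N j q (Y q)) p u
         - dmap M N j p (cov M (pullback_metric M N h j) Y p u))"

definition second_ff_norm_sq ::
    "('m, 'e::euclidean_space) charts \<Rightarrow> ('p, 'n::euclidean_space) charts \<Rightarrow> ('p, 'n) metric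
      \<Rightarrow> ('m \<Rightarrow> 'p) \<Rightarrow> 'm \<Rightarrow> real" where
  "second_ff_norm_sq M N h j p =
     (let B = (SOME B. orthonormal_frame (pullback_metric M N h j p) B)
      in \<Sum>u\<in>B. \<Sum>v\<in>B. h (j p) (second_ff M N h j p u v) (second_ff M N h j p u v))"

definition totally_geodesic ::
    "('m, 'e::euclidean_space) charts \<Rightarrow> ('p, 'n::euclidean_space) charts \<Rightarrow> ('p, 'n) metric
      \<Rightarrow> ('m \<Rightarrow> 'p) \<Rightarrow> bool" where
  "totally_geodesic M N h j \<longleftrightarrow> (\<forall>p u v. second_ff M N h j p u v = 0)"

definition totally_umbilical ::
    "('m, 'e::euclidean_space) charts \<Rightarrow> ('p, 'n::euclidean_space) charts \<Rightarrow> ('p, 'n) metric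
      \<Rightarrow> ('m \<Rightarrow> 'p) \<Rightarrow> ('m \<Rightarrow> 'n) \<Rightarrow> bool" where
  "totally_umbilical M N h j H \<longleftrightarrow>
     (\<forall>p u v. second_ff M N h j p u v = pullback_metric M N h j p u v *\<^sub>R H p)"

section \<open>Almost contact metric manifolds\<close>

definition almost_contact_metric ::
    "('p::{t2_space,second_countable_topology}, 'n::euclidean_space) charts
      \<Rightarrow> ('p \<Rightarrow> 'n \<Rightarrow> 'n) \<Rightarrow> ('p \<Rightarrow> 'n) \<Rightarrow> ('p \<Rightarrow> 'n \<Rightarrow> real) \<Rightarrow> ('p, 'n) metric \<Rightarrow> bool" where
  "almost_contact_metric N \<Phi> \<xi> \<eta> g \<longleftrightarrow>
     odd DIM('n) \<and> riemannian_manifold N g \<and>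
     smooth_11_tensor N \<Phi> \<and> smooth_vf_on N UNIV \<xi> \<and> smooth_one_form N \<eta> \<and>
     (\<forall>p X. \<Phi> p (\<Phi> p X) = - X + \<eta> p X *\<^sub>R \<xi> p) \<and>
     (\<forall>p. \<eta> p (\<xi> p) = 1) \<and> (\<forall>p. \<Phi> p (\<xi> p) = 0) \<and> (\<forall>p X. \<eta> p (\<Phi> p X) = 0) \<and>
     (\<forall>p X Y. g p (\<Phi> p X) (\<Phi> p Y) = g p X Y - \<eta> p X * \<eta> p Y)"

text \<open>\<open>\<nabla>\<^sub>X\<close> at \<open>p\<close> depends on \<open>X\<close> only through its value at \<open>p\<close>, so \<open>X\<close> is a tangent vector below;
  \<open>Y\<close> ranges over all local smooth vector fields.\<close>

definition loc_conf_almost_cosymplectic ::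
    "('p::{t2_space,second_countable_topology}, 'n::euclidean_space) charts
      \<Rightarrow> ('p \<Rightarrow> 'n \<Rightarrow> 'n) \<Rightarrow> ('p \<Rightarrow> 'n) \<Rightarrow> ('p \<Rightarrow> 'n \<Rightarrow> real) \<Rightarrow> ('p, 'n) metric
      \<Rightarrow> ('p \<Rightarrow> real) \<Rightarrow> bool" where
  "loc_conf_almost_cosymplectic N \<Phi> \<xi> \<eta> g \<beta> \<longleftrightarrow>
     almost_contact_metric N \<Phi> \<xi> \<eta> g \<and> smooth_fun_on N UNIV \<beta> \<and>
     (\<forall>U Y. open U \<longrightarrow> smooth_vf_on N U Y \<longrightarrow> (\<forall>p\<in>U. \<forall>X.
        cov N g (\<lambda>q. \<Phi> q (Y q)) p X - \<Phi> p (cov N g Y p X)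
        = \<beta> p *\<^sub>R (g p (\<Phi> p X) (Y p) *\<^sub>R \<xi> p - \<eta> p (Y p) *\<^sub>R \<Phi> p X))) \<and>
     (\<forall>p X. cov N g \<xi> p X = \<beta> p *\<^sub>R (X - \<eta> p X *\<^sub>R \<xi> p))"

section \<open>Slant submanifolds\<close>

definition orth_proj :: "('n::euclidean_space \<Rightarrow> 'n \<Rightarrow> real) \<Rightarrow> 'n set \<Rightarrow> 'n \<Rightarrow> 'n" where
  "orth_proj b W v = (THE w. w \<in> W \<and> (\<forall>u\<in>W. b (v - w) u = 0))"

definition angle_to_subspace :: "('n::euclidean_space \<Rightarrow> 'n \<Rightarrow> real) \<Rightarrow> 'n \<Rightarrow> 'n set \<Rightarrow> real" where
  "angle_to_subspace b v W =
     arccos (sqrt (b (orth_proj b W v) (orth_proj b W v)) / sqrt (b v v))"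

text \<open>Linear independence of \<open>X\<close> and \<open>\<xi>\<close> is \<open>X \<notin> span {\<xi>}\<close> because \<open>\<xi>\<close> is nowhere zero; independence of
  the set \<open>{X, \<xi>}\<close> would also admit \<open>X = \<xi>\<close>.\<close>

definition slant_tangent_xi ::
    "('m, 'e::euclidean_space) charts \<Rightarrow> ('p, 'n::euclidean_space) charts \<Rightarrow> ('p \<Rightarrow> 'n \<Rightarrow> 'n)
      \<Rightarrow> ('p \<Rightarrow> 'n) \<Rightarrow> ('p, 'n) metric \<Rightarrow> ('m \<Rightarrow> 'p) \<Rightarrow> real \<Rightarrow> bool" where
  "slant_tangent_xi M N \<Phi> \<xi> g j \<nu> \<longleftrightarrow> 0 \<le> \<nu> \<and> \<nu> \<le> pi / 2 \<and>
     (\<forall>p. \<xi> (j p) \<in> tangent_space M N j p \<and>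
        (\<forall>X\<in>tangent_space M N j p. X \<notin> span {\<xi> (j p)} \<longrightarrow>
           angle_to_subspace (g (j p)) (\<Phi> (j p) X) (tangent_space M N j p) = \<nu>))"

definition slant_orthogonal_xi ::
    "('m, 'e::euclidean_space) charts \<Rightarrow> ('p, 'n::euclidean_space) charts \<Rightarrow> ('p \<Rightarrow> 'n \<Rightarrow> 'n)
      \<Rightarrow> ('p \<Rightarrow> 'n) \<Rightarrow> ('p, 'n) metric \<Rightarrow> ('m \<Rightarrow> 'p) \<Rightarrow> real \<Rightarrow> bool" where
  "slant_orthogonal_xi M N \<Phi> \<xi> g j \<nu> \<longleftrightarrow> 0 \<le> \<nu> \<and> \<nu> \<le> pi / 2 \<and>
     (\<forall>p. \<forall>X\<in>tangent_space M N j p. g (j p) X (\<xi> (j p)) = 0 \<and>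
        (X \<noteq> 0 \<longrightarrow>
           angle_to_subspace (g (j p)) (\<Phi> (j p) X) (tangent_space M N j p) = \<nu>))"

section \<open>Bi-warped products\<close>

definition warping_function ::
    "('a, 'e::euclidean_space) charts \<Rightarrow> ('a \<Rightarrow> real) \<Rightarrow> bool" where
  "warping_function M f \<longleftrightarrow> smooth_fun_on M UNIV f \<and> (\<forall>x. 0 < f x) \<and> (\<exists>x x'. f x \<noteq> f x')"

text \<open>In the product charts the differentials of the projections are the projections of the model
  spaces, so the pullbacks in the warped metric reduce to taking components.\<close>

definition bi_warped_metric ::
    "('a, 'e) metric \<Rightarrow> ('b, 'f) metric \<Rightarrow> ('c, 'h) metric \<Rightarrow> ('a \<Rightarrow> real) \<Rightarrow> ('a \<Rightarrow> real)
      \<Rightarrow> ('a \<times> 'b \<times> 'c, 'e \<times> 'f \<times> 'h) metric" where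
  "bi_warped_metric g1 g2 g3 f2 f3 = (\<lambda>(x, y, z) (u, v, w) (u', v', w').
     g1 x u u' + (f2 x)\<^sup>2 * g2 y v v' + (f3 x)\<^sup>2 * g3 z w w')"

text \<open>
  \<open>bi_warped_submanifold\<close>: the isometric immersion \<open>\<iota>\<close> makes \<open>L1 \<times>\<^sub>f\<^sub>2 L2 \<times>\<^sub>f\<^sub>3 L3\<close> a bi-warped product
  submanifold of \<open>N\<close> whose leaves are, respectively, invariant and tangent to \<open>\<xi>\<close>, anti-invariant,
  and proper slant with angle \<open>\<nu>\<close>. The last clause says that \<open>\<Phi>\<close> maps the distribution tangent to the
  second factor into the normal bundle of the whole submanifold, as is part of the setting of
  anti-invariant distributions; anti-invariance of the leaves only gives normality to the leaves.
  The invariance of the first distribution under \<open>\<Phi>\<close> and the orthogonal splitting of the normal bundle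
  follow from these clauses.
\<close>

definition bi_warped_submanifold ::
    "('a::{t2_space,second_countable_topology}, 'e::euclidean_space) charts \<Rightarrow> ('a, 'e) metric
      \<Rightarrow> ('b::{t2_space,second_countable_topology}, 'f::euclidean_space) charts \<Rightarrow> ('b, 'f) metric
      \<Rightarrow> ('c::{t2_space,second_countable_topology}, 'h::euclidean_space) charts \<Rightarrow> ('c, 'h) metric
      \<Rightarrow> ('a \<Rightarrow> real) \<Rightarrow> ('a \<Rightarrow> real)
      \<Rightarrow> ('p::{t2_space,second_countable_topology}, 'n::euclidean_space) charts
      \<Rightarrow> ('p \<Rightarrow> 'n \<Rightarrow> 'n) \<Rightarrow> ('p \<Rightarrow> 'n) \<Rightarrow> ('p, 'n) metric
      \<Rightarrow> ('a \<times> 'b \<times> 'c \<Rightarrow> 'p) \<Rightarrow> real \<Rightarrow> bool" where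
  "bi_warped_submanifold L1 g1 L2 g2 L3 g3 f2 f3 N \<Phi> \<xi> g \<iota> \<nu> \<longleftrightarrow>
     riemannian_manifold L1 g1 \<and> riemannian_manifold L2 g2 \<and> riemannian_manifold L3 g3 \<and>
     warping_function L1 f2 \<and> warping_function L1 f3 \<and>
     isometric_immersion (prod_charts L1 (prod_charts L2 L3)) (bi_warped_metric g1 g2 g3 f2 f3)
       N g \<iota> \<and>
     (\<forall>y z. slant_tangent_xi L1 N \<Phi> \<xi> g (\<lambda>x. \<iota> (x, y, z)) 0) \<and>
     (\<forall>x z. slant_orthogonal_xi L2 N \<Phi> \<xi> g (\<lambda>y. \<iota> (x, y, z)) (pi / 2)) \<and>
     0 < \<nu> \<and> \<nu> < pi / 2 \<and>
     (\<forall>x y. slant_orthogonal_xi L3 N \<Phi> \<xi> g (\<lambda>z. \<iota> (x, y, z)) \<nu>) \<and>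
     (let L = prod_charts L1 (prod_charts L2 L3)
      in \<forall>p v t. g (\<iota> p) (\<Phi> (\<iota> p) (dmap L N \<iota> p (0, v, 0))) (dmap L N \<iota> p t) = 0)"

end

theory Submission
  imports Defs
begin

text \<open>
  At a point, let \<open>S u v\<close> be the ambient covariant derivative of the coordinate field of \<open>L\<close> with
  components \<open>v\<close> in the direction \<open>u\<close>. In charts, \<open>S\<close> is the Hessian of the immersion plus the Christoffel
  map of the ambient manifold, and the second fundamental form is the normal part of \<open>S\<close>. Its tangential
  part is the Christoffel map of \<open>L\<close>, which is explicit for a bi-warped product.

  For \<open>X\<close> tangent to the invariant leaf and \<open>Z\<close> tangent to one of the other leaves, \<open>g(\<Phi>X, Z) = 0\<close>
  identically on \<open>L\<close>. Differentiating this in the direction of \<open>Z'\<close>, tangent to the same leaf as \<open>Z\<close>, and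
  using the formula for the covariant derivative of \<open>\<Phi>\<close>, gives the components \<open>g(\<Sigma>(X, Z'), \<Phi>Z)\<close>;
  differentiating \<open>g(\<xi>, Z) = 0\<close> gives \<open>\<xi>(ln \<phi>\<^sub>i) = \<beta>\<close>. Bessel's inequality for the orthogonal families
  \<open>\<Phi>Z\<close> and \<open>FZ\<close> and a summation over orthonormal frames then bound the mixed terms of \<open>\<parallel>\<Sigma>\<parallel>\<^sup>2\<close> from below
  by the right-hand side. In the case of equality all the other terms vanish, and comparing the
  Christoffel maps of \<open>L\<close> and of its leaves gives (ii).
\<close>

section \<open>Positive definite forms\<close>

text \<open>Every pair of a vector of the invariant factor and a vector of another factor is counted
  twice in |\<Sigma>|^2, whence the leading 2, and 4 t3 is twice the dimension of the slant factor.
  The subtracted \<beta>^2 comes from |\<Phi>G|^2 = |G|^2 - g(\<xi>, G)^2 for a gradient G with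
  g(\<xi>, G) = \<beta>. In the slant case FZ has squared length sin^2 \<nu>, by which Bessel's
  inequality divides. The components of \<Sigma> have one part from \<Phi>X and one proportional to
  g(\<Phi>Z, Z'); these do not interfere because g(\<Phi>Z, Z) = 0, and they contribute 1 and cos^2
  \<nu>, where 1 + cos^2 \<nu> = sin^2 \<nu> + 2 cos^2 \<nu>. What shapes the formal side is that
  vectors at different points are read in different charts, so no field can be differentiated before
  it is rewritten in one fixed chart. The differentiated identities are therefore stated for
  coordinate fields and handled by expansion over a basis. Inner products are explicit forms, since
  they vary with the point while the one of the type class is fixed.\<close>

locale inner_form =
  fixes b :: "'e::euclidean_space \<Rightarrow> 'e \<Rightarrow> real"
  assumes bilin: "bilinear b"
    and sym: "b u v = b v u"
    and pos: "v \<noteq> 0 \<Longrightarrow> 0 < b v v"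
begin

lemma linear_right: "linear (b u)" and linear_left: "linear (\<lambda>u. b u v)"
  using bilin by (auto simp: bilinear_def)

lemmas add_left = bilinear_ladd[OF bilin] and add_right = bilinear_radd[OF bilin]
  and diff_left = bilinear_lsub[OF bilin] and diff_right = bilinear_rsub[OF bilin]
  and minus_left = bilinear_lneg[OF bilin] and minus_right = bilinear_rneg[OF bilin]
  and zero_left [simp] = bilinear_lzero[OF bilin] and zero_right [simp] = bilinear_rzero[OF bilin]

lemma scale_left: "b (c *\<^sub>R u) v = c * b u v" and scale_right: "b u (c *\<^sub>R v) = c * b u v"
  using bilinear_lmul[OF bilin, of c u v] bilinear_rmul[OF bilin, of u c v] by auto

lemma sum_left: "b (sum f S) v = (\<Sum>i\<in>S. b (f i) v)" and sum_right: "b u (sum f S) = (\<Sum>i\<in>S. b u (f i))"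
  using linear_sum[OF linear_left] linear_sum[OF linear_right] by auto

lemmas form_simps = add_left add_right diff_left diff_right minus_left minus_right
  scale_left scale_right sum_left sum_right

lemma nonneg: "0 \<le> b v v"
  using pos[of v] by (cases "v = 0") auto

lemma zero_iff [simp]: "b v v = 0 \<longleftrightarrow> v = 0"
  using pos[of v] by (cases "v = 0") auto

lemma form_ext: "u = v" if "\<And>w. b u w = b v w"
proof -
  have "b (u - v) (u - v) = 0" using that by (simp add: diff_left)
  then show ?thesis by simp
qed

text \<open>The form is represented by an operator \<open>A\<close> with respect to the Euclidean
  inner product. Positivity makes \<open>A\<close> injective, and an injective endomorphism in
  finite dimension is onto. Gradients and Christoffel maps are obtained in this way.\<close>

lemma riesz:
  assumes "linear l"
  shows "\<exists>!w. \<forall>v. b w v = l v"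
proof -
  define A where "A w = (\<Sum>i\<in>Basis. b w i *\<^sub>R i)" for w
  have A: "A w \<bullet> v = b w v" for w v
  proof -
    have "A w \<bullet> v = (\<Sum>i\<in>Basis. b w i * (v \<bullet> i))"
      unfolding A_def by (simp add: inner_sum_left inner_commute[of v])
    also have "\<dots> = b w (\<Sum>i\<in>Basis. (v \<bullet> i) *\<^sub>R i)" by (simp add: form_simps mult.commute)
    finally show ?thesis by (simp add: euclidean_representation)
  qed
  have lin: "linear A"
    unfolding A_def by (intro linear_compose_sum ballI linearI) (auto simp: form_simps algebra_simps)
  have "inj A"
    unfolding linear_injective_0[OF lin] by (metis A inner_zero_left zero_iff)
  then have "surj A" using lin linear_injective_imp_surjective by blast
  then obtain w where w: "A w = (\<Sum>i\<in>Basis. l i *\<^sub>R i)" by (metis surjD)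
  have "b w v = l v" for v
  proof -
    have "b w v = (\<Sum>i\<in>Basis. l i *\<^sub>R i) \<bullet> v" using A w by metis
    also have "\<dots> = (\<Sum>i\<in>Basis. (v \<bullet> i) *\<^sub>R l i)"
      by (simp add: inner_sum_left inner_commute[of v] mult.commute)
    also have "\<dots> = l (\<Sum>i\<in>Basis. (v \<bullet> i) *\<^sub>R i)"
      by (simp add: linear_sum[OF assms] linear_scale[OF assms])
    finally show ?thesis by (simp add: euclidean_representation)
  qed
  then show ?thesis by (metis form_ext)
qed

section \<open>Orthonormal frames\<close>

lemma orthonormal_independent:
  assumes "finite B" "\<And>u v. u \<in> B \<Longrightarrow> v \<in> B \<Longrightarrow> b u v = (if u = v then 1 else 0)"
  shows "independent B"
proof (rule ccontr)
  assume "\<not> independent B"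
  then obtain c v where v: "v \<in> B" "c v \<noteq> 0" "(\<Sum>u\<in>B. c u *\<^sub>R u) = 0"
    using assms(1) by (auto simp: dependent_finite)
  have "0 = b (\<Sum>u\<in>B. c u *\<^sub>R u) v" using v by simp
  also have "\<dots> = (\<Sum>u\<in>B. if u = v then c u else 0)"
    unfolding sum_left by (intro sum.cong) (auto simp: scale_left assms(2) v(1))
  also have "\<dots> = c v" using assms(1) v(1) by simp
  finally show False using v by simp
qed

text \<open>Gram-Schmidt, run by induction on the number of vectors: fewer vectors than the
  dimension cannot span, so some vector outside the span survives the subtraction of its
  projection.\<close>

lemma orthonormal_frame_exists: "\<exists>B. orthonormal_frame b B"
proof -
  have "\<exists>B. finite B \<and> card B = n \<and> (\<forall>u\<in>B. \<forall>v\<in>B. b u v = (if u = v then 1 else 0))"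
    if "n \<le> DIM('e)" for n
    using that
  proof (induction n)
    case 0
    show ?case by (rule exI[of _ "{}"]) auto
  next
    case (Suc n)
    then obtain B where B: "finite B" "card B = n"
      "\<And>u v. u \<in> B \<Longrightarrow> v \<in> B \<Longrightarrow> b u v = (if u = v then 1 else 0)" by auto
    have "dim (span B) < DIM('e)" using dim_le_card'[OF B(1)] B(2) Suc.prems by simp
    then have "span B \<noteq> UNIV" by (metis dim_UNIV less_irrefl)
    then obtain x where x: "x \<notin> span B" by auto
    define w where "w = x - (\<Sum>e\<in>B. b x e *\<^sub>R e)"
    have "(\<Sum>e\<in>B. b x e *\<^sub>R e) \<in> span B" by (intro span_sum span_scale span_base)
    then have w0: "w \<noteq> 0" using x by (auto simp: w_def)
    have wB: "b w v = 0" if "v \<in> B" for v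
    proof -
      have "(\<Sum>e\<in>B. b x e * b e v) = (\<Sum>e\<in>B. if e = v then b x e else 0)"
        by (intro sum.cong) (auto simp: B(3) that)
      then show ?thesis using B(1) that by (simp add: w_def form_simps)
    qed
    define e where "e = (1 / sqrt (b w w)) *\<^sub>R w"
    have ee: "b e e = 1" using pos[OF w0] by (auto simp: e_def scale_left scale_right simp del: zero_iff)
    have eB: "b e v = 0" "b v e = 0" if "v \<in> B" for v
      using wB[OF that] sym[of v w] by (auto simp: e_def scale_left scale_right)
    have "e \<notin> B" using eB ee by fastforce
    then show ?case using B ee eB by (intro exI[of _ "insert e B"]) auto
  qed
  then show ?thesis unfolding orthonormal_frame_def by blast
qed

lemma frame_span:
  assumes "orthonormal_frame b B"
  shows "span B = UNIV"
proof -
  have "independent B" using assms orthonormal_independent by (auto simp: orthonormal_frame_def)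
  then show ?thesis
    using assms card_ge_dim_independent[of B UNIV] by (auto simp: orthonormal_frame_def)
qed

lemma frame_expansion:
  assumes B: "orthonormal_frame b B"
  shows "v = (\<Sum>e\<in>B. b v e *\<^sub>R e)"
proof -
  define w where "w = v - (\<Sum>e\<in>B. b v e *\<^sub>R e)"
  have wB: "b w e = 0" if "e \<in> B" for e
  proof -
    have "(\<Sum>d\<in>B. b v d * b d e) = (\<Sum>d\<in>B. if d = e then b v d else 0)"
      using B that by (intro sum.cong) (auto simp: orthonormal_frame_def)
    then show ?thesis using B that by (simp add: w_def form_simps orthonormal_frame_def)
  qed
  have "w \<in> span B" using frame_span[OF B] by simp
  then have "b w w = 0"
    using linear_eq_0_on_span[OF linear_right wB] by blast
  then show ?thesis by (simp add: w_def)
qed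

lemma parseval:
  assumes B: "orthonormal_frame b B"
  shows "(\<Sum>e\<in>B. b u e * b v e) = b u v"
proof -
  have "b u v = b u (\<Sum>e\<in>B. b v e *\<^sub>R e)" using frame_expansion[OF B, of v] by simp
  then show ?thesis by (simp add: form_simps mult.commute)
qed

text \<open>Expanding one argument in the other frame turns both traces into the same double sum of
  \<open>b u c * q u c\<close>. It is needed because \<open>second_ff_norm_sq\<close> fixes a frame
  by an unspecified choice, while the estimate uses frames adapted to the factors.\<close>

lemma frame_sum_independent:
  assumes B: "orthonormal_frame b B" and C: "orthonormal_frame b C" and q: "bilinear q"
  shows "(\<Sum>u\<in>B. q u u) = (\<Sum>u\<in>C. q u u :: real)"
proof -
  have fin: "finite B" "finite C" using B C by (auto simp: orthonormal_frame_def)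
  have "(\<Sum>u\<in>B. q u u) = (\<Sum>u\<in>B. \<Sum>c\<in>C. b u c * q u c)"
  proof (intro sum.cong refl)
    fix u
    have l: "linear (q u)" using q by (simp add: bilinear_def)
    have "q u u = q u (\<Sum>c\<in>C. b u c *\<^sub>R c)" using frame_expansion[OF C, of u] by simp
    then show "q u u = (\<Sum>c\<in>C. b u c * q u c)" by (simp add: linear_sum[OF l] linear_scale[OF l])
  qed
  also have "\<dots> = (\<Sum>c\<in>C. \<Sum>u\<in>B. b u c * q u c)" by (rule sum.swap)
  also have "\<dots> = (\<Sum>c\<in>C. q c c)"
  proof (intro sum.cong refl)
    fix c
    have l: "linear (\<lambda>u. q u c)" using q by (simp add: bilinear_def)
    have "q c c = q (\<Sum>u\<in>B. b c u *\<^sub>R u) c" using frame_expansion[OF B, of c] by simp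
    then show "(\<Sum>u\<in>B. b u c * q u c) = q c c"
      by (simp add: linear_sum[OF l] linear_scale[OF l] sym)
  qed
  finally show ?thesis .
qed

text \<open>\<open>w\<close> is the orthogonal projection of \<open>v\<close> to the span of the
  family, and \<open>b w w = b w v\<close> turns \<open>0 \<le> b (v - w) (v - w)\<close> into the
  claim. A common squared length \<open>s\<close> in place of 1 is allowed because the family used
  in the slant directions has squared length \<open>(sin \<nu>)\<^sup>2\<close>.\<close>

lemma bessel:
  assumes "finite S" "\<And>i j. i \<in> S \<Longrightarrow> j \<in> S \<Longrightarrow> b (f i) (f j) = (if i = j then s else 0)" "0 < s"
  shows "(\<Sum>i\<in>S. (b v (f i))\<^sup>2) / s \<le> b v v"
proof -
  define w where "w = (\<Sum>i\<in>S. (b v (f i) / s) *\<^sub>R f i)"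
  have wv: "b w v = (\<Sum>i\<in>S. (b v (f i))\<^sup>2) / s"
    by (simp add: w_def form_simps sym[of _ v] power2_eq_square sum_divide_distrib)
  have "b w (f j) = b v (f j)" if "j \<in> S" for j
  proof -
    have "b w (f j) = (\<Sum>i\<in>S. if i = j then b v (f i) else 0)"
      unfolding w_def sum_left using assms that by (intro sum.cong) (auto simp: scale_left)
    then show ?thesis using assms(1) that by simp
  qed
  then have "b w w = (\<Sum>i\<in>S. b v (f i) / s * b v (f i))"
    by (subst (2) w_def) (simp add: form_simps)
  then have "b w w = b w v" using wv by (simp add: power2_eq_square sum_divide_distrib)
  then have "0 \<le> b v v - b w v"
    using nonneg[of "v - w"] sym[of v w] by (simp add: form_simps)
  then show ?thesis using wv by simp
qed

end

section \<open>Pulled back forms, orthogonal projections and angles\<close>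

lemma inner_form_pullback:
  fixes A :: "'e::euclidean_space \<Rightarrow> 'n::euclidean_space"
  assumes "inner_form h" "linear A" "inj A"
  shows "inner_form (\<lambda>u v. h (A u) (A v))"
proof -
  interpret inner_form h by fact
  have "A v \<noteq> 0" if "v \<noteq> 0" for v using assms(2,3) that by (metis injD linear_0)
  then have pos': "0 < h (A v) (A v)" if "v \<noteq> 0" for v using pos that by blast
  show ?thesis
  proof
    show "bilinear (\<lambda>u v. h (A u) (A v))"
      using linear_compose[OF assms(2) linear_left] linear_compose[OF assms(2) linear_right]
      by (simp add: bilinear_def o_def)
  qed (use sym pos' in auto)
qed

lemma inner_form_scale:
  assumes "inner_form b" "0 < c"
  shows "inner_form (\<lambda>u v. c * b u v)"
proof -
  interpret inner_form b by fact
  show ?thesis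
  proof
    show "bilinear (\<lambda>u v. c * b u v)"
      by (auto simp: bilinear_def add_left add_right scale_left scale_right distrib_left intro!: linearI)
    show "c * b u v = c * b v u" for u v by (simp add: sym[of u v])
    show "0 < c * b v v" if "v \<noteq> 0" for v using assms(2) pos[OF that] by simp
  qed
qed

text \<open>The vector \<open>w0\<close> with coefficients \<open>h v (A e)\<close> leaves a
  remainder orthogonal to the range. A second candidate differs from it by a vector that lies in the
  range and is orthogonal to it, hence by zero. So the description in \<open>orth_proj\<close> is
  realized, and the norm is read off the coefficients.\<close>

lemma norm_proj_range:
  fixes A :: "'e::euclidean_space \<Rightarrow> 'n::euclidean_space" and v :: 'n
  assumes h: "inner_form h" and A: "linear A" "inj A"
    and B: "orthonormal_frame (\<lambda>u v. h (A u) (A v)) B"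
  defines "w \<equiv> orth_proj h (range A) v"
  shows "w \<in> range A" "h (v - w) w = 0" "h w w = (\<Sum>e\<in>B. (h v (A e))\<^sup>2)"
proof -
  interpret inner_form h by fact
  interpret P: inner_form "\<lambda>u v. h (A u) (A v)" by (rule inner_form_pullback[OF h A])
  define w0 where "w0 = A (\<Sum>e\<in>B. h v (A e) *\<^sub>R e)"
  have w0: "w0 = (\<Sum>e\<in>B. h v (A e) *\<^sub>R A e)"
    by (simp add: w0_def linear_sum[OF A(1)] linear_scale[OF A(1)])
  have orth: "h (v - w0) (A u) = 0" for u
  proof -
    have "h v (A u) = h v (A (\<Sum>e\<in>B. h (A u) (A e) *\<^sub>R e))" using P.frame_expansion[OF B, of u] by simp
    also have "\<dots> = (\<Sum>e\<in>B. h (A u) (A e) * h v (A e))"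
      by (simp add: linear_sum[OF A(1)] linear_scale[OF A(1)] form_simps)
    finally show ?thesis by (simp add: w0 form_simps sym mult.commute)
  qed
  have "w = w0" unfolding w_def orth_proj_def
  proof (rule the_equality)
    show "w0 \<in> range A \<and> (\<forall>u\<in>range A. h (v - w0) u = 0)" using orth by (auto simp: w0_def)
  next
    fix x assume x: "x \<in> range A \<and> (\<forall>u\<in>range A. h (v - x) u = 0)"
    then obtain t where t: "x = A t" by auto
    have "h (x - w0) (A u) = 0" for u
    proof -
      have "h (x - w0) (A u) = h (v - w0) (A u) - h (v - x) (A u)" by (simp add: form_simps)
      then show ?thesis using orth x by simp
    qed
    moreover have "x - w0 = A (t - (\<Sum>e\<in>B. h v (A e) *\<^sub>R e))"
      by (simp add: t w0_def linear_diff[OF A(1)])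
    ultimately have "h (x - w0) (x - w0) = 0" by metis
    then show "x = w0" by simp
  qed
  then show "w \<in> range A" "h (v - w) w = 0" using orth by (auto simp: w0_def)
  have "h w0 w0 = h v w0"
    using orth[of "\<Sum>e\<in>B. h v (A e) *\<^sub>R e"] by (simp add: diff_left flip: w0_def)
  also have "\<dots> = (\<Sum>e\<in>B. (h v (A e))\<^sup>2)"
    by (subst w0) (simp add: sum_right scale_right power2_eq_square)
  finally show "h w w = (\<Sum>e\<in>B. (h v (A e))\<^sup>2)" by (simp add: \<open>w = w0\<close>)
qed

text \<open>Pythagoras bounds the quotient of the norms by 1, so \<open>arccos\<close> can be
  inverted. The angle condition becomes an identity of squared lengths, the form in which the slant
  conditions are used afterwards.\<close>

lemma angle_to_range:
  fixes A :: "'e::euclidean_space \<Rightarrow> 'n::euclidean_space"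
  assumes h: "inner_form h" and A: "linear A" "inj A" and v: "v \<noteq> 0"
    and ang: "angle_to_subspace h v (range A) = \<theta>"
  defines "w \<equiv> orth_proj h (range A) v"
  shows "h w w = (cos \<theta>)\<^sup>2 * h v v"
proof -
  interpret inner_form h by fact
  interpret P: inner_form "\<lambda>u v. h (A u) (A v)" by (rule inner_form_pullback[OF h A])
  obtain B where B: "orthonormal_frame (\<lambda>u v. h (A u) (A v)) B"
    using P.orthonormal_frame_exists by blast
  note w = norm_proj_range[OF h A B, of v, folded w_def]
  have "h v v = h w w + h (v - w) (v - w)" using w(2) sym[of v w] by (simp add: form_simps)
  then have le: "h w w \<le> h v v" using nonneg[of "v - w"] by linarith
  define r where "r = sqrt (h w w) / sqrt (h v v)"
  have r: "0 \<le> r" "r \<le> 1" "r\<^sup>2 = h w w / h v v"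
    using le pos[OF v] nonneg[of w] by (auto simp: r_def power_divide)
  have "arccos r = \<theta>" using ang by (simp add: angle_to_subspace_def r_def w_def)
  then have "cos \<theta> = r" using cos_arccos[of r] r by auto
  then show ?thesis using r(3) pos[OF v] v by simp
qed

section \<open>Calculus of smooth functions\<close>

lemma frechet_derivative_eqI: "(f has_derivative f') (at x) \<Longrightarrow> frechet_derivative f (at x) = f'"
  using frechet_derivative_at by metis

lemma has_derivative_frechet: "f differentiable (at x) \<Longrightarrow> (f has_derivative frechet_derivative f (at x)) (at x)"
  by (simp add: frechet_derivative_works)

text \<open>\<open>frechet_derivative\<close> is a choice among all derivatives. Functions that
  agree near the point have the same ones, so the choices coincide even without
  differentiability.\<close>

lemma frechet_derivative_cong_open:
  assumes "open S" "x \<in> S" "\<And>y. y \<in> S \<Longrightarrow> f y = g y"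
  shows "frechet_derivative f (at x) = frechet_derivative g (at x)"
proof -
  have "(f has_derivative D) (at x) \<longleftrightarrow> (g has_derivative D) (at x)" for D
    using assms has_derivative_transform_within_open[of f D x UNIV S g]
      has_derivative_transform_within_open[of g D x UNIV S f] by metis
  then show ?thesis by (simp add: frechet_derivative_def)
qed

lemma differentiable_cong_open:
  assumes "open S" "x \<in> S" "\<And>y. y \<in> S \<Longrightarrow> f y = g y" "f differentiable (at x)"
  shows "g differentiable (at x)"
  using assms has_derivative_transform_within_open[of f _ x UNIV S g] unfolding differentiable_def by metis

section \<open>Closure properties of C^k functions\<close>

lemma Ck_on_cong:
  assumes "open S" "\<And>x. x \<in> S \<Longrightarrow> f x = g x" "Ck_on k S f"
  shows "Ck_on k S g"
  using assms(2,3)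
proof (induction k arbitrary: f g)
  case 0
  then show ?case using continuous_on_cong[OF refl, of S f g] by simp
next
  case (Suc k)
  have "Ck_on k S (\<lambda>x. frechet_derivative g (at x) v)" for v
    using Suc.IH[of "\<lambda>x. frechet_derivative f (at x) v" "\<lambda>x. frechet_derivative g (at x) v"]
      frechet_derivative_cong_open[OF assms(1) _ Suc.prems(1)] Suc.prems(2) by simp
  moreover have "g differentiable (at x)" if "x \<in> S" for x
    using differentiable_cong_open[OF assms(1) that Suc.prems(1)] Suc.prems(2) that by simp
  ultimately show ?case by simp
qed

lemma Ck_on_subset: "Ck_on k T f \<Longrightarrow> S \<subseteq> T \<Longrightarrow> Ck_on k S f"
  by (induction k arbitrary: f) (auto intro: continuous_on_subset)

lemma Ck_on_Suc_imp: "Ck_on (Suc k) S f \<Longrightarrow> Ck_on k S f"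
proof (induction k arbitrary: f)
  case 0
  then show ?case
    using differentiable_imp_continuous_within[of f _ UNIV] by (auto intro: continuous_at_imp_continuous_on)
qed auto

lemma Ck_on_const: "Ck_on k S (\<lambda>x. c)"
  by (induction k arbitrary: c) auto

lemma Ck_on_linear:
  assumes "linear f"
  shows "Ck_on k S f"
proof (cases k)
  case 0
  then show ?thesis using linear_continuous_on_compose[OF continuous_on_id assms] by simp
next
  case (Suc k)
  have "(f has_derivative f) (at x)" for x using linear_imp_has_derivative[OF assms] .
  then show ?thesis
    using Suc by (auto simp: frechet_derivative_eqI[of f f] Ck_on_const differentiable_def)
qed

lemma Ck_on_add:
  assumes "open S" "Ck_on k S f" "Ck_on k S g"
  shows "Ck_on k S (\<lambda>x. f x + g x)"
  using assms(2,3)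
proof (induction k arbitrary: f g)
  case 0
  then show ?case by (auto intro: continuous_on_add)
next
  case (Suc k)
  have "Ck_on k S (\<lambda>x. frechet_derivative (\<lambda>x. f x + g x) (at x) v)" for v
  proof (rule Ck_on_cong[OF assms(1)])
    show "Ck_on k S (\<lambda>x. frechet_derivative f (at x) v + frechet_derivative g (at x) v)"
      using Suc by simp
    show "frechet_derivative f (at x) v + frechet_derivative g (at x) v
        = frechet_derivative (\<lambda>x. f x + g x) (at x) v" if "x \<in> S" for x
      using Suc.prems that
      by (simp add: frechet_derivative_eqI[OF has_derivative_add[OF has_derivative_frechet has_derivative_frechet]])
  qed
  then show ?case using Suc.prems by (auto intro: differentiable_add)
qed

lemma Ck_on_scaleR:
  assumes "open S" "Ck_on k S a" "Ck_on k S f"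
  shows "Ck_on k S (\<lambda>x. a x *\<^sub>R f x)"
  using assms(2,3)
proof (induction k arbitrary: a f)
  case 0
  then show ?case by (auto intro: continuous_on_scaleR)
next
  case (Suc k)
  \<comment> \<open>The product rule leaves the undifferentiated factors in place, so the induction
    needs them at order \<open>k\<close> as well.\<close>
  note pre = Ck_on_Suc_imp[OF Suc.prems(1)] Ck_on_Suc_imp[OF Suc.prems(2)]
  have "Ck_on k S (\<lambda>x. frechet_derivative (\<lambda>x. a x *\<^sub>R f x) (at x) v)" for v
  proof (rule Ck_on_cong[OF assms(1)])
    show "Ck_on k S (\<lambda>x. a x *\<^sub>R frechet_derivative f (at x) v + frechet_derivative a (at x) v *\<^sub>R f x)"
      using Suc pre by (intro Ck_on_add assms(1) Suc.IH) auto
    show "a x *\<^sub>R frechet_derivative f (at x) v + frechet_derivative a (at x) v *\<^sub>R f x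
        = frechet_derivative (\<lambda>x. a x *\<^sub>R f x) (at x) v" if "x \<in> S" for x
      using Suc.prems that
      by (simp add: frechet_derivative_eqI[OF has_derivative_scaleR[OF has_derivative_frechet has_derivative_frechet]])
  qed
  then show ?case using Suc.prems by (auto intro: differentiable_scaleR)
qed

lemma Ck_on_sum:
  assumes "open S" "\<And>i. i \<in> I \<Longrightarrow> Ck_on k S (f i)"
  shows "Ck_on k S (\<lambda>x. \<Sum>i\<in>I. f i x)"
  using assms(2)
  by (induction I rule: infinite_finite_induct) (simp_all add: Ck_on_const Ck_on_add[OF assms(1)] del: Ck_on.simps)

lemma Ck_on_linear_compose:
  assumes "open S" "linear L" "Ck_on k S f"
  shows "Ck_on k S (\<lambda>x. L (f x))"
  using assms(3)
proof (induction k arbitrary: f)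
  case 0
  then show ?case using linear_continuous_on_compose[OF _ assms(2)] by simp
next
  case (Suc k)
  have der: "((\<lambda>x. L (f x)) has_derivative (\<lambda>v. L (frechet_derivative f (at x) v))) (at x)" if "x \<in> S" for x
    using has_derivative_compose[OF has_derivative_frechet linear_imp_has_derivative[OF assms(2)], of f x]
      Suc.prems that by simp
  have "Ck_on k S (\<lambda>x. frechet_derivative (\<lambda>x. L (f x)) (at x) v)" for v
    using Ck_on_cong[OF assms(1), of "\<lambda>x. L (frechet_derivative f (at x) v)"]
      frechet_derivative_eqI[OF der] Suc by simp
  then show ?case using der by (auto simp: differentiable_def)
qed

text \<open>In the chain rule the derivative of \<open>f\<close> is a linear map that varies with
  \<open>x\<close> and acts on a vector that varies too. Expanding that vector over the basis leaves
  sums of products of a C^k coefficient and a partial derivative of \<open>f\<close> composed with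
  \<open>g\<close>, to which the induction hypothesis applies.\<close>

lemma Ck_on_compose:
  fixes f :: "'f::euclidean_space \<Rightarrow> 'g::euclidean_space" and g :: "'e::euclidean_space \<Rightarrow> 'f"
  assumes S: "open S" and T: "open T" and gS: "g ` S \<subseteq> T"
    and "Ck_on k T f" "Ck_on k S g"
  shows "Ck_on k S (f \<circ> g)"
  using assms(4,5)
proof (induction k arbitrary: f)
  case 0
  then show ?case using continuous_on_compose[of S g f] continuous_on_subset[OF _ gS] by auto
next
  case (Suc k)
  have der: "(f \<circ> g has_derivative (\<lambda>v. frechet_derivative f (at (g x)) (frechet_derivative g (at x) v))) (at x)"
    if "x \<in> S" for x
    using diff_chain_at[OF has_derivative_frechet has_derivative_frechet, of g x f] Suc.prems gS that
    by (auto simp: o_def)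
  have lin: "linear (frechet_derivative f (at (g x)))" if "x \<in> S" for x
    using Suc.prems gS that linear_frechet_derivative by auto
  have "Ck_on k S (\<lambda>x. frechet_derivative (f \<circ> g) (at x) v)" for v
  proof (rule Ck_on_cong[OF S])
    show "Ck_on k S (\<lambda>x. \<Sum>i\<in>Basis. (frechet_derivative g (at x) v \<bullet> i) *\<^sub>R ((\<lambda>y. frechet_derivative f (at y) i) \<circ> g) x)"
    proof (intro Ck_on_sum Ck_on_scaleR S)
      fix i :: 'f
      show "Ck_on k S ((\<lambda>y. frechet_derivative f (at y) i) \<circ> g)"
        using Suc.prems(1) Ck_on_Suc_imp[OF Suc.prems(2)] by (intro Suc.IH) simp_all
      show "Ck_on k S (\<lambda>x. frechet_derivative g (at x) v \<bullet> i)"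
        using Suc.prems(2)
        by (intro Ck_on_linear_compose[OF S, where L = "\<lambda>y. y \<bullet> i"] linearI) (simp_all add: inner_left_distrib)
    qed
    show "(\<Sum>i\<in>Basis. (frechet_derivative g (at x) v \<bullet> i) *\<^sub>R ((\<lambda>y. frechet_derivative f (at y) i) \<circ> g) x)
       = frechet_derivative (f \<circ> g) (at x) v" if "x \<in> S" for x
    proof -
      let ?w = "frechet_derivative g (at x) v"
      have "frechet_derivative f (at (g x)) ?w = frechet_derivative f (at (g x)) (\<Sum>i\<in>Basis. (?w \<bullet> i) *\<^sub>R i)"
        by (simp add: euclidean_representation)
      then show ?thesis
        using frechet_derivative_eqI[OF der[OF that]]
        by (simp add: linear_sum[OF lin[OF that]] linear_scale[OF lin[OF that]])
    qed
  qed
  then show ?case using der unfolding Ck_on.simps differentiable_def by blast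
qed

lemma Ck_on_Pair:
  assumes S: "open S" and "Ck_on k S f" "Ck_on k S g"
  shows "Ck_on k S (\<lambda>x. (f x, g x))"
proof -
  have "Ck_on k S (\<lambda>x. (f x, 0) + (0, g x))"
    by (intro Ck_on_add Ck_on_linear_compose[OF S _ assms(2), where L = "\<lambda>y. (y, 0)"]
        Ck_on_linear_compose[OF S _ assms(3), where L = "\<lambda>y. (0, y)"] S linearI) auto
  then show ?thesis by simp
qed

lemma smooth_on_cong: "open S \<Longrightarrow> (\<And>x. x \<in> S \<Longrightarrow> f x = g x) \<Longrightarrow> smooth_on S f \<Longrightarrow> smooth_on S g"
  unfolding smooth_on_def using Ck_on_cong by blast

lemma smooth_on_subset: "smooth_on T f \<Longrightarrow> S \<subseteq> T \<Longrightarrow> smooth_on S f"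
  unfolding smooth_on_def using Ck_on_subset by blast

lemma smooth_on_compose:
  "open S \<Longrightarrow> open T \<Longrightarrow> g ` S \<subseteq> T \<Longrightarrow> smooth_on T f \<Longrightarrow> smooth_on S g \<Longrightarrow> smooth_on S (f \<circ> g)"
  unfolding smooth_on_def using Ck_on_compose by blast

lemma smooth_on_linear: "linear f \<Longrightarrow> smooth_on S f"
  unfolding smooth_on_def using Ck_on_linear by blast

lemma smooth_on_Pair:
  "open S \<Longrightarrow> smooth_on S f \<Longrightarrow> smooth_on S g \<Longrightarrow> smooth_on S (\<lambda>x. (f x, g x))"
  unfolding smooth_on_def using Ck_on_Pair by blast

lemma smooth_on_derivative: "smooth_on S f \<Longrightarrow> smooth_on S (\<lambda>x. frechet_derivative f (at x) v)"
  unfolding smooth_on_def using Ck_on.simps(2) by blast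

lemma smooth_on_differentiable: "smooth_on S f \<Longrightarrow> x \<in> S \<Longrightarrow> f differentiable (at x)"
  unfolding smooth_on_def using Ck_on.simps(2) by blast

lemma smooth_on_continuous: "smooth_on S f \<Longrightarrow> continuous_on S f"
  unfolding smooth_on_def using Ck_on.simps(1) by blast

subsection \<open>Symmetry of second derivatives\<close>

definition deriv2 :: "('e::euclidean_space \<Rightarrow> 'f::euclidean_space) \<Rightarrow> 'e \<Rightarrow> 'e \<Rightarrow> 'e \<Rightarrow> 'f" where
  "deriv2 f x u v = frechet_derivative (\<lambda>y. frechet_derivative f (at y) v) (at x) u"

text \<open>The mean value theorem is applied twice to the second difference.\<close>

lemma second_difference_mvt:
  fixes f :: "'e::euclidean_space \<Rightarrow> real"
  assumes f: "smooth_on S f" and h: "0 < h"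
    and S: "\<And>s t. 0 \<le> s \<Longrightarrow> s \<le> h \<Longrightarrow> 0 \<le> t \<Longrightarrow> t \<le> h \<Longrightarrow> x + s *\<^sub>R u + t *\<^sub>R v \<in> S"
  obtains a c where "0 < a" "a < h" "0 < c" "c < h"
    "f (x + h *\<^sub>R u + h *\<^sub>R v) - f (x + h *\<^sub>R u) - f (x + h *\<^sub>R v) + f x
       = h\<^sup>2 * deriv2 f (x + a *\<^sub>R u + c *\<^sub>R v) v u"
proof -
  have line: "((\<lambda>s. F (y + s *\<^sub>R w)) has_field_derivative frechet_derivative F (at (y + s *\<^sub>R w)) w) (at s)"
    if F: "smooth_on S F" and y: "y + s *\<^sub>R w \<in> S" for F :: "'e \<Rightarrow> real" and y w s
  proof -
    have F': "(F has_derivative frechet_derivative F (at (y + s *\<^sub>R w))) (at (y + s *\<^sub>R w))"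
      using has_derivative_frechet smooth_on_differentiable[OF F y] .
    have "((\<lambda>s. y + s *\<^sub>R w) has_derivative (\<lambda>s. s *\<^sub>R w)) (at s)" by (auto intro!: derivative_eq_intros)
    from has_derivative_compose[OF this F'] show ?thesis
      using linear_scale[OF linear_frechet_derivative[OF smooth_on_differentiable[OF F y]]]
      by (simp add: has_field_derivative_def mult.commute[of _ "frechet_derivative F _ w"])
  qed
  \<comment> \<open>The increment of \<open>\<phi>\<close> over \<open>[0, h]\<close> is the whole
    second difference; \<open>\<psi>\<close> below varies the other direction at the intermediate
    parameter \<open>a\<close>.\<close>
  define \<phi> where "\<phi> s = f ((x + h *\<^sub>R v) + s *\<^sub>R u) - f (x + s *\<^sub>R u)" for s
  have "(\<phi> has_field_derivative (frechet_derivative f (at ((x + h *\<^sub>R v) + s *\<^sub>R u)) u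
      - frechet_derivative f (at (x + s *\<^sub>R u)) u)) (at s)" if "0 \<le> s" "s \<le> h" for s
    unfolding \<phi>_def
    using S[of s h] S[of s 0] that h by (intro DERIV_diff line f) (auto simp: algebra_simps)
  from MVT2[OF h this] obtain a where a: "0 < a" "a < h" "\<phi> h - \<phi> 0
      = h * (frechet_derivative f (at ((x + h *\<^sub>R v) + a *\<^sub>R u)) u - frechet_derivative f (at (x + a *\<^sub>R u)) u)"
    by auto
  define \<psi> where "\<psi> t = frechet_derivative f (at ((x + a *\<^sub>R u) + t *\<^sub>R v)) u" for t
  have "(\<psi> has_field_derivative deriv2 f ((x + a *\<^sub>R u) + t *\<^sub>R v) v u) (at t)" if "0 \<le> t" "t \<le> h" for t
    unfolding \<psi>_def deriv2_def
    using S[of a t] that a by (intro line[of "\<lambda>y. frechet_derivative f (at y) u"] smooth_on_derivative f) auto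
  from MVT2[OF h this] obtain c where c: "0 < c" "c < h"
    "\<psi> h - \<psi> 0 = h * deriv2 f (x + a *\<^sub>R u + c *\<^sub>R v) v u" by auto
  have "\<phi> h - \<phi> 0 = h * (\<psi> h - \<psi> 0)" using a(3) by (simp add: \<psi>_def algebra_simps)
  then show thesis
    using a c by (intro that[of a c]) (auto simp: \<phi>_def power2_eq_square algebra_simps)
qed

text \<open>The second difference does not change when \<open>u\<close> and \<open>v\<close> are
  exchanged, so the two mixed derivatives agree at two points arbitrarily close to \<open>x\<close>,
  and continuity carries this to \<open>x\<close>. \<open>?\<epsilon>\<close> is half of the
  supposed gap, which two errors smaller than it cannot bridge.\<close>

lemma deriv2_sym_real:
  fixes f :: "'e::euclidean_space \<Rightarrow> real"
  assumes S: "open S" "x \<in> S" and f: "smooth_on S f"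
  shows "deriv2 f x u v = deriv2 f x v u"
proof (rule ccontr)
  assume "deriv2 f x u v \<noteq> deriv2 f x v u"
  then have pos: "0 < \<bar>deriv2 f x u v - deriv2 f x v u\<bar> / 2" (is "0 < ?\<epsilon>") by simp
  have cont: "continuous (at x) (\<lambda>y. deriv2 f y w z)" for w z
  proof -
    have "continuous_on S (\<lambda>y. deriv2 f y w z)"
      unfolding deriv2_def by (intro smooth_on_continuous smooth_on_derivative f)
    then show ?thesis using S continuous_on_eq_continuous_at by blast
  qed
  obtain r where r: "r > 0" "ball x r \<subseteq> S" using S open_contains_ball by metis
  obtain d1 where d1: "d1 > 0" "\<And>y. dist y x < d1 \<Longrightarrow> dist (deriv2 f y u v) (deriv2 f x u v) < ?\<epsilon>"
    using cont[of u v] pos unfolding continuous_at_eps_delta dist_norm by blast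
  obtain d2 where d2: "d2 > 0" "\<And>y. dist y x < d2 \<Longrightarrow> dist (deriv2 f y v u) (deriv2 f x v u) < ?\<epsilon>"
    using cont[of v u] pos unfolding continuous_at_eps_delta dist_norm by blast
  define d where "d = min r (min d1 d2)"
  \<comment> \<open>The step is short enough for the whole parallelogram to lie within
    \<open>d / 2\<close> of \<open>x\<close>; the added 1 keeps the denominator positive when
    \<open>u\<close> and \<open>v\<close> are zero.\<close>
  define h where "h = d / (2 * (norm u + norm v + 1))"
  have d: "d > 0" using r d1 d2 by (simp add: d_def)
  have n: "norm u + norm v + 1 > 0" by (simp add: add_nonneg_pos)
  have h: "h > 0" using d n by (simp add: h_def)
  have near: "dist (x + s *\<^sub>R w + t *\<^sub>R z) x < d"
    if "0 \<le> s" "s \<le> h" "0 \<le> t" "t \<le> h" "norm w + norm z = norm u + norm v" for s t w z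
  proof -
    have "dist (x + s *\<^sub>R w + t *\<^sub>R z) x \<le> norm (s *\<^sub>R w) + norm (t *\<^sub>R z)"
      unfolding dist_norm using norm_triangle_ineq[of "s *\<^sub>R w" "t *\<^sub>R z"] by (simp add: add.assoc)
    also have "\<dots> \<le> h * norm w + h * norm z" using that by (auto intro!: add_mono mult_right_mono)
    also have "\<dots> = h * (norm u + norm v)" using that by (simp flip: distrib_left)
    also have "\<dots> \<le> h * (norm u + norm v + 1)" using h by (intro mult_left_mono) auto
    also have "\<dots> = d / 2" using n by (simp add: h_def field_simps)
    finally show ?thesis using d by simp
  qed
  have inS: "x + s *\<^sub>R w + t *\<^sub>R z \<in> S"
    if "0 \<le> s" "s \<le> h" "0 \<le> t" "t \<le> h" "norm w + norm z = norm u + norm v" for s t w z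
    using near[OF that] r(2) by (auto simp: d_def dist_commute)
  obtain a c where 1: "0 < a" "a < h" "0 < c" "c < h"
    "f (x + h *\<^sub>R u + h *\<^sub>R v) - f (x + h *\<^sub>R u) - f (x + h *\<^sub>R v) + f x
       = h\<^sup>2 * deriv2 f (x + a *\<^sub>R u + c *\<^sub>R v) v u"
    using second_difference_mvt[OF f h inS, of u v] by auto
  obtain a' c' where 2: "0 < a'" "a' < h" "0 < c'" "c' < h"
    "f (x + h *\<^sub>R v + h *\<^sub>R u) - f (x + h *\<^sub>R v) - f (x + h *\<^sub>R u) + f x
       = h\<^sup>2 * deriv2 f (x + a' *\<^sub>R v + c' *\<^sub>R u) u v"
    using second_difference_mvt[OF f h inS, of v u] by auto
  have "h\<^sup>2 * deriv2 f (x + a *\<^sub>R u + c *\<^sub>R v) v u = h\<^sup>2 * deriv2 f (x + a' *\<^sub>R v + c' *\<^sub>R u) u v"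
  proof -
    have "x + h *\<^sub>R v + h *\<^sub>R u = x + h *\<^sub>R u + h *\<^sub>R v" by simp
    from 2(5)[unfolded this] 1(5) show ?thesis by linarith
  qed
  then have eq: "deriv2 f (x + a *\<^sub>R u + c *\<^sub>R v) v u = deriv2 f (x + a' *\<^sub>R v + c' *\<^sub>R u) u v"
    using h by (metis less_irrefl mult_left_cancel zero_eq_power2)
  have "dist (deriv2 f (x + a *\<^sub>R u + c *\<^sub>R v) v u) (deriv2 f x v u) < ?\<epsilon>"
    using near[of a c u v] 1 by (intro d2) (auto simp: d_def)
  moreover have "dist (deriv2 f (x + a' *\<^sub>R v + c' *\<^sub>R u) u v) (deriv2 f x u v) < ?\<epsilon>"
    using near[of a' c' v u] 2 by (intro d1) (auto simp: d_def)
  ultimately show False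
    unfolding eq dist_real_def by (smt (verit) field_sum_of_halves)
qed

lemma deriv2_sym:
  fixes f :: "'e::euclidean_space \<Rightarrow> 'f::euclidean_space"
  assumes S: "open S" "x \<in> S" and f: "smooth_on S f"
  shows "deriv2 f x u v = deriv2 f x v u"
proof (rule euclidean_eqI)
  fix i :: 'f
  have lin: "linear (\<lambda>y::'f. y \<bullet> i)" by (auto intro!: linearI simp: inner_left_distrib)
  have D: "frechet_derivative (\<lambda>y. F y \<bullet> i) (at y) = (\<lambda>w. frechet_derivative F (at y) w \<bullet> i)"
    if "smooth_on S F" "y \<in> S" for F :: "'e \<Rightarrow> 'f" and y
    using has_derivative_compose[OF has_derivative_frechet linear_imp_has_derivative[OF lin]]
      smooth_on_differentiable[OF that] by (intro frechet_derivative_eqI) auto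
  have "deriv2 f x w z \<bullet> i = deriv2 (\<lambda>y. f y \<bullet> i) x w z" for w z
  proof -
    have "deriv2 (\<lambda>y. f y \<bullet> i) x w z
        = frechet_derivative (\<lambda>y. frechet_derivative f (at y) z \<bullet> i) (at x) w"
      unfolding deriv2_def using D[OF f] by (subst frechet_derivative_cong_open[OF S]) auto
    then show ?thesis unfolding deriv2_def using D[OF smooth_on_derivative[OF f] S(2)] by simp
  qed
  moreover have "smooth_on S (\<lambda>y. f y \<bullet> i)"
    using f Ck_on_linear_compose[OF S(1) lin] unfolding smooth_on_def by blast
  ultimately show "deriv2 f x u v \<bullet> i = deriv2 f x v u \<bullet> i"
    using deriv2_sym_real[OF S] by metis
qed

lemma linear_deriv:
  "smooth_on S f \<Longrightarrow> x \<in> S \<Longrightarrow> linear (frechet_derivative f (at x))"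
  using linear_frechet_derivative smooth_on_differentiable by blast

lemma deriv2_linear_left:
  "smooth_on S f \<Longrightarrow> x \<in> S \<Longrightarrow> linear (\<lambda>u. deriv2 f x u v)"
  unfolding deriv2_def by (rule linear_deriv[OF smooth_on_derivative])

text \<open>Linearity in the direction of the outer differentiation is that of a derivative;
  linearity in the other slot comes from symmetry.\<close>

lemma deriv2_bilinear:
  assumes "open S" "x \<in> S" "smooth_on S f"
  shows "bilinear (deriv2 f x)"
proof -
  have "linear (deriv2 f x u)" for u
    using deriv2_linear_left[OF assms(3,2), of u] by (simp only: deriv2_sym[OF assms, of _ u])
  then show ?thesis using deriv2_linear_left[OF assms(3,2)] by (simp add: bilinear_def)
qed

section \<open>Charts\<close>

locale manifold =
  fixes M :: "('m::{t2_space,second_countable_topology}, 'e::euclidean_space) charts"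
  assumes smooth_manifold: "smooth_manifold M"
begin

lemma in_cdom [simp]: "p \<in> cdom M p" and open_cdom [simp]: "open (cdom M p)"
  and open_image: "open (chart M p ` cdom M p)"
  and homeo: "homeomorphism (cdom M p) (chart M p ` cdom M p) (chart M p) (inv_chart M p)"
  and transition_smooth: "smooth_on (chart M p ` (cdom M p \<inter> cdom M q)) (chart M q \<circ> inv_chart M p)"
  using smooth_manifold unfolding smooth_manifold_def by auto

lemma inv_chart_chart [simp]: "q \<in> cdom M p \<Longrightarrow> inv_chart M p (chart M p q) = q"
  using homeo[of p] by (simp add: homeomorphism_def)

lemma open_chart_image:
  assumes "open U"
  shows "open (chart M p ` (U \<inter> cdom M p))"
proof -
  have "openin (top_of_set (cdom M p)) (U \<inter> cdom M p)" using assms by (auto simp: openin_open)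
  from homeomorphism_imp_open_map[OF homeo this] show ?thesis
    using open_image openin_open_eq by blast
qed

text \<open>The Jacobian of the transition map at \<open>m\<close>: it carries components in the
  chart at \<open>p\<close> to components in the chart at \<open>q\<close>.\<close>

abbreviation change :: "'m \<Rightarrow> 'm \<Rightarrow> 'm \<Rightarrow> 'e \<Rightarrow> 'e" where
  "change p q m \<equiv> frechet_derivative (chart M q \<circ> inv_chart M p) (at (chart M p m))"

lemma change_differentiable:
  "m \<in> cdom M p \<Longrightarrow> m \<in> cdom M q \<Longrightarrow> (chart M q \<circ> inv_chart M p) differentiable (at (chart M p m))"
  by (rule smooth_on_differentiable[OF transition_smooth]) auto

lemma change_has_derivative:
  "m \<in> cdom M p \<Longrightarrow> m \<in> cdom M q \<Longrightarrow>
    (chart M q \<circ> inv_chart M p has_derivative change p q m) (at (chart M p m))"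
  by (intro has_derivative_frechet change_differentiable)

lemma linear_change: "m \<in> cdom M p \<Longrightarrow> m \<in> cdom M q \<Longrightarrow> linear (change p q m)"
  by (intro linear_frechet_derivative change_differentiable)

lemma derivative_change:
  assumes m: "m \<in> cdom M p" "m \<in> cdom M q" "m \<in> U" and U: "open U"
    and f: "(f \<circ> inv_chart M q) differentiable (at (chart M q m))"
  shows "(f \<circ> inv_chart M p has_derivative
    (\<lambda>v. frechet_derivative (f \<circ> inv_chart M q) (at (chart M q m)) (change p q m v))) (at (chart M p m))"
proof (rule has_derivative_transform_within_open)
  have "(chart M q \<circ> inv_chart M p) (chart M p m) = chart M q m" using m by simp
  then show "((f \<circ> inv_chart M q) \<circ> (chart M q \<circ> inv_chart M p) has_derivative
    (\<lambda>v. frechet_derivative (f \<circ> inv_chart M q) (at (chart M q m)) (change p q m v))) (at (chart M p m))"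
    using diff_chain_at[OF change_has_derivative[OF m(1,2)], of "f \<circ> inv_chart M q"]
      has_derivative_frechet[OF f] by (simp add: o_def)
  show "open (chart M p ` (cdom M q \<inter> cdom M p))" by (intro open_chart_image) simp
  show "chart M p m \<in> chart M p ` (cdom M q \<inter> cdom M p)" using m by auto
qed auto

text \<open>The chain rule for transition maps. Together with \<open>change_same\<close> it makes
  \<open>components\<close> and \<open>coord_field\<close> inverse to each other on a chart
  domain.\<close>

lemma change_cocycle:
  assumes "m \<in> cdom M p" "m \<in> cdom M q" "m \<in> cdom M r"
  shows "change q r m (change p q m v) = change p r m v"
  using frechet_derivative_eqI[OF derivative_change[OF assms(1,2) UNIV_I open_UNIV, of "chart M r"]]
    change_differentiable[OF assms(2,3)] by simp

lemma change_same: "m \<in> cdom M p \<Longrightarrow> change p p m v = v"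
proof -
  assume m: "m \<in> cdom M p"
  have "frechet_derivative (\<lambda>x. x) (at (chart M p m)) = change p p m"
    using m by (intro frechet_derivative_cong_open[OF open_chart_image[OF open_UNIV, of p]]) auto
  then show ?thesis by (metis frechet_derivative_ident)
qed

lemma coord_field_change: "coord_field M p v q = change p q q v"
  and components_change: "components M p q v = change q p q v"
  by (simp_all add: coord_field_def components_def dfun_def)

lemma components_coord_field [simp]: "q \<in> cdom M p \<Longrightarrow> components M p q (coord_field M p v q) = v"
  by (simp add: coord_field_change components_change change_cocycle change_same)

lemma coord_field_components [simp]: "q \<in> cdom M p \<Longrightarrow> coord_field M p (components M p q v) q = v"
  by (simp add: coord_field_change components_change change_cocycle change_same)

lemma coord_field_self [simp]: "coord_field M p v p = v" and components_self [simp]: "components M p p v = v"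
  by (simp_all add: coord_field_change components_change change_same)

lemma linear_coord_field: "q \<in> cdom M p \<Longrightarrow> linear (\<lambda>v. coord_field M p v q)"
  using linear_change by (simp add: coord_field_change)

text \<open>Read in the chart at \<open>r\<close>, the field is a partial derivative of the
  transition map from the chart at \<open>p\<close>, a smooth function; the chart at
  \<open>s\<close> only precomposes another transition map.\<close>

lemma smooth_vf_coord_field: "smooth_vf_on M (cdom M p) (coord_field M p v)"
  unfolding smooth_vf_on_def smooth_fun_on_def
proof (intro allI)
  fix r s
  let ?S = "chart M s ` (cdom M p \<inter> cdom M r \<inter> cdom M s)"
  have S: "open ?S" by (intro open_chart_image open_Int open_cdom)
  show "smooth_on ?S ((\<lambda>q. components M r q (coord_field M p v q)) \<circ> inv_chart M s)"
  proof (rule smooth_on_cong[OF S])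
    let ?T = "chart M p ` (cdom M p \<inter> cdom M r)"
    show "smooth_on ?S ((\<lambda>x. frechet_derivative (chart M r \<circ> inv_chart M p) (at x) v) \<circ> (chart M p \<circ> inv_chart M s))"
    proof (rule smooth_on_compose[OF S])
      show "open ?T" using open_chart_image[of "cdom M r" p] by (simp add: Int_commute)
      show "smooth_on ?S (chart M p \<circ> inv_chart M s)"
        by (rule smooth_on_subset[OF transition_smooth]) auto
      show "smooth_on ?T (\<lambda>x. frechet_derivative (chart M r \<circ> inv_chart M p) (at x) v)"
        by (intro smooth_on_derivative transition_smooth)
    qed auto
    show "((\<lambda>x. frechet_derivative (chart M r \<circ> inv_chart M p) (at x) v) \<circ> (chart M p \<circ> inv_chart M s)) x
        = ((\<lambda>q. components M r q (coord_field M p v q)) \<circ> inv_chart M s) x" if "x \<in> ?S" for x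
      using that by (auto simp: coord_field_change components_change change_cocycle)
  qed
qed

lemma smooth_fun_on_differentiable:
  assumes "smooth_fun_on M U f" "q \<in> U" "q \<in> cdom M p"
  shows "(f \<circ> inv_chart M p) differentiable (at (chart M p q))"
  using assms unfolding smooth_fun_on_def by (auto intro: smooth_on_differentiable)

lemma dfun_cong:
  assumes "open U" "p \<in> U" "\<And>q. q \<in> U \<Longrightarrow> f q = f' q"
  shows "dfun M f p = dfun M f' p"
proof
  fix v
  have "frechet_derivative (f \<circ> inv_chart M p) (at (chart M p p)) = frechet_derivative (f' \<circ> inv_chart M p) (at (chart M p p))"
    using assms by (intro frechet_derivative_cong_open[OF open_chart_image[OF assms(1), of p]]) auto
  then show "dfun M f p v = dfun M f' p v" by (simp add: dfun_def)
qed

end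

lemma smooth_map_local:
  assumes "smooth_map M N j"
  shows "smooth_on (chart M p ` (j -` cdom N P \<inter> cdom M p)) (chart N P \<circ> j \<circ> inv_chart M p)"
  using assms by (simp add: smooth_map_def smooth_fun_on_def)

text \<open>\<open>dmap\<close> at \<open>q\<close> uses the charts at \<open>q\<close> and
  \<open>j q\<close>, which move with \<open>q\<close>. After conversion to two fixed charts, the
  pushed-forward coordinate field has a partial derivative of one local representative as its
  components, so it can be differentiated in \<open>q\<close>.\<close>

lemma dmap_coord_field:
  assumes "smooth_manifold M" "smooth_manifold N" and j: "smooth_map M N j"
    and q: "q \<in> cdom M p" "j q \<in> cdom N P"
  shows "components N P (j q) (dmap M N j q (coord_field M p v q))
    = frechet_derivative (chart N P \<circ> j \<circ> inv_chart M p) (at (chart M p q)) v"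
proof -
  interpret M: manifold M by unfold_locales fact
  interpret N: manifold N by unfold_locales fact
  have cont: "continuous_on UNIV j" using j by (simp add: smooth_map_def)
  have op: "open (j -` cdom N P)" for P using cont by (simp add: open_vimage)
  have dif: "(chart N P \<circ> j \<circ> inv_chart M q) differentiable (at (chart M q q))" if "j q \<in> cdom N P" for P
    using smooth_on_differentiable[OF smooth_map_local[OF j, of q P]] that by auto
  have "frechet_derivative (chart N P \<circ> j \<circ> inv_chart M p) (at (chart M p q)) v
    = frechet_derivative (chart N P \<circ> j \<circ> inv_chart M q) (at (chart M q q)) (coord_field M p v q)"
    using frechet_derivative_eqI[OF M.derivative_change[OF q(1) M.in_cdom UNIV_I open_UNIV dif[OF q(2)]]]
    by (simp add: M.coord_field_change)
  also have "frechet_derivative (chart N P \<circ> j \<circ> inv_chart M q) (at (chart M q q))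
    = (\<lambda>w. components N P (j q) (dmap M N j q w))"
  proof (rule frechet_derivative_eqI, rule has_derivative_transform_within_open)
    let ?U = "j -` cdom N (j q) \<inter> cdom M q"
    show "((chart N P \<circ> inv_chart N (j q)) \<circ> (chart N (j q) \<circ> j \<circ> inv_chart M q) has_derivative
      (\<lambda>w. components N P (j q) (dmap M N j q w))) (at (chart M q q))"
      using diff_chain_at[OF has_derivative_frechet[OF dif[OF N.in_cdom]], of "chart N P \<circ> inv_chart N (j q)"]
        N.change_has_derivative[of "j q" "j q" P] q
      by (simp add: o_def N.components_change dmap_def dfun_def)
    show "open (chart M q ` ?U)" using op by (rule M.open_chart_image)
    show "chart M q q \<in> chart M q ` ?U" by auto
  qed auto
  finally show ?thesis by (rule sym)
qed

lemma dmap_linear: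
  assumes "smooth_manifold M" "smooth_manifold N" and j: "smooth_map M N j"
  shows "linear (dmap M N j p)"
proof -
  interpret M: manifold M by unfold_locales fact
  interpret N: manifold N by unfold_locales fact
  have "linear (frechet_derivative (chart N (j p) \<circ> j \<circ> inv_chart M p) (at (chart M p p)))"
    by (rule linear_deriv[OF smooth_map_local[OF j]]) auto
  then show ?thesis by (simp add: dmap_def[abs_def] dfun_def[abs_def] o_assoc)
qed

section \<open>Products of manifolds\<close>

lemma prod_charts_simps [simp]:
  "cdom (prod_charts M N) (x, y) = cdom M x \<times> cdom N y"
  "chart (prod_charts M N) (x, y) = map_prod (chart M x) (chart N y)"
  by (simp_all add: prod_charts_def)

text \<open>Inverse charts are values of \<open>inv_into\<close>, unspecified outside the chart
  images; hence the restriction to points of the images.\<close>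

lemma inv_chart_prod:
  assumes "smooth_manifold M" "smooth_manifold N"
    and "u \<in> chart M x ` cdom M x" "v \<in> chart N y ` cdom N y"
  shows "inv_chart (prod_charts M N) (x, y) (u, v) = (inv_chart M x u, inv_chart N y v)"
proof -
  interpret M: manifold M by unfold_locales fact
  interpret N: manifold N by unfold_locales fact
  obtain a b where ab: "a \<in> cdom M x" "b \<in> cdom N y" "u = chart M x a" "v = chart N y b" using assms by auto
  have "inj_on (map_prod (chart M x) (chart N y)) (cdom M x \<times> cdom N y)"
    by (intro map_prod_inj_on) (metis M.inv_chart_chart N.inv_chart_chart inj_onI)+
  then have "inv_into (cdom M x \<times> cdom N y) (map_prod (chart M x) (chart N y)) (map_prod (chart M x) (chart N y) (a, b)) = (a, b)"
    by (rule inv_into_f_f) (use ab in auto)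
  then show ?thesis using ab by (simp add: inv_chart_def[of "prod_charts M N"])
qed

lemma smooth_manifold_prod:
  assumes "smooth_manifold M" "smooth_manifold N"
  shows "smooth_manifold (prod_charts M N)"
proof -
  interpret M: manifold M by unfold_locales fact
  interpret N: manifold N by unfold_locales fact
  let ?L = "prod_charts M N"
  note inv = inv_chart_prod[OF assms]
  have "open (chart ?L (x, y) ` cdom ?L (x, y)) \<and>
    homeomorphism (cdom ?L (x, y)) (chart ?L (x, y) ` cdom ?L (x, y)) (chart ?L (x, y)) (inv_chart ?L (x, y))" for x y
  proof
    have im: "chart ?L (x, y) ` cdom ?L (x, y) = (chart M x ` cdom M x) \<times> (chart N y ` cdom N y)"
      by (simp add: map_prod_surj_on)
    show "open (chart ?L (x, y) ` cdom ?L (x, y))" unfolding im by (intro open_Times M.open_image N.open_image)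
    have "continuous_on (cdom M x \<times> cdom N y) (\<lambda>z. (chart M x (fst z), chart N y (snd z)))"
      using M.homeo[of x] N.homeo[of y] unfolding homeomorphism_def
      by (intro continuous_on_Pair continuous_on_compose2[OF _ continuous_on_fst[OF continuous_on_id]]
          continuous_on_compose2[OF _ continuous_on_snd[OF continuous_on_id]]) auto
    then have c1: "continuous_on (cdom ?L (x, y)) (chart ?L (x, y))"
      by (simp add: map_prod_def case_prod_beta)
    have "continuous_on ((chart M x ` cdom M x) \<times> (chart N y ` cdom N y)) (\<lambda>z. (inv_chart M x (fst z), inv_chart N y (snd z)))"
      using M.homeo[of x] N.homeo[of y] unfolding homeomorphism_def
      by (intro continuous_on_Pair continuous_on_compose2[OF _ continuous_on_fst[OF continuous_on_id]]
          continuous_on_compose2[OF _ continuous_on_snd[OF continuous_on_id]]) auto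
    then have c2: "continuous_on ((chart M x ` cdom M x) \<times> (chart N y ` cdom N y)) (inv_chart ?L (x, y))"
      by (rule continuous_on_eq) (auto simp: inv)
    show "homeomorphism (cdom ?L (x, y)) (chart ?L (x, y) ` cdom ?L (x, y)) (chart ?L (x, y)) (inv_chart ?L (x, y))"
      unfolding im by (rule homeomorphismI[OF c1 c2]) (auto simp: inv)
  qed
  moreover have "smooth_on (chart ?L (x, y) ` (cdom ?L (x, y) \<inter> cdom ?L (x', y')))
    (chart ?L (x', y') \<circ> inv_chart ?L (x, y))" for x y x' y'
  proof -
    define S where "S = chart M x ` (cdom M x \<inter> cdom M x')"
    define T where "T = chart N y ` (cdom N y \<inter> cdom N y')"
    have im: "chart ?L (x, y) ` (cdom ?L (x, y) \<inter> cdom ?L (x', y')) = S \<times> T"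
      by (simp add: S_def T_def Times_Int_Times map_prod_surj_on)
    have op: "open S" "open T"
      using M.open_chart_image[of "cdom M x'" x] N.open_chart_image[of "cdom N y'" y]
      by (simp_all add: S_def T_def Int_commute)
    have "smooth_on (S \<times> T) (\<lambda>z. (((chart M x' \<circ> inv_chart M x) \<circ> fst) z, ((chart N y' \<circ> inv_chart N y) \<circ> snd) z))"
      using op M.transition_smooth[of x x'] N.transition_smooth[of y y']
      by (intro smooth_on_Pair smooth_on_compose[where T = S] smooth_on_compose[where T = T]
          smooth_on_linear[OF linear_fst] smooth_on_linear[OF linear_snd] open_Times) (auto simp: S_def T_def)
    then show ?thesis unfolding im
      by (rule smooth_on_cong[OF open_Times[OF op], rotated]) (auto simp: S_def T_def inv)
  qed
  ultimately show ?thesis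
    unfolding smooth_manifold_def by (simp add: split_paired_all open_Times del: prod_charts_simps(2))
qed

section \<open>The Levi-Civita connection\<close>

text \<open>The property inside the definite description of \<open>christoffel\<close>, named so
  that existence and uniqueness can be treated separately.\<close>

definition is_christoffel ::
    "('m, 'e::euclidean_space) charts \<Rightarrow> ('m, 'e) metric \<Rightarrow> 'm \<Rightarrow> ('e \<Rightarrow> 'e \<Rightarrow> 'e) \<Rightarrow> bool" where
  "is_christoffel M g p \<Gamma> \<longleftrightarrow> bilinear \<Gamma> \<and> (\<forall>u v. \<Gamma> u v = \<Gamma> v u) \<and>
     (\<forall>u v w. dfun M (\<lambda>q. g q (coord_field M p v q) (coord_field M p w q)) p u
        = g p (\<Gamma> u v) w + g p v (\<Gamma> u w))"

text \<open>In this combination of three metric identities the symmetry of \<open>\<Gamma>\<close>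
  cancels everything but two equal terms. The right-hand side involves the metric alone, which gives
  uniqueness.\<close>

lemma koszul:
  assumes "inner_form (g p)" "is_christoffel M g p \<Gamma>"
  defines "A u v w \<equiv> dfun M (\<lambda>q. g q (coord_field M p v q) (coord_field M p w q)) p u"
  shows "2 * g p (\<Gamma> u v) w = A u v w + A v u w - A w u v"
proof -
  interpret inner_form "g p" by fact
  have A: "A u v w = g p (\<Gamma> u v) w + g p v (\<Gamma> u w)" for u v w
    using assms(2) by (simp add: is_christoffel_def A_def)
  have "\<Gamma> v u = \<Gamma> u v" "\<Gamma> w u = \<Gamma> u w" "\<Gamma> w v = \<Gamma> v w"
    using assms(2) by (simp_all add: is_christoffel_def)
  then show ?thesis using sym[of v "\<Gamma> u w"] by (simp add: A)
qed

lemma christoffel_eqI: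
  assumes "inner_form (g p)" "is_christoffel M g p \<Gamma>"
  shows "christoffel M g p = \<Gamma>"
proof -
  interpret inner_form "g p" by fact
  have "\<Gamma>' = \<Gamma>" if "is_christoffel M g p \<Gamma>'" for \<Gamma>'
  proof (intro ext form_ext)
    show "g p (\<Gamma>' u v) w = g p (\<Gamma> u v) w" for u v w
      using koszul[OF assms(1) that, of u v w] koszul[OF assms, of u v w] by simp
  qed
  then show ?thesis
    unfolding christoffel_def is_christoffel_def[symmetric] by (intro the_equality assms(2))
qed

lemma dfun_eqI: "(f \<circ> inv_chart M p has_derivative D) (at (chart M p p)) \<Longrightarrow> dfun M f p = D"
  unfolding dfun_def[abs_def] by (rule frechet_derivative_eqI)

lemma dfun_has_derivative:
  "(f \<circ> inv_chart M p) differentiable (at (chart M p p)) \<Longrightarrow>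
    (f \<circ> inv_chart M p has_derivative dfun M f p) (at (chart M p p))"
  unfolding dfun_def[abs_def] by (rule has_derivative_frechet)

lemma dfun_linear:
  "(f \<circ> inv_chart M p) differentiable (at (chart M p p)) \<Longrightarrow> linear (dfun M f p)"
  by (rule has_derivative_linear[OF dfun_has_derivative])

lemma linear_expansion:
  fixes l :: "'e::euclidean_space \<Rightarrow> 'f::real_vector"
  assumes "linear l"
  shows "l v = (\<Sum>i\<in>Basis. (v \<bullet> i) *\<^sub>R l i)"
proof -
  have "l v = l (\<Sum>i\<in>Basis. (v \<bullet> i) *\<^sub>R i)" by (simp add: euclidean_representation)
  then show ?thesis by (simp add: linear_sum[OF assms] linear_scale[OF assms])
qed

lemma bilinear_expansion:
  fixes B :: "'e::euclidean_space \<Rightarrow> 'f::euclidean_space \<Rightarrow> real"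
  assumes "bilinear B"
  shows "B v w = (\<Sum>i\<in>Basis. \<Sum>k\<in>Basis. (v \<bullet> i) * (w \<bullet> k) * B i k)"
proof -
  have "B v w = (\<Sum>i\<in>Basis. (v \<bullet> i) *\<^sub>R B i w)"
    using assms by (intro linear_expansion) (simp add: bilinear_def)
  also have "\<dots> = (\<Sum>i\<in>Basis. (v \<bullet> i) *\<^sub>R (\<Sum>k\<in>Basis. (w \<bullet> k) *\<^sub>R B i k))"
    using assms by (intro sum.cong refl arg_cong2[of _ _ _ _ scaleR] linear_expansion) (simp add: bilinear_def)
  finally show ?thesis by (simp add: sum_distrib_left mult.assoc)
qed

section \<open>Derivatives of families of forms along a map\<close>

context manifold
begin

text \<open>Here a field of forms is evaluated along the map \<open>F\<close> on the vector field along \<open>F\<close> whose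
  components in the chart at \<open>p = F x\<close> are given by \<open>c\<close>.\<close>

lemma linear_family_has_derivative:
  fixes \<theta> :: "'m \<Rightarrow> 'e \<Rightarrow> real" and c :: "'k::euclidean_space \<Rightarrow> 'e" and F :: "'k \<Rightarrow> 'm"
  assumes lin: "\<And>q. linear (\<theta> q)"
    and dif: "\<And>v. ((\<lambda>q. \<theta> q (coord_field M p v q)) \<circ> inv_chart M p) differentiable (at (chart M p p))"
    and J: "(chart M p \<circ> F has_derivative J') (at x)" and Fx: "F x = p"
    and c: "(c has_derivative c') (at x)"
    and U: "open U" "x \<in> U" "\<And>y. y \<in> U \<Longrightarrow> F y \<in> cdom M p"
  shows "((\<lambda>y. \<theta> (F y) (coord_field M p (c y) (F y))) has_derivative
    (\<lambda>u. dfun M (\<lambda>q. \<theta> q (coord_field M p (c x) q)) p (J' u) + \<theta> p (c' u))) (at x)"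
proof -
  define b where "b v q = \<theta> q (coord_field M p v q)" for v q
  have b_lin: "linear (\<lambda>v. b v q)" if "q \<in> cdom M p" for q
    using linear_compose[OF linear_coord_field[OF that] lin[of q]] by (simp add: b_def o_def)
  \<comment> \<open>The expansion separates the dependence on the point, contained in finitely many
    coefficient functions \<open>b i\<close>, from the dependence on the vector, so that the product
    rule applies termwise.\<close>
  have b_exp: "b v q = (\<Sum>i\<in>Basis. (v \<bullet> i) * b i q)" if "q \<in> cdom M p" for v q
    using linear_expansion[OF b_lin[OF that], of v] by (simp only: real_scaleR_def)
  have db: "((b v \<circ> inv_chart M p) has_derivative dfun M (b v) p) (at (chart M p p))" for v
    using dfun_has_derivative[OF dif[of v]] by (simp add: b_def[abs_def])
  have db_F: "((\<lambda>y. b v (F y)) has_derivative (\<lambda>u. dfun M (b v) p (J' u))) (at x)" for v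
  proof (rule has_derivative_transform_within_open[OF _ U(1,2)])
    show "((\<lambda>y. (b v \<circ> inv_chart M p) ((chart M p \<circ> F) y)) has_derivative (\<lambda>u. dfun M (b v) p (J' u))) (at x)"
      using has_derivative_compose[OF J, of "b v \<circ> inv_chart M p"] db[of v] Fx by simp
  qed (use U(3) in simp)
  have dfun_b: "dfun M (b v) p X = (\<Sum>i\<in>Basis. (v \<bullet> i) * dfun M (b i) p X)" for v X
  proof -
    have "dfun M (b v) p = dfun M (\<lambda>q. \<Sum>i\<in>Basis. (v \<bullet> i) * b i q) p"
      by (intro dfun_cong[OF open_cdom in_cdom] b_exp)
    also have "\<dots> = (\<lambda>X. \<Sum>i\<in>Basis. (v \<bullet> i) * dfun M (b i) p X)"
      using db by (intro dfun_eqI) (auto simp: o_def intro!: has_derivative_sum has_derivative_mult_right)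
    finally show ?thesis by simp
  qed
  have "((\<lambda>y. \<Sum>i\<in>Basis. (c y \<bullet> i) * b i (F y)) has_derivative
      (\<lambda>u. \<Sum>i\<in>Basis. (c x \<bullet> i) * dfun M (b i) p (J' u) + (c' u \<bullet> i) * b i (F x))) (at x)"
    by (intro has_derivative_sum has_derivative_mult db_F has_derivative_inner_left c)
  also have "(\<lambda>u. \<Sum>i\<in>Basis. (c x \<bullet> i) * dfun M (b i) p (J' u) + (c' u \<bullet> i) * b i (F x))
    = (\<lambda>u. dfun M (b (c x)) p (J' u) + \<theta> p (c' u))"
  proof
    fix u
    have "(\<Sum>i\<in>Basis. (c' u \<bullet> i) * b i (F x)) = \<theta> p (c' u)"
      unfolding linear_expansion[OF lin, of p "c' u"] by (simp add: b_def Fx)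
    then show "(\<Sum>i\<in>Basis. (c x \<bullet> i) * dfun M (b i) p (J' u) + (c' u \<bullet> i) * b i (F x))
        = dfun M (b (c x)) p (J' u) + \<theta> p (c' u)"
      by (simp only: sum.distrib dfun_b[of "c x"])
  qed
  finally have D: "((\<lambda>y. \<Sum>i\<in>Basis. (c y \<bullet> i) * b i (F y)) has_derivative (\<lambda>u. dfun M (b (c x)) p (J' u) + \<theta> p (c' u))) (at x)" .
  have "((\<lambda>y. \<theta> (F y) (coord_field M p (c y) (F y))) has_derivative
      (\<lambda>u. dfun M (b (c x)) p (J' u) + \<theta> p (c' u))) (at x)"
  proof (rule has_derivative_transform_within_open[OF D U(1,2)])
    show "(\<Sum>i\<in>Basis. (c y \<bullet> i) * b i (F y)) = \<theta> (F y) (coord_field M p (c y) (F y))" if "y \<in> U" for y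
      using b_exp[OF U(3)[OF that], of "c y"] by (simp add: b_def)
  qed
  then show ?thesis by (simp only: b_def[abs_def])
qed

text \<open>One term comes from moving the base point with frozen components, the other two from
  varying each argument. Immersions enter through \<open>F\<close>, so that the metric and the form
  g(\<Phi>X, Y) can be differentiated along a submanifold.\<close>

lemma bilinear_family_has_derivative:
  fixes B :: "'m \<Rightarrow> 'e \<Rightarrow> 'e \<Rightarrow> real" and c d :: "'k::euclidean_space \<Rightarrow> 'e" and F :: "'k \<Rightarrow> 'm"
  assumes bil: "\<And>q. bilinear (B q)"
    and dif: "\<And>v w. ((\<lambda>q. B q (coord_field M p v q) (coord_field M p w q)) \<circ> inv_chart M p)
      differentiable (at (chart M p p))"
    and J: "(chart M p \<circ> F has_derivative J') (at x)" and Fx: "F x = p"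
    and c: "(c has_derivative c') (at x)" and d: "(d has_derivative d') (at x)"
    and U: "open U" "x \<in> U" "\<And>y. y \<in> U \<Longrightarrow> F y \<in> cdom M p"
  shows "((\<lambda>y. B (F y) (coord_field M p (c y) (F y)) (coord_field M p (d y) (F y))) has_derivative
    (\<lambda>u. dfun M (\<lambda>q. B q (coord_field M p (c x) q) (coord_field M p (d x) q)) p (J' u)
      + B p (c' u) (d x) + B p (c x) (d' u))) (at x)"
proof -
  define b where "b v w q = B q (coord_field M p v q) (coord_field M p w q)" for v w q
  have b_bil: "bilinear (\<lambda>v w. b v w q)" if "q \<in> cdom M p" for q
  proof -
    have "linear (B q v)" "linear (\<lambda>v. B q v w)" for v w using bil[of q] by (auto simp: bilinear_def)
    from linear_compose[OF linear_coord_field[OF that] this(1)] linear_compose[OF linear_coord_field[OF that] this(2)]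
    show ?thesis by (auto simp: b_def bilinear_def o_def)
  qed
  have b_exp: "b v w q = (\<Sum>i\<in>Basis. \<Sum>k\<in>Basis. (v \<bullet> i) * (w \<bullet> k) * b i k q)" if "q \<in> cdom M p" for v w q
    by (rule bilinear_expansion[OF b_bil[OF that]])
  have db: "((b v w \<circ> inv_chart M p) has_derivative dfun M (b v w) p) (at (chart M p p))" for v w
    using dfun_has_derivative[OF dif[of v w]] by (simp add: b_def[abs_def])
  have db_F: "((\<lambda>y. b v w (F y)) has_derivative (\<lambda>u. dfun M (b v w) p (J' u))) (at x)" for v w
  proof (rule has_derivative_transform_within_open[OF _ U(1,2)])
    show "((\<lambda>y. (b v w \<circ> inv_chart M p) ((chart M p \<circ> F) y)) has_derivative (\<lambda>u. dfun M (b v w) p (J' u))) (at x)"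
      using has_derivative_compose[OF J, of "b v w \<circ> inv_chart M p"] db[of v w] Fx by simp
  qed (use U(3) in simp)
  have dfun_b: "dfun M (b v w) p X = (\<Sum>i\<in>Basis. \<Sum>k\<in>Basis. (v \<bullet> i) * (w \<bullet> k) * dfun M (b i k) p X)" for v w X
  proof -
    have "dfun M (b v w) p = dfun M (\<lambda>q. \<Sum>i\<in>Basis. \<Sum>k\<in>Basis. (v \<bullet> i) * (w \<bullet> k) * b i k q) p"
      by (intro dfun_cong[OF open_cdom in_cdom] b_exp)
    also have "\<dots> = (\<lambda>X. \<Sum>i\<in>Basis. \<Sum>k\<in>Basis. (v \<bullet> i) * (w \<bullet> k) * dfun M (b i k) p X)"
      using db by (intro dfun_eqI) (auto simp: o_def intro!: has_derivative_sum has_derivative_mult_right)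
    finally show ?thesis by simp
  qed
  have "((\<lambda>y. \<Sum>i\<in>Basis. \<Sum>k\<in>Basis. (c y \<bullet> i) * (d y \<bullet> k) * b i k (F y)) has_derivative
      (\<lambda>u. \<Sum>i\<in>Basis. \<Sum>k\<in>Basis. ((c x \<bullet> i) * (d x \<bullet> k)) * dfun M (b i k) p (J' u)
        + ((c x \<bullet> i) * (d' u \<bullet> k) + (c' u \<bullet> i) * (d x \<bullet> k)) * b i k (F x))) (at x)"
    by (intro has_derivative_sum has_derivative_mult db_F has_derivative_inner_left c d)
  also have "(\<lambda>u. \<Sum>i\<in>Basis. \<Sum>k\<in>Basis. ((c x \<bullet> i) * (d x \<bullet> k)) * dfun M (b i k) p (J' u)
        + ((c x \<bullet> i) * (d' u \<bullet> k) + (c' u \<bullet> i) * (d x \<bullet> k)) * b i k (F x))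
    = (\<lambda>u. dfun M (b (c x) (d x)) p (J' u) + B p (c' u) (d x) + B p (c x) (d' u))"
  proof
    fix u
    have bp: "b i k (F x) = B p i k" for i k by (simp add: b_def Fx)
    show "(\<Sum>i\<in>Basis. \<Sum>k\<in>Basis. ((c x \<bullet> i) * (d x \<bullet> k)) * dfun M (b i k) p (J' u)
        + ((c x \<bullet> i) * (d' u \<bullet> k) + (c' u \<bullet> i) * (d x \<bullet> k)) * b i k (F x))
      = dfun M (b (c x) (d x)) p (J' u) + B p (c' u) (d x) + B p (c x) (d' u)"
      unfolding bp dfun_b[of "c x"] bilinear_expansion[OF bil, of p "c' u"] bilinear_expansion[OF bil, of p "c x"]
      by (simp add: sum.distrib distrib_right)
  qed
  finally have D: "((\<lambda>y. \<Sum>i\<in>Basis. \<Sum>k\<in>Basis. (c y \<bullet> i) * (d y \<bullet> k) * b i k (F y)) has_derivative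
      (\<lambda>u. dfun M (b (c x) (d x)) p (J' u) + B p (c' u) (d x) + B p (c x) (d' u))) (at x)" .
  have "((\<lambda>y. B (F y) (coord_field M p (c y) (F y)) (coord_field M p (d y) (F y))) has_derivative
      (\<lambda>u. dfun M (b (c x) (d x)) p (J' u) + B p (c' u) (d x) + B p (c x) (d' u))) (at x)"
  proof (rule has_derivative_transform_within_open[OF D U(1,2)])
    show "(\<Sum>i\<in>Basis. \<Sum>k\<in>Basis. (c y \<bullet> i) * (d y \<bullet> k) * b i k (F y))
        = B (F y) (coord_field M p (c y) (F y)) (coord_field M p (d y) (F y))" if "y \<in> U" for y
      using b_exp[OF U(3)[OF that], of "c y" "d y"] by (simp add: b_def)
  qed
  then show ?thesis by (simp only: b_def[abs_def])
qed

end

locale riemannian = manifold M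
  for M :: "('m::{t2_space,second_countable_topology}, 'e::euclidean_space) charts" +
  fixes g :: "('m, 'e) metric"
  assumes riemannian_manifold: "riemannian_manifold M g"
begin

lemma inner_form: "inner_form (g p)"
  using riemannian_manifold unfolding riemannian_manifold_def by unfold_locales auto

lemma metric_bilinear: "bilinear (g p)"
  using inner_form inner_form.bilin by blast

lemma smooth_metric:
  "open U \<Longrightarrow> smooth_vf_on M U X \<Longrightarrow> smooth_vf_on M U Y \<Longrightarrow> smooth_fun_on M U (\<lambda>q. g q (X q) (Y q))"
  using riemannian_manifold unfolding riemannian_manifold_def by auto

lemma metric_coord_differentiable:
  "((\<lambda>q. g q (coord_field M p v q) (coord_field M p w q)) \<circ> inv_chart M p) differentiable (at (chart M p p))"
  by (rule smooth_fun_on_differentiable[OF smooth_metric[OF open_cdom smooth_vf_coord_field smooth_vf_coord_field]]) auto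

text \<open>The Koszul formula, forced by uniqueness, serves as the definition: its right-hand side
  \<open>l\<close> is linear in the last argument and has a Riesz representative.\<close>

lemma christoffel_exists: "\<exists>\<Gamma>. is_christoffel M g p \<Gamma>"
proof -
  interpret G: inner_form "g p" by (rule inner_form)
  define b where "b v w q = g q (coord_field M p v q) (coord_field M p w q)" for v w q
  define A where "A u v w = dfun M (b v w) p u" for u v w
  have D: "(b v w \<circ> inv_chart M p has_derivative dfun M (b v w) p) (at (chart M p p))" for v w
    using metric_coord_differentiable[of p v w] by (intro dfun_has_derivative) (simp add: b_def[abs_def])
  have b_sym: "b v w = b w v" for v w
    using inner_form.sym[OF inner_form] by (simp add: b_def[abs_def])
  have A_sym: "A u v w = A u w v" for u v w unfolding A_def by (simp only: b_sym[of v])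
  have A1: "linear (\<lambda>u. A u v w)" for v w
    unfolding A_def using has_derivative_linear[OF D] .
  \<comment> \<open>Coordinate fields are linear in their components only on the chart domain, hence
    the passage through \<open>dfun_cong\<close>.\<close>
  have A2: "linear (\<lambda>v. A u v w)" for u w
  proof (rule linearI)
    fix v v' :: 'e and c :: real
    have "dfun M (b (v + v') w) p = dfun M (\<lambda>q. b v w q + b v' w q) p"
      by (intro dfun_cong[OF open_cdom in_cdom])
        (simp add: b_def linear_add[OF linear_coord_field] bilinear_ladd[OF metric_bilinear])
    also have "\<dots> = (\<lambda>u. dfun M (b v w) p u + dfun M (b v' w) p u)"
      using has_derivative_add[OF D D] by (intro dfun_eqI) (simp add: o_def)
    finally show "A u (v + v') w = A u v w + A u v' w" by (simp add: A_def)
    have "dfun M (b (c *\<^sub>R v) w) p = dfun M (\<lambda>q. c * b v w q) p"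
      by (intro dfun_cong[OF open_cdom in_cdom])
        (simp add: b_def linear_scale[OF linear_coord_field] bilinear_lmul[OF metric_bilinear])
    also have "\<dots> = (\<lambda>u. c * dfun M (b v w) p u)"
      using has_derivative_mult_right[OF D] by (intro dfun_eqI) (simp add: o_def)
    finally show "A u (c *\<^sub>R v) w = c *\<^sub>R A u v w" by (simp add: A_def)
  qed
  have A3: "linear (\<lambda>w. A u v w)" for u v using A2[of u v] by (simp only: A_sym[of u v])
  define l where "l u v w = (A u v w + A v u w - A w u v) / 2" for u v w
  have lin: "linear (l u v)" for u v
    unfolding l_def
    by (intro linearI) (simp_all add: linear_add[OF A1] linear_add[OF A3] linear_scale[OF A1] linear_scale[OF A3] field_simps)
  have "\<exists>\<Gamma>. \<forall>u v w. g p (\<Gamma> u v) w = l u v w"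
    using G.riesz[OF lin] by metis
  then obtain \<Gamma> where \<Gamma>: "\<And>u v w. g p (\<Gamma> u v) w = l u v w" by blast
  have l_sym: "l u v w = l v u w" for u v w by (simp add: l_def A_sym[of w u])
  have sym: "\<Gamma> u v = \<Gamma> v u" for u v by (rule G.form_ext) (simp only: \<Gamma> l_sym[of u])
  have "linear (\<Gamma> u)" for u
  proof (rule linearI; rule G.form_ext)
    fix v v' w :: 'e and c :: real
    show "g p (\<Gamma> u (v + v')) w = g p (\<Gamma> u v + \<Gamma> u v') w"
      by (simp add: G.add_left \<Gamma> l_def linear_add[OF A1] linear_add[OF A2] linear_add[OF A3] field_simps)
    show "g p (\<Gamma> u (c *\<^sub>R v)) w = g p (c *\<^sub>R \<Gamma> u v) w"
      by (simp add: G.scale_left \<Gamma> l_def linear_scale[OF A1] linear_scale[OF A2] linear_scale[OF A3] field_simps)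
  qed
  moreover from this have "linear (\<lambda>u. \<Gamma> u v)" for v by (simp only: sym[of _ v])
  ultimately have "bilinear \<Gamma>" unfolding bilinear_def by blast
  moreover have "A u v w = g p (\<Gamma> u v) w + g p v (\<Gamma> u w)" for u v w
    unfolding G.sym[of v] \<Gamma> l_def using A_sym[of v u w] A_sym[of w u v] A_sym[of u v w] by (simp add: field_simps)
  ultimately show ?thesis
    unfolding is_christoffel_def using sym by (intro exI[of _ \<Gamma>]) (simp add: A_def b_def[abs_def])
qed

lemma christoffel: "is_christoffel M g p (christoffel M g p)"
  using christoffel_exists[of p] christoffel_eqI[where M = M and g = g and p = p, OF inner_form] by auto

lemma christoffel_bilinear: "bilinear (christoffel M g p)"
  and christoffel_sym: "christoffel M g p u v = christoffel M g p v u"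
  and christoffel_metric: "dfun M (\<lambda>q. g q (coord_field M p v q) (coord_field M p w q)) p u
        = g p (christoffel M g p u v) w + g p v (christoffel M g p u w)"
  using christoffel[of p] unfolding is_christoffel_def by auto

lemma chart_inv_chart_derivative:
  "(chart M p \<circ> inv_chart M p has_derivative (\<lambda>u. u)) (at (chart M p p))"
  by (rule has_derivative_eq_rhs[OF change_has_derivative]) (simp_all add: change_same fun_eq_iff)

text \<open>Writing \<open>Y\<close> by its components in the fixed chart reduces the claim to the
  derivative of a family of forms: the varying components supply the derivative term of
  \<open>cov\<close>, and the metric on moving coordinate fields supplies both Christoffel
  terms.\<close>

lemma metric_cov:
  assumes "((\<lambda>q. components M p q (Y q)) \<circ> inv_chart M p) differentiable (at (chart M p p))"
  shows "((\<lambda>q. g q (Y q) (coord_field M p w q)) \<circ> inv_chart M p) differentiable (at (chart M p p))"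
    and "dfun M (\<lambda>q. g q (Y q) (coord_field M p w q)) p u
      = g p (cov M g Y p u) w + g p (Y p) (christoffel M g p u w)"
proof -
  let ?x = "chart M p p" and ?c = "(\<lambda>q. components M p q (Y q)) \<circ> inv_chart M p"
  let ?D = "\<lambda>u. dfun M (\<lambda>q. g q (coord_field M p (?c ?x) q) (coord_field M p w q)) p u
      + g p (dfun M (\<lambda>q. components M p q (Y q)) p u) w + g p (?c ?x) 0"
  have "((\<lambda>y. g (inv_chart M p y) (coord_field M p (?c y) (inv_chart M p y)) (coord_field M p w (inv_chart M p y)))
      has_derivative ?D) (at ?x)"
    by (rule bilinear_family_has_derivative[OF metric_bilinear metric_coord_differentiable chart_inv_chart_derivative
          _ dfun_has_derivative[OF assms] has_derivative_const open_chart_image[OF open_UNIV, of p]]) auto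
  then have D: "((\<lambda>q. g q (Y q) (coord_field M p w q)) \<circ> inv_chart M p has_derivative ?D) (at ?x)"
    by (rule has_derivative_transform_within_open[OF _ open_chart_image[OF open_UNIV, of p]]) auto
  show "((\<lambda>q. g q (Y q) (coord_field M p w q)) \<circ> inv_chart M p) differentiable (at ?x)"
    using D by (auto simp: differentiable_def)
  show "dfun M (\<lambda>q. g q (Y q) (coord_field M p w q)) p u
      = g p (cov M g Y p u) w + g p (Y p) (christoffel M g p u w)"
    unfolding dfun_eqI[OF D]
    by (simp add: christoffel_metric cov_def bilinear_ladd[OF metric_bilinear] bilinear_rzero[OF metric_bilinear])
qed

lemma smooth_vf_differentiable:
  assumes "smooth_vf_on M U Y" "p \<in> U"
  shows "((\<lambda>q. components M p q (Y q)) \<circ> inv_chart M p) differentiable (at (chart M p p))"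
  using assms unfolding smooth_vf_on_def by (intro smooth_fun_on_differentiable[of "U \<inter> cdom M p"]) auto

end

context manifold
begin

lemma cov_coord_field: "cov M g (coord_field M p v) p u = christoffel M g p u v"
proof -
  have "dfun M (\<lambda>q. components M p q (coord_field M p v q)) p = dfun M (\<lambda>q. v) p"
    by (intro dfun_cong[OF open_cdom in_cdom]) simp
  also have "\<dots> = (\<lambda>u. 0)" by (intro dfun_eqI) (simp add: o_def)
  finally show ?thesis by (simp add: cov_def)
qed

end

section \<open>Immersions and the Gauss formula\<close>

text \<open>For an immersion \<open>j\<close>, \<open>gauss\<close> is the ambient covariant derivative of the coordinate field
  with components \<open>v\<close> in the direction \<open>u\<close>.\<close>

definition local_rep ::
    "('m, 'e::euclidean_space) charts \<Rightarrow> ('p, 'n::euclidean_space) charts \<Rightarrow> ('m \<Rightarrow> 'p) \<Rightarrow> 'm \<Rightarrow> 'e \<Rightarrow> 'n" where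
  "local_rep M N j p = chart N (j p) \<circ> j \<circ> inv_chart M p"

definition gauss ::
    "('m, 'e::euclidean_space) charts \<Rightarrow> ('p, 'n::euclidean_space) charts \<Rightarrow> ('p, 'n) metric
      \<Rightarrow> ('m \<Rightarrow> 'p) \<Rightarrow> 'm \<Rightarrow> 'e \<Rightarrow> 'e \<Rightarrow> 'n" where
  "gauss M N h j p u v = deriv2 (local_rep M N j p) (chart M p p) u v
     + christoffel N h (j p) (dmap M N j p u) (dmap M N j p v)"

locale smooth_submanifold = M: manifold M + N: riemannian N h
  for M :: "('m::{t2_space,second_countable_topology}, 'e::euclidean_space) charts"
    and N :: "('p::{t2_space,second_countable_topology}, 'n::euclidean_space) charts"
    and h :: "('p, 'n) metric" +
  fixes j :: "'m \<Rightarrow> 'p"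
  assumes smooth_map: "smooth_map M N j"
begin

abbreviation dj :: "'m \<Rightarrow> 'e \<Rightarrow> 'n" where "dj \<equiv> dmap M N j"

text \<open>The image under \<open>j\<close> of a chart domain may leave the chart at
  \<open>j p\<close>; this smaller neighbourhood is where \<open>local_rep\<close> expresses
  \<open>j\<close> in charts.\<close>

definition local_dom :: "'m \<Rightarrow> 'm set" where
  "local_dom p = j -` cdom N (j p) \<inter> cdom M p"

lemma local_dom: "open (local_dom p)" "p \<in> local_dom p" "local_dom p \<subseteq> cdom M p"
    "q \<in> local_dom p \<Longrightarrow> j q \<in> cdom N (j p)"
  and chart_local_dom: "open (chart M p ` local_dom p)" "chart M p p \<in> chart M p ` local_dom p"
proof -
  have "open (j -` cdom N (j p))" using smooth_map by (simp add: smooth_map_def open_vimage)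
  then show "open (local_dom p)" "open (chart M p ` local_dom p)"
    using M.open_chart_image by (simp_all add: local_dom_def open_Int)
qed (auto simp: local_dom_def)

lemma local_dom_cdom [simp]: "q \<in> local_dom p \<Longrightarrow> q \<in> cdom M p" "q \<in> local_dom p \<Longrightarrow> j q \<in> cdom N (j p)"
  using local_dom(3,4) by auto

lemma local_rep_smooth: "smooth_on (chart M p ` local_dom p) (local_rep M N j p)"
  unfolding local_dom_def local_rep_def by (rule smooth_map_local[OF smooth_map])

lemma dj_local_rep: "dj p = frechet_derivative (local_rep M N j p) (at (chart M p p))"
  by (simp add: dmap_def[abs_def] dfun_def[abs_def] local_rep_def o_assoc)

lemma linear_dj: "linear (dj p)"
  using dmap_linear[OF M.smooth_manifold N.smooth_manifold smooth_map] .

lemma dj_coord_field: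
  assumes "q \<in> local_dom p"
  shows "components N (j p) (j q) (dj q (coord_field M p v q))
    = frechet_derivative (local_rep M N j p) (at (chart M p q)) v"
  using dmap_coord_field[OF M.smooth_manifold N.smooth_manifold smooth_map, of q p "j p"] assms
  by (simp add: local_rep_def)

text \<open>The pushed-forward field in the shape that the derivative lemmas for families of forms
  expect: a field along \<open>j \<circ> inv_chart M p\<close> given by its components in the chart
  at \<open>j p\<close>.\<close>

lemma dj_coord_field':
  assumes "y \<in> chart M p ` local_dom p"
  shows "coord_field N (j p) (frechet_derivative (local_rep M N j p) (at y) v) (j (inv_chart M p y))
    = dj (inv_chart M p y) (coord_field M p v (inv_chart M p y))"
proof -
  obtain q where q: "q \<in> local_dom p" "y = chart M p q" using assms by auto
  then have "q \<in> cdom M p" "j q \<in> cdom N (j p)" using local_dom by auto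
  then show ?thesis using dj_coord_field[OF q(1), of v, symmetric] q(2) by simp
qed

lemma deriv2_has_derivative:
  "((\<lambda>y. frechet_derivative (local_rep M N j p) (at y) v) has_derivative
    (\<lambda>u. deriv2 (local_rep M N j p) (chart M p p) u v)) (at (chart M p p))"
  unfolding deriv2_def
  using smooth_on_differentiable[OF smooth_on_derivative[OF local_rep_smooth] chart_local_dom(2)]
  by (rule has_derivative_frechet)

lemma local_rep_has_derivative:
  "(chart N (j p) \<circ> (j \<circ> inv_chart M p) has_derivative dj p) (at (chart M p p))"
  using smooth_on_differentiable[OF local_rep_smooth chart_local_dom(2)]
  unfolding dj_local_rep local_rep_def o_assoc[symmetric] by (rule has_derivative_frechet)

text \<open>Symmetry combines the equality of mixed second derivatives with the symmetry of the
  ambient Christoffel map.\<close>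

lemma gauss_bilinear: "bilinear (gauss M N h j p)" and gauss_sym: "gauss M N h j p u v = gauss M N h j p v u"
proof -
  have "linear (christoffel N h (j p) X)" "linear (\<lambda>Y. christoffel N h (j p) Y X)" for X
    using N.christoffel_bilinear[of "j p"] by (simp_all add: bilinear_def)
  then have "linear (\<lambda>v. christoffel N h (j p) (dj p u) (dj p v))" "linear (\<lambda>u. christoffel N h (j p) (dj p u) (dj p v))" for u v
    by (auto intro: linear_compose[OF linear_dj, unfolded o_def])
  moreover have "bilinear (deriv2 (local_rep M N j p) (chart M p p))"
    by (rule deriv2_bilinear[OF chart_local_dom local_rep_smooth])
  ultimately show "bilinear (gauss M N h j p)"
    unfolding bilinear_def gauss_def by (simp add: linear_compose_add)
  show "gauss M N h j p u v = gauss M N h j p v u"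
    unfolding gauss_def using deriv2_sym[OF chart_local_dom local_rep_smooth] N.christoffel_sym by metis
qed

text \<open>A coordinate field has constant components, so its covariant derivative in
  \<open>M\<close> is only a Christoffel term, while the components of its image are first
  derivatives of \<open>local_rep\<close>, whose derivative is the Hessian in
  \<open>gauss\<close>.\<close>

lemma second_ff_gauss:
  "second_ff M N h j p u v = gauss M N h j p u v - dj p (christoffel M (pullback_metric M N h j) p u v)"
proof -
  have "dfun M (\<lambda>q. components N (j p) (j q) (dj q (coord_field M p v q))) p
      = dfun M (\<lambda>q. frechet_derivative (local_rep M N j p) (at (chart M p q)) v) p"
    using dj_coord_field by (intro M.dfun_cong[OF local_dom(1,2)])
  also have "\<dots> = (\<lambda>u. deriv2 (local_rep M N j p) (chart M p p) u v)"
  proof (rule dfun_eqI, rule has_derivative_transform_within_open[OF deriv2_has_derivative chart_local_dom])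
    show "frechet_derivative (local_rep M N j p) (at y) v
      = ((\<lambda>q. frechet_derivative (local_rep M N j p) (at (chart M p q)) v) \<circ> inv_chart M p) y"
      if "y \<in> chart M p ` local_dom p" for y using that by auto
  qed
  finally show ?thesis
    by (simp add: second_ff_def Let_def cov_along_def gauss_def M.cov_coord_field)
qed

lemma pullback_linear_derivative:
  assumes lin: "\<And>q. linear (\<theta> q :: 'n \<Rightarrow> real)"
    and dif: "\<And>v. ((\<lambda>q. \<theta> q (coord_field N (j p) v q)) \<circ> inv_chart N (j p)) differentiable (at (chart N (j p) (j p)))"
  shows "dfun M (\<lambda>q. \<theta> (j q) (dj q (coord_field M p a q))) p u
    = dfun N (\<lambda>q. \<theta> q (coord_field N (j p) (dj p a) q)) (j p) (dj p u)
      + \<theta> (j p) (deriv2 (local_rep M N j p) (chart M p p) u a)"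
proof -
  have "((\<lambda>y. \<theta> ((j \<circ> inv_chart M p) y) (coord_field N (j p) (frechet_derivative (local_rep M N j p) (at y) a) ((j \<circ> inv_chart M p) y)))
    has_derivative (\<lambda>u. dfun N (\<lambda>q. \<theta> q (coord_field N (j p)
        (frechet_derivative (local_rep M N j p) (at (chart M p p)) a) q)) (j p) (dj p u)
      + \<theta> (j p) (deriv2 (local_rep M N j p) (chart M p p) u a))) (at (chart M p p))"
    by (rule N.linear_family_has_derivative[OF lin dif local_rep_has_derivative _ deriv2_has_derivative chart_local_dom])
      auto
  then have "((\<lambda>q. \<theta> (j q) (dj q (coord_field M p a q))) \<circ> inv_chart M p has_derivative (\<lambda>u. dfun N (\<lambda>q. \<theta> q (coord_field N (j p)
        (frechet_derivative (local_rep M N j p) (at (chart M p p)) a) q)) (j p) (dj p u)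
      + \<theta> (j p) (deriv2 (local_rep M N j p) (chart M p p) u a))) (at (chart M p p))"
    by (rule has_derivative_transform_within_open[OF _ chart_local_dom]) (simp add: dj_coord_field')
  from dfun_eqI[OF this] show ?thesis by (simp add: dj_local_rep)
qed

lemma pullback_bilinear_derivative:
  assumes bil: "\<And>q. bilinear (B q :: 'n \<Rightarrow> 'n \<Rightarrow> real)"
    and dif: "\<And>v w. ((\<lambda>q. B q (coord_field N (j p) v q) (coord_field N (j p) w q)) \<circ> inv_chart N (j p))
      differentiable (at (chart N (j p) (j p)))"
  shows "dfun M (\<lambda>q. B (j q) (dj q (coord_field M p a q)) (dj q (coord_field M p b q))) p u
    = dfun N (\<lambda>q. B q (coord_field N (j p) (dj p a) q) (coord_field N (j p) (dj p b) q)) (j p) (dj p u)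
      + B (j p) (deriv2 (local_rep M N j p) (chart M p p) u a) (dj p b)
      + B (j p) (dj p a) (deriv2 (local_rep M N j p) (chart M p p) u b)"
proof -
  let ?D = "\<lambda>a y. frechet_derivative (local_rep M N j p) (at y) a"
  let ?E = "\<lambda>u. dfun N (\<lambda>q. B q (coord_field N (j p) (?D a (chart M p p)) q) (coord_field N (j p) (?D b (chart M p p)) q)) (j p) (dj p u)
      + B (j p) (deriv2 (local_rep M N j p) (chart M p p) u a) (?D b (chart M p p))
      + B (j p) (?D a (chart M p p)) (deriv2 (local_rep M N j p) (chart M p p) u b)"
  have "((\<lambda>y. B ((j \<circ> inv_chart M p) y) (coord_field N (j p) (?D a y) ((j \<circ> inv_chart M p) y))
      (coord_field N (j p) (?D b y) ((j \<circ> inv_chart M p) y))) has_derivative ?E) (at (chart M p p))"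
    by (rule N.bilinear_family_has_derivative[OF bil dif local_rep_has_derivative _
          deriv2_has_derivative deriv2_has_derivative chart_local_dom])
      auto
  then have "((\<lambda>q. B (j q) (dj q (coord_field M p a q)) (dj q (coord_field M p b q))) \<circ> inv_chart M p
      has_derivative ?E) (at (chart M p p))"
    by (rule has_derivative_transform_within_open[OF _ chart_local_dom]) (simp add: dj_coord_field')
  from dfun_eqI[OF this] show ?thesis by (simp add: dj_local_rep)
qed

text \<open>The ambient Christoffel terms of the metric derivative and the Hessian terms of the
  moving pushed-forward vectors pair up to form \<open>gauss\<close>.\<close>

lemma pullback_metric_derivative:
  "dfun M (\<lambda>q. pullback_metric M N h j q (coord_field M p a q) (coord_field M p b q)) p u
    = h (j p) (gauss M N h j p u a) (dj p b) + h (j p) (dj p a) (gauss M N h j p u b)"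
proof -
  interpret H: inner_form "h (j p)" by (rule N.inner_form)
  show ?thesis
    unfolding pullback_metric_def
      pullback_bilinear_derivative[of h, OF N.metric_bilinear N.metric_coord_differentiable] N.christoffel_metric
    by (simp add: gauss_def H.add_left H.add_right)
qed

end

locale immersed_submanifold = smooth_submanifold M N h j
  for M :: "('m::{t2_space,second_countable_topology}, 'e::euclidean_space) charts"
    and N :: "('p::{t2_space,second_countable_topology}, 'n::euclidean_space) charts" and h j +
  assumes inj_dj: "inj (dmap M N j p)"
begin

lemma pullback_inner_form: "inner_form (pullback_metric M N h j p)"
  unfolding pullback_metric_def by (rule inner_form_pullback[OF N.inner_form linear_dj inj_dj])

text \<open>The tangential part of the ambient derivative is torsion-free and metric.\<close>

lemma christoffel_pullback:
  "is_christoffel M (pullback_metric M N h j) p (christoffel M (pullback_metric M N h j) p)"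
  "h (j p) (dj p (christoffel M (pullback_metric M N h j) p u v)) (dj p w) = h (j p) (gauss M N h j p u v) (dj p w)"
proof -
  let ?g = "pullback_metric M N h j"
  interpret H: inner_form "h (j p)" by (rule N.inner_form)
  interpret G: inner_form "?g p" by (rule pullback_inner_form)
  have "linear (\<lambda>w. h (j p) X (dj p w))" for X
    using linear_compose[OF linear_dj H.linear_right] by (simp add: o_def)
  from theI'[OF G.riesz[OF this]]
  have riesz: "?g p (THE w. \<forall>v. ?g p w v = h (j p) X (dj p v)) v = h (j p) X (dj p v)" for X v by blast
  \<comment> \<open>Riesz representation yields the tangential part of \<open>gauss\<close>; once
    this has the defining properties, uniqueness identifies it with the Christoffel map.\<close>
  define \<Gamma> where "\<Gamma> u v = (THE w. \<forall>t. ?g p w t = h (j p) (gauss M N h j p u v) (dj p t))" for u v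
  have \<Gamma>: "?g p (\<Gamma> u v) w = h (j p) (gauss M N h j p u v) (dj p w)" for u v w
    unfolding \<Gamma>_def by (rule riesz)
  have sym: "\<Gamma> u v = \<Gamma> v u" for u v by (rule G.form_ext) (simp only: \<Gamma> gauss_sym[of p u])
  have "linear (\<Gamma> u)" for u
    by (rule linearI; rule G.form_ext)
      (simp_all add: G.add_left G.scale_left \<Gamma> bilinear_radd[OF gauss_bilinear] bilinear_rmul[OF gauss_bilinear]
        H.add_left H.scale_left)
  moreover from this have "linear (\<lambda>u. \<Gamma> u v)" for v by (simp only: sym[of _ v])
  ultimately have "bilinear \<Gamma>" unfolding bilinear_def by blast
  moreover have "?g p v (\<Gamma> u w) = h (j p) (dj p v) (gauss M N h j p u w)" for u v w
    unfolding G.sym[of v] \<Gamma> by (rule H.sym)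
  ultimately have "is_christoffel M ?g p \<Gamma>"
    unfolding is_christoffel_def pullback_metric_derivative using sym \<Gamma> by simp
  moreover from this have "christoffel M ?g p = \<Gamma>" by (rule christoffel_eqI[where g = ?g and p = p, OF pullback_inner_form])
  ultimately show "is_christoffel M ?g p (christoffel M ?g p)"
    "h (j p) (dj p (christoffel M ?g p u v)) (dj p w) = h (j p) (gauss M N h j p u v) (dj p w)"
    using \<Gamma>[of u v w] by (simp_all add: pullback_metric_def)
qed

lemma second_ff_normal: "h (j p) (second_ff M N h j p u v) (dj p w) = 0"
  by (simp add: second_ff_gauss bilinear_lsub[OF N.metric_bilinear] christoffel_pullback(2))

lemma second_ff_sym: "second_ff M N h j p u v = second_ff M N h j p v u"
  using christoffel_pullback(1)[of p] gauss_sym[of p u v] by (simp add: second_ff_gauss is_christoffel_def)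

lemma second_ff_bilinear: "bilinear (second_ff M N h j p)"
proof -
  have "linear (\<lambda>v. dj p (christoffel M (pullback_metric M N h j) p u v))"
    "linear (\<lambda>v. dj p (christoffel M (pullback_metric M N h j) p v u))" for u
    using christoffel_pullback(1)[of p]
    by (auto simp: is_christoffel_def bilinear_def intro: linear_compose[OF _ linear_dj, unfolded o_def])
  then show ?thesis
    using gauss_bilinear[of p] unfolding bilinear_def second_ff_gauss by (auto intro: linear_compose_sub)
qed

end

section \<open>Leaves of a product\<close>

text \<open>A map \<open>e\<close> that is affine in the charts, such as the inclusion of a leaf.\<close>

locale affine_leaf = smooth_submanifold L N h j + B: manifold M
  for L :: "('l::{t2_space,second_countable_topology}, 'k::euclidean_space) charts"
    and N :: "('p::{t2_space,second_countable_topology}, 'n::euclidean_space) charts" and h j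
    and M :: "('m::{t2_space,second_countable_topology}, 'e::euclidean_space) charts" +
  fixes e :: "'m \<Rightarrow> 'l" and A :: "'e \<Rightarrow> 'k" and b :: "'m \<Rightarrow> 'k"
  assumes continuous_e: "continuous_on UNIV e" and linear_A: "linear A"
    and e_cdom: "x' \<in> cdom M x \<Longrightarrow> e x' \<in> cdom L (e x)"
    and e_chart: "x' \<in> cdom M x \<Longrightarrow> chart L (e x) (e x') = A (chart M x x') + b x"
begin

lemma affine_derivative: "((\<lambda>y. A y + b x) has_derivative A) (at y)"
  using has_derivative_add[OF linear_imp_has_derivative[OF linear_A] has_derivative_const] by simp

lemma affine_smooth: "open S \<Longrightarrow> smooth_on S (\<lambda>y. A y + b x)"
  unfolding smooth_on_def by (intro allI Ck_on_add Ck_on_linear Ck_on_const linear_A)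

lemma inv_chart_affine:
  "x' \<in> cdom M x \<Longrightarrow> inv_chart L (e x) (A (chart M x x') + b x) = e x'"
  using e_chart[of x' x] M.inv_chart_chart[OF e_cdom[of x' x]] by simp

lemma smooth_map_leaf: "smooth_map M N (j \<circ> e)"
  unfolding smooth_map_def smooth_fun_on_def
proof (intro conjI allI)
  show cont: "continuous_on UNIV (j \<circ> e)"
    using smooth_map continuous_e continuous_on_subset by (intro continuous_on_compose) (auto simp: smooth_map_def)
  have cj: "continuous_on UNIV j" using smooth_map by (simp add: smooth_map_def)
  fix P x
  let ?S = "chart M x ` ((j \<circ> e) -` cdom N P \<inter> cdom M x)"
  let ?T = "chart L (e x) ` (j -` cdom N P \<inter> cdom L (e x))"
  have S: "open ?S" by (intro B.open_chart_image open_vimage N.open_cdom cont)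
  show "smooth_on ?S (chart N P \<circ> (j \<circ> e) \<circ> inv_chart M x)"
  proof (rule smooth_on_cong[OF S])
    show "smooth_on ?S ((chart N P \<circ> j \<circ> inv_chart L (e x)) \<circ> (\<lambda>y. A y + b x))"
    proof (rule smooth_on_compose[OF S])
      show "open ?T" by (intro M.open_chart_image open_vimage N.open_cdom cj)
      show "smooth_on ?T (chart N P \<circ> j \<circ> inv_chart L (e x))" by (rule smooth_map_local[OF smooth_map])
      show "smooth_on ?S (\<lambda>y. A y + b x)" by (rule affine_smooth[OF S])
      show "(\<lambda>y. A y + b x) ` ?S \<subseteq> ?T"
      proof (clarsimp simp: image_iff)
        fix x' assume x': "j (e x') \<in> cdom N P" "x' \<in> cdom M x"
        then show "\<exists>q\<in>j -` cdom N P \<inter> cdom L (e x). A (chart M x x') + b x = chart L (e x) q"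
          using e_chart[OF x'(2)] e_cdom[OF x'(2)] by (intro bexI[of _ "e x'"]) auto
      qed
    qed
  qed (auto simp: inv_chart_affine)
qed

sublocale leaf: smooth_submanifold M N h "j \<circ> e"
  by unfold_locales (rule smooth_map_leaf)

lemma local_rep_leaf:
  assumes "y \<in> chart M x ` leaf.local_dom x"
  shows "local_rep M N (j \<circ> e) x y = local_rep L N j (e x) (A y + b x)"
  using assms by (auto simp: local_rep_def inv_chart_affine)

lemma local_dom_leaf:
  assumes "y \<in> chart M x ` leaf.local_dom x"
  shows "A y + b x \<in> chart L (e x) ` local_dom (e x)"
proof -
  obtain x' where x': "x' \<in> leaf.local_dom x" "y = chart M x x'" using assms by auto
  have c: "x' \<in> cdom M x" and "(j \<circ> e) x' \<in> cdom N ((j \<circ> e) x)" using leaf.local_dom_cdom[OF x'(1)] .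
  then have "e x' \<in> local_dom (e x)" using e_cdom[OF c] unfolding local_dom_def by fastforce
  from imageI[OF this, of "chart L (e x)"] show ?thesis using e_chart[OF c] x'(2) by simp
qed

lemma local_rep_leaf_derivative:
  assumes y: "y \<in> chart M x ` leaf.local_dom x"
  shows "frechet_derivative (local_rep M N (j \<circ> e) x) (at y) v
    = frechet_derivative (local_rep L N j (e x)) (at (A y + b x)) (A v)"
proof -
  have "(local_rep L N j (e x) \<circ> (\<lambda>y. A y + b x) has_derivative
      frechet_derivative (local_rep L N j (e x)) (at (A y + b x)) \<circ> A) (at y)"
    using smooth_on_differentiable[OF local_rep_smooth local_dom_leaf[OF y]]
    by (intro diff_chain_at affine_derivative has_derivative_frechet)
  then have "(local_rep M N (j \<circ> e) x has_derivative
      frechet_derivative (local_rep L N j (e x)) (at (A y + b x)) \<circ> A) (at y)"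
    by (rule has_derivative_transform_within_open[OF _ leaf.chart_local_dom(1) y]) (simp add: local_rep_leaf)
  from frechet_derivative_eqI[OF this] show ?thesis by simp
qed

lemma affine_base: "A (chart M x x) + b x = chart L (e x) (e x)"
  using e_chart[of x x] by simp

lemma dmap_leaf: "dmap M N (j \<circ> e) x v = dj (e x) (A v)"
  using local_rep_leaf_derivative[OF leaf.chart_local_dom(2)]
  by (simp add: leaf.dj_local_rep dj_local_rep affine_base)

text \<open>An affine inclusion has no second derivative, so the Hessian of the composite is the
  restricted Hessian. The second fundamental forms of a leaf and of the whole submanifold thus
  differ only through the tangential part that is subtracted.\<close>

lemma gauss_leaf: "gauss M N h (j \<circ> e) x u v = gauss L N h j (e x) (A u) (A v)"
proof -
  have "((\<lambda>y. frechet_derivative (local_rep L N j (e x)) (at (A y + b x)) (A v)) has_derivative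
    (\<lambda>u. deriv2 (local_rep L N j (e x)) (chart L (e x) (e x)) (A u) (A v))) (at (chart M x x))"
    by (rule has_derivative_compose[OF affine_derivative, where g = "\<lambda>y. frechet_derivative (local_rep L N j (e x)) (at y) (A v)"])
      (simp add: affine_base deriv2_has_derivative)
  then have "((\<lambda>y. frechet_derivative (local_rep M N (j \<circ> e) x) (at y) v) has_derivative
    (\<lambda>u. deriv2 (local_rep L N j (e x)) (chart L (e x) (e x)) (A u) (A v))) (at (chart M x x))"
    by (rule has_derivative_transform_within_open[OF _ leaf.chart_local_dom]) (simp add: local_rep_leaf_derivative)
  from frechet_derivative_eqI[OF this] show ?thesis
    by (simp add: gauss_def deriv2_def dmap_leaf)
qed

lemma pullback_metric_leaf:
  "pullback_metric M N h (j \<circ> e) x u v = pullback_metric L N h j (e x) (A u) (A v)"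
  by (simp add: pullback_metric_def dmap_leaf)

lemma second_ff_leaf:
  "second_ff M N h (j \<circ> e) x u v = gauss L N h j (e x) (A u) (A v)
    - dj (e x) (A (christoffel M (pullback_metric M N h (j \<circ> e)) x u v))"
  by (simp add: leaf.second_ff_gauss gauss_leaf dmap_leaf)

end

section \<open>Bi-warped products\<close>

lemma coord_field_prod:
  assumes "smooth_manifold M" "smooth_manifold N" and x': "x' \<in> cdom M x" and y': "y' \<in> cdom N y"
  shows "coord_field (prod_charts M N) (x, y) (u, v) (x', y') = (coord_field M x u x', coord_field N y v y')"
proof -
  interpret M: manifold M by unfold_locales fact
  interpret N: manifold N by unfold_locales fact
  let ?S = "chart M x ` (UNIV \<inter> cdom M x) \<times> chart N y ` (UNIV \<inter> cdom N y)"
  have "((\<lambda>z. ((chart M x' \<circ> inv_chart M x) (fst z), (chart N y' \<circ> inv_chart N y) (snd z))) has_derivative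
    (\<lambda>z. (M.change x x' x' (fst z), N.change y y' y' (snd z)))) (at (chart M x x', chart N y y'))"
    using has_derivative_compose[OF bounded_linear_imp_has_derivative[OF bounded_linear_fst], of "chart M x' \<circ> inv_chart M x" _ "(chart M x x', chart N y y')"]
      has_derivative_compose[OF bounded_linear_imp_has_derivative[OF bounded_linear_snd], of "chart N y' \<circ> inv_chart N y" _ "(chart M x x', chart N y y')"]
      M.change_has_derivative[OF x', of x'] N.change_has_derivative[OF y', of y']
    by (intro has_derivative_Pair) auto
  then have "(chart (prod_charts M N) (x', y') \<circ> inv_chart (prod_charts M N) (x, y) has_derivative
    (\<lambda>z. (M.change x x' x' (fst z), N.change y y' y' (snd z)))) (at (chart M x x', chart N y y'))"
  proof (rule has_derivative_transform_within_open[where s = ?S])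
    show "open ?S" by (intro open_Times M.open_chart_image N.open_chart_image open_UNIV)
  qed (use x' y' in \<open>auto simp: inv_chart_prod[OF assms(1,2)]\<close>)
  from frechet_derivative_eqI[OF this] show ?thesis
    by (simp add: coord_field_def)
qed

lemma prod_fst_has_derivative:
  assumes "smooth_manifold M" "smooth_manifold N"
    and "(f \<circ> inv_chart M x) differentiable (at (chart M x x))"
  shows "((\<lambda>q. f (fst q)) \<circ> inv_chart (prod_charts M N) (x, y) has_derivative
    (\<lambda>z. dfun M f x (fst z))) (at (chart (prod_charts M N) (x, y) (x, y)))"
proof -
  interpret M: manifold M by unfold_locales fact
  interpret N: manifold N by unfold_locales fact
  let ?S = "chart M x ` (UNIV \<inter> cdom M x) \<times> chart N y ` (UNIV \<inter> cdom N y)"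
  have "((\<lambda>z. (f \<circ> inv_chart M x) (fst z)) has_derivative (\<lambda>z. dfun M f x (fst z))) (at (chart M x x, chart N y y))"
    using has_derivative_compose[OF bounded_linear_imp_has_derivative[OF bounded_linear_fst], of "f \<circ> inv_chart M x" _ "(chart M x x, chart N y y)"]
      dfun_has_derivative[OF assms(3)] by auto
  then show ?thesis unfolding prod_charts_simps map_prod_simp
  proof (rule has_derivative_transform_within_open[where s = ?S])
    show "open ?S" by (intro open_Times M.open_chart_image N.open_chart_image open_UNIV)
  qed (auto simp: inv_chart_prod[OF assms(1,2)])
qed

lemma prod_snd_has_derivative:
  assumes "smooth_manifold M" "smooth_manifold N"
    and "(f \<circ> inv_chart N y) differentiable (at (chart N y y))"
  shows "((\<lambda>q. f (snd q)) \<circ> inv_chart (prod_charts M N) (x, y) has_derivative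
    (\<lambda>z. dfun N f y (snd z))) (at (chart (prod_charts M N) (x, y) (x, y)))"
proof -
  interpret M: manifold M by unfold_locales fact
  interpret N: manifold N by unfold_locales fact
  let ?S = "chart M x ` (UNIV \<inter> cdom M x) \<times> chart N y ` (UNIV \<inter> cdom N y)"
  have "((\<lambda>z. (f \<circ> inv_chart N y) (snd z)) has_derivative (\<lambda>z. dfun N f y (snd z))) (at (chart M x x, chart N y y))"
    using has_derivative_compose[OF bounded_linear_imp_has_derivative[OF bounded_linear_snd], of "f \<circ> inv_chart N y" _ "(chart M x x, chart N y y)"]
      dfun_has_derivative[OF assms(3)] by auto
  then show ?thesis unfolding prod_charts_simps map_prod_simp
  proof (rule has_derivative_transform_within_open[where s = ?S])
    show "open ?S" by (intro open_Times M.open_chart_image N.open_chart_image open_UNIV)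
  qed (auto simp: inv_chart_prod[OF assms(1,2)])
qed

text \<open>A leaf in a fibre direction carries the factor metric times the square of a warping
  function at a fixed base point. Such a constant leaves the Christoffel map unchanged.\<close>

lemma (in manifold) is_christoffel_scale:
  assumes "is_christoffel M g p \<Gamma>"
    and "\<And>v w. ((\<lambda>q. g q (coord_field M p v q) (coord_field M p w q)) \<circ> inv_chart M p) differentiable (at (chart M p p))"
  shows "is_christoffel M (\<lambda>q u v. c * g q u v) p \<Gamma>"
proof -
  have "dfun M (\<lambda>q. c * g q (coord_field M p v q) (coord_field M p w q)) p
      = (\<lambda>u. c * dfun M (\<lambda>q. g q (coord_field M p v q) (coord_field M p w q)) p u)" for v w
    using has_derivative_mult_right[OF dfun_has_derivative[OF assms(2)]] by (intro dfun_eqI) (simp add: o_def)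
  then show ?thesis using assms(1) by (simp add: is_christoffel_def distrib_left)
qed

text \<open>The connection of a warped product: a base vector \<open>X\<close> and a fibre vector
  \<open>V\<close> give \<open>(X f / f) V\<close>, and two vectors \<open>V\<close>,
  \<open>W\<close> of the same fibre give the connection of the factor minus
  \<open>g(V, W) / f\<close> times the gradient of \<open>f\<close>. The warped
  \<open>g(V, W)\<close> contains \<open>f\<^sup>2\<close>, which leaves the single factor
  \<open>f\<close> here.\<close>

definition warped_christoffel ::
    "('a, 'e::euclidean_space) charts \<Rightarrow> ('a, 'e) metric
      \<Rightarrow> ('b, 'f::euclidean_space) charts \<Rightarrow> ('b, 'f) metric
      \<Rightarrow> ('c, 'h::euclidean_space) charts \<Rightarrow> ('c, 'h) metric
      \<Rightarrow> ('a \<Rightarrow> real) \<Rightarrow> ('a \<Rightarrow> real)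
      \<Rightarrow> 'a \<times> 'b \<times> 'c \<Rightarrow> 'e \<times> 'f \<times> 'h \<Rightarrow> 'e \<times> 'f \<times> 'h \<Rightarrow> 'e \<times> 'f \<times> 'h" where
  "warped_christoffel L1 g1 L2 g2 L3 g3 f2 f3 = (\<lambda>(x, y, z) (u, v, w) (u', v', w').
     (christoffel L1 g1 x u u' - (f2 x * g2 y v v') *\<^sub>R grad L1 g1 f2 x - (f3 x * g3 z w w') *\<^sub>R grad L1 g1 f3 x,
      christoffel L2 g2 y v v' + (dfun L1 f2 x u / f2 x) *\<^sub>R v' + (dfun L1 f2 x u' / f2 x) *\<^sub>R v,
      christoffel L3 g3 z w w' + (dfun L1 f3 x u / f3 x) *\<^sub>R w' + (dfun L1 f3 x u' / f3 x) *\<^sub>R w))"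

lemma (in riemannian) grad:
  assumes "(f \<circ> inv_chart M p) differentiable (at (chart M p p))"
  shows "g p (grad M g f p) v = dfun M f p v"
  using theI'[OF inner_form.riesz[OF inner_form dfun_linear[OF assms]]] unfolding grad_def by blast

locale bi_warped = T: riemannian L1 g1 + P: riemannian L2 g2 + S: riemannian L3 g3
  for L1 :: "('a::{t2_space,second_countable_topology}, 'e::euclidean_space) charts" and g1
    and L2 :: "('b::{t2_space,second_countable_topology}, 'f::euclidean_space) charts" and g2
    and L3 :: "('c::{t2_space,second_countable_topology}, 'h::euclidean_space) charts" and g3 +
  fixes f2 f3 :: "'a \<Rightarrow> real"
  assumes f2: "warping_function L1 f2" and f3: "warping_function L1 f3"
begin

abbreviation "L \<equiv> prod_charts L1 (prod_charts L2 L3)"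
abbreviation "gL \<equiv> bi_warped_metric g1 g2 g3 f2 f3"

lemma warping_pos: "0 < f2 x" "0 < f3 x" and warping_nz [simp]: "f2 x \<noteq> 0" "f3 x \<noteq> 0"
  using f2 f3 by (simp_all add: warping_function_def) (metis less_irrefl)+

lemma warping_differentiable:
  "(f2 \<circ> inv_chart L1 x) differentiable (at (chart L1 x x))"
  "(f3 \<circ> inv_chart L1 x) differentiable (at (chart L1 x x))"
  using T.smooth_fun_on_differentiable[of UNIV f2 x x] T.smooth_fun_on_differentiable[of UNIV f3 x x] f2 f3
  by (simp_all add: warping_function_def)

lemmas smooth_mfds = T.smooth_manifold P.smooth_manifold S.smooth_manifold
  smooth_manifold_prod[OF P.smooth_manifold S.smooth_manifold]

lemma smooth_manifold_L: "smooth_manifold L"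
  by (intro smooth_manifold_prod smooth_mfds)

lemma inner_form_L: "inner_form (gL p)"
proof -
  obtain x y z where p: "p = (x, y, z)" using prod_cases3 by blast
  interpret T1: inner_form "g1 x" by (rule T.inner_form)
  interpret P1: inner_form "g2 y" by (rule P.inner_form)
  interpret S1: inner_form "g3 z" by (rule S.inner_form)
  show ?thesis unfolding p
  proof
    show "bilinear (gL (x, y, z))"
      by (auto simp: bilinear_def bi_warped_metric_def T1.form_simps P1.form_simps S1.form_simps algebra_simps
          intro!: linearI)
    show "gL (x, y, z) u v = gL (x, y, z) v u" for u v
      by (cases u; cases v) (simp add: bi_warped_metric_def T1.sym P1.sym S1.sym)
    fix u :: "'e \<times> 'f \<times> 'h" assume "u \<noteq> 0"
    obtain a b c where u: "u = (a, b, c)" using prod_cases3 by blast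
    have "0 \<le> g1 x a a" "0 \<le> (f2 x)\<^sup>2 * g2 y b b" "0 \<le> (f3 x)\<^sup>2 * g3 z c c"
      using T1.nonneg P1.nonneg S1.nonneg by simp_all
    moreover have "0 < g1 x a a \<or> 0 < (f2 x)\<^sup>2 * g2 y b b \<or> 0 < (f3 x)\<^sup>2 * g3 z c c"
      using \<open>u \<noteq> 0\<close> T1.pos P1.pos S1.pos unfolding u by (auto simp: zero_prod_def)
    ultimately show "0 < gL (x, y, z) u u" by (auto simp: bi_warped_metric_def u)
  qed
qed

lemma coord_field_L:
  assumes "x' \<in> cdom L1 x" "y' \<in> cdom L2 y" "z' \<in> cdom L3 z"
  shows "coord_field L (x, y, z) (u, v, w) (x', y', z')
    = (coord_field L1 x u x', coord_field L2 y v y', coord_field L3 z w z')"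
  using assms by (simp add: coord_field_prod smooth_mfds)

text \<open>The formula is checked against the characterization of the Christoffel map: symmetry and
  bilinearity are direct, and the metric identity is the product rule for a squared warping function
  times a fibre metric. Uniqueness concludes.\<close>

lemma christoffel_L: "christoffel L gL p = warped_christoffel L1 g1 L2 g2 L3 g3 f2 f3 p"
proof -
  interpret L: manifold L by unfold_locales (rule smooth_manifold_L)
  obtain x y z where p: "p = (x, y, z)" using prod_cases3 by blast
  interpret T1: inner_form "g1 x" by (rule T.inner_form)
  interpret P1: inner_form "g2 y" by (rule P.inner_form)
  interpret S1: inner_form "g3 z" by (rule S.inner_form)
  let ?W = "warped_christoffel L1 g1 L2 g2 L3 g3 f2 f3 (x, y, z)"
  note dlin = linear_add[OF dfun_linear[OF warping_differentiable(1)]] linear_scale[OF dfun_linear[OF warping_differentiable(1)]]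
    linear_add[OF dfun_linear[OF warping_differentiable(2)]] linear_scale[OF dfun_linear[OF warping_differentiable(2)]]
  note \<Gamma>lin = bilinear_radd[OF T.christoffel_bilinear] bilinear_rmul[OF T.christoffel_bilinear]
    bilinear_radd[OF P.christoffel_bilinear] bilinear_rmul[OF P.christoffel_bilinear]
    bilinear_radd[OF S.christoffel_bilinear] bilinear_rmul[OF S.christoffel_bilinear]
  have sym: "?W u v = ?W v u" for u v
  proof -
    obtain u1 u2 u3 v1 v2 v3 where "u = (u1, u2, u3)" "v = (v1, v2, v3)" using prod_cases3 by metis
    then show ?thesis
      using T.christoffel_sym[of x u1 v1] P.christoffel_sym[of y u2 v2] S.christoffel_sym[of z u3 v3]
        P1.sym[of u2 v2] S1.sym[of u3 v3]
      by (simp add: warped_christoffel_def add_ac)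
  qed
  have lin: "linear (?W u)" for u
    by (cases u; rule linearI)
      (auto simp: warped_christoffel_def dlin \<Gamma>lin P1.form_simps S1.form_simps algebra_simps add_divide_distrib)
  then have "linear (\<lambda>u. ?W u v)" for v by (simp only: sym[of _ v])
  with lin have "bilinear ?W" by (simp add: bilinear_def)
  moreover have "dfun L (\<lambda>q. gL q (coord_field L (x, y, z) v q) (coord_field L (x, y, z) w q)) (x, y, z) u
      = gL (x, y, z) (?W u v) w + gL (x, y, z) v (?W u w)" for u v w
  proof -
    obtain u1 u2 u3 v1 v2 v3 w1 w2 w3 where uvw: "u = (u1, u2, u3)" "v = (v1, v2, v3)" "w = (w1, w2, w3)"
      using prod_cases3 by metis
    define bT where "bT q = g1 q (coord_field L1 x v1 q) (coord_field L1 x w1 q)" for q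
    define bP where "bP q = g2 q (coord_field L2 y v2 q) (coord_field L2 y w2 q)" for q
    define bS where "bS q = g3 q (coord_field L3 z v3 q) (coord_field L3 z w3 q)" for q
    have b_diff: "(bT \<circ> inv_chart L1 x) differentiable (at (chart L1 x x))"
      "(bP \<circ> inv_chart L2 y) differentiable (at (chart L2 y y))"
      "(bS \<circ> inv_chart L3 z) differentiable (at (chart L3 z z))"
      using T.metric_coord_differentiable P.metric_coord_differentiable S.metric_coord_differentiable
      by (simp_all add: bT_def[abs_def] bP_def[abs_def] bS_def[abs_def])
    let ?x = "chart L (x, y, z) (x, y, z)"
    note fst_der = prod_fst_has_derivative[OF T.smooth_manifold smooth_mfds(4), of _ x "(y, z)"]
    note snd_der = prod_snd_has_derivative[OF T.smooth_manifold smooth_mfds(4), of _ "(y, z)" x]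
    have DP: "((\<lambda>q. bP (fst (snd q))) \<circ> inv_chart L (x, y, z) has_derivative (\<lambda>t. dfun L2 bP y (fst (snd t)))) (at ?x)"
    proof -
      note D = prod_fst_has_derivative[OF P.smooth_manifold S.smooth_manifold b_diff(2), of z]
      show ?thesis
        using snd_der[of "\<lambda>q. bP (fst q)"] D dfun_eqI[OF D] by (auto simp: differentiable_def)
    qed
    have DS: "((\<lambda>q. bS (snd (snd q))) \<circ> inv_chart L (x, y, z) has_derivative (\<lambda>t. dfun L3 bS z (snd (snd t)))) (at ?x)"
    proof -
      note D = prod_snd_has_derivative[OF P.smooth_manifold S.smooth_manifold b_diff(3), of y]
      show ?thesis
        using snd_der[of "\<lambda>q. bS (snd q)"] D dfun_eqI[OF D] by (auto simp: differentiable_def)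
    qed
    define F where "F q = bT (fst q) + (f2 (fst q))\<^sup>2 * bP (fst (snd q)) + (f3 (fst q))\<^sup>2 * bS (snd (snd q))" for q :: "'a \<times> 'b \<times> 'c"
    have at_base: "inv_chart L (x, y, z) ?x = (x, y, z)" by (rule L.inv_chart_chart[OF L.in_cdom])
    have "dfun L (\<lambda>q. gL q (coord_field L (x, y, z) v q) (coord_field L (x, y, z) w q)) (x, y, z) = dfun L F (x, y, z)"
      by (rule L.dfun_cong[OF L.open_cdom L.in_cdom])
        (auto simp: uvw coord_field_L bi_warped_metric_def F_def bT_def bP_def bS_def)
    also have "\<dots> = (\<lambda>t. dfun L1 bT x (fst t) + ((f2 x)\<^sup>2 * dfun L2 bP y (fst (snd t)) + 2 * f2 x * dfun L1 f2 x (fst t) * bP y)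
      + ((f3 x)\<^sup>2 * dfun L3 bS z (snd (snd t)) + 2 * f3 x * dfun L1 f3 x (fst t) * bS z))"
    proof (rule dfun_eqI)
      note d = fst_der[OF b_diff(1)] fst_der[OF warping_differentiable(1)] fst_der[OF warping_differentiable(2)] DP DS
      have F: "F = (\<lambda>q. bT (fst q) + (f2 (fst q) * f2 (fst q)) * bP (fst (snd q)) + (f3 (fst q) * f3 (fst q)) * bS (snd (snd q)))"
        by (simp add: F_def[abs_def] power2_eq_square)
      have "(F \<circ> inv_chart L (x, y, z) has_derivative
        (\<lambda>t. dfun L1 bT x (fst t) + ((f2 x * f2 x) * dfun L2 bP y (fst (snd t)) + (f2 x * dfun L1 f2 x (fst t) + dfun L1 f2 x (fst t) * f2 x) * bP y)
          + ((f3 x * f3 x) * dfun L3 bS z (snd (snd t)) + (f3 x * dfun L1 f3 x (fst t) + dfun L1 f3 x (fst t) * f3 x) * bS z))) (at ?x)"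
        using has_derivative_add[OF has_derivative_add[OF d(1) has_derivative_mult[OF has_derivative_mult[OF d(2) d(2)] d(4)]]
            has_derivative_mult[OF has_derivative_mult[OF d(3) d(3)] d(5)]] at_base
        by (simp add: F o_def del: prod_charts_simps)
      then show "(F \<circ> inv_chart L (x, y, z) has_derivative (\<lambda>t. dfun L1 bT x (fst t)
        + ((f2 x)\<^sup>2 * dfun L2 bP y (fst (snd t)) + 2 * f2 x * dfun L1 f2 x (fst t) * bP y)
        + ((f3 x)\<^sup>2 * dfun L3 bS z (snd (snd t)) + 2 * f3 x * dfun L1 f3 x (fst t) * bS z))) (at ?x)"
        by (rule has_derivative_eq_rhs) (simp add: power2_eq_square fun_eq_iff)
    qed
    finally show ?thesis
      using T.christoffel_metric[of x v1 w1 u1] P.christoffel_metric[of y v2 w2 u2] S.christoffel_metric[of z v3 w3 u3]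
        P1.sym[of u2 v2] S1.sym[of u3 v3] P1.sym[of v2] S1.sym[of v3]
        T1.sym[of v1 "christoffel L1 g1 x u1 w1"] T1.sym[of v1 "grad L1 g1 f2 x"] T1.sym[of v1 "grad L1 g1 f3 x"]
      by (simp add: uvw bT_def[abs_def] bP_def[abs_def] bS_def[abs_def] bi_warped_metric_def warped_christoffel_def
          T1.form_simps P1.form_simps S1.form_simps T.grad warping_differentiable power2_eq_square algebra_simps)
  qed
  ultimately show ?thesis
    unfolding p using sym by (intro christoffel_eqI inner_form_L) (simp add: is_christoffel_def)
qed

end

section \<open>The inequality at a point\<close>

text \<open>Polarization; it passes from the lengths of the vectors \<open>F c\<close> in the slant
  estimate to their inner products.\<close>

lemma quadratic_form_polar:
  assumes "bilinear q" "bilinear r" "\<And>u v. q u v = q v u" "\<And>u v. r u v = r v u" "\<And>u. q u u = r u u"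
  shows "q u v = (r u v :: real)"
proof -
  have "2 * q u v = q (u + v) (u + v) - q u u - q v v"
    using assms(3)[of v u] by (simp add: bilinear_ladd[OF assms(1)] bilinear_radd[OF assms(1)])
  also have "\<dots> = r (u + v) (u + v) - r u u - r v v" by (simp only: assms(5))
  also have "\<dots> = 2 * r u v"
    using assms(4)[of v u] by (simp add: bilinear_ladd[OF assms(2)] bilinear_radd[OF assms(2)])
  finally show ?thesis by simp
qed

text \<open>
  In the application, \<open>d\<close> is the differential of the immersion, \<open>\<sigma>\<close> its second fundamental form,
  \<open>d (r, 0, 0) = \<xi>\<close>, \<open>\<tau>\<close> is the action of \<open>\<Phi>\<close> on the invariant factor, and \<open>G1\<close>, \<open>G2\<close> are the gradients of
  the logarithms of the warping functions. The forms \<open>bP\<close> and \<open>bS\<close> include the warping factors.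
\<close>

locale slant_point = T: inner_form bT + P: inner_form bP + S: inner_form bS + H: inner_form h
  for bT :: "'e::euclidean_space \<Rightarrow> 'e \<Rightarrow> real" and bP :: "'f::euclidean_space \<Rightarrow> 'f \<Rightarrow> real"
    and bS :: "'h::euclidean_space \<Rightarrow> 'h \<Rightarrow> real" and h :: "'n::euclidean_space \<Rightarrow> 'n \<Rightarrow> real" +
  fixes d :: "'e \<times> 'f \<times> 'h \<Rightarrow> 'n" and \<Phi> :: "'n \<Rightarrow> 'n" and \<xi> :: 'n and r :: 'e and \<tau> :: "'e \<Rightarrow> 'e"
    and \<sigma> :: "'e \<times> 'f \<times> 'h \<Rightarrow> 'e \<times> 'f \<times> 'h \<Rightarrow> 'n" and G1 G2 :: 'e and \<beta> \<nu> :: real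
  assumes linear_d: "linear d"
    and isometric: "h (d (a, b, c)) (d (a', b', c')) = bT a a' + bP b b' + bS c c'"
    and linear_\<Phi>: "linear \<Phi>" and skew: "h (\<Phi> X) Y = - h X (\<Phi> Y)"
    and \<Phi>_metric: "h (\<Phi> X) (\<Phi> Y) = h X Y - h \<xi> X * h \<xi> Y"
    and \<xi>: "\<xi> = d (r, 0, 0)" "h \<xi> \<xi> = 1"
    and \<tau>: "\<Phi> (d (a, 0, 0)) = d (\<tau> a, 0, 0)"
    and slant: "orthonormal_frame bS B \<Longrightarrow> (\<Sum>k\<in>B. (h (\<Phi> (d (0, 0, c))) (d (0, 0, k)))\<^sup>2) = (cos \<nu>)\<^sup>2 * bS c c"
    and \<nu>: "0 < \<nu>" "\<nu> < pi / 2"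
    and \<sigma>_bilinear: "bilinear \<sigma>" and \<sigma>_sym: "\<sigma> u v = \<sigma> v u" and \<sigma>_normal: "h (\<sigma> u v) (d w) = 0"
    and \<sigma>_TP: "h (\<sigma> (0, b, 0) (a, 0, 0)) (\<Phi> (d (0, b', 0))) = - bP b b' * bT G1 (\<tau> a)"
    and \<sigma>_TS: "h (\<sigma> (0, 0, c) (a, 0, 0)) (\<Phi> (d (0, 0, c')))
      = - bS c c' * bT G2 (\<tau> a) + (bT G2 a - \<beta> * bT r a) * h (\<Phi> (d (0, 0, c))) (d (0, 0, c'))"
    and G_\<xi>: "bT G1 r = \<beta>" "bT G2 r = \<beta>"
begin

definition bL where "bL = (\<lambda>(a, b, c) (a', b', c'). bT a a' + bP b b' + bS c c')"

lemma r_unit: "bT r r = 1"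
  using \<xi> isometric[of r 0 0 r 0 0] by simp

text \<open>Since \<open>\<Phi>\<close> is skew, Parseval makes the sum the squared length of
  \<open>\<tau> G\<close>, and \<open>\<Phi>\<close> preserves lengths except for the
  \<xi>-component \<open>\<beta>\<close> of \<open>G\<close>.\<close>

lemma sum_tau_sq:
  assumes B: "orthonormal_frame bT B" and G: "bT G r = \<beta>"
  shows "(\<Sum>e\<in>B. (bT G (\<tau> e))\<^sup>2) = bT G G - \<beta>\<^sup>2"
proof -
  have "bT G (\<tau> e) = - bT (\<tau> G) e" for e
    using skew[of "d (G, 0, 0)" "d (e, 0, 0)"] isometric[of G 0 0 "\<tau> e" 0 0] isometric[of "\<tau> G" 0 0 e 0 0]
    by (simp add: \<tau>)
  then have "(\<Sum>e\<in>B. (bT G (\<tau> e))\<^sup>2) = bT (\<tau> G) (\<tau> G)"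
    using T.parseval[OF B, of "\<tau> G" "\<tau> G"] by (simp add: power2_eq_square)
  also have "\<dots> = h (\<Phi> (d (G, 0, 0))) (\<Phi> (d (G, 0, 0)))" by (simp add: \<tau> isometric)
  also have "\<dots> = bT G G - \<beta>\<^sup>2" 
    unfolding \<Phi>_metric by (simp add: \<xi>(1) isometric G T.sym[of r G] power2_eq_square)
  finally show ?thesis .
qed

text \<open>\<open>G - \<beta> *\<^sub>R r\<close> is the part of \<open>G\<close> orthogonal to
  \<xi>, with the same squared length as \<open>\<tau> G\<close>. So both kinds of terms in the
  slant estimate sum to the same value.\<close>

lemma sum_shift_sq:
  assumes B: "orthonormal_frame bT B" and G: "bT G r = \<beta>"
  shows "(\<Sum>e\<in>B. (bT G e - \<beta> * bT r e)\<^sup>2) = bT G G - \<beta>\<^sup>2"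
proof -
  have "(\<Sum>e\<in>B. (bT G e - \<beta> * bT r e)\<^sup>2) = bT (G - \<beta> *\<^sub>R r) (G - \<beta> *\<^sub>R r)"
    using T.parseval[OF B, of "G - \<beta> *\<^sub>R r" "G - \<beta> *\<^sub>R r"] by (simp add: T.form_simps power2_eq_square)
  also have "\<dots> = bT G G - \<beta>\<^sup>2"
    using G T.sym[of r G] r_unit by (simp add: T.form_simps power2_eq_square)
  finally show ?thesis .
qed

text \<open>Among the images of the frame vectors only that of \<open>b\<close> itself pairs with
  \<open>\<sigma>\<close>, so Bessel with the single unit vector \<open>\<Phi> (d (0, b, 0))\<close>
  gives as much as the whole frame would.\<close>

lemma \<sigma>_TP_bound:
  assumes B: "orthonormal_frame bP B" and b: "b \<in> B"
  shows "(bT G1 (\<tau> a))\<^sup>2 \<le> h (\<sigma> (0, b, 0) (a, 0, 0)) (\<sigma> (0, b, 0) (a, 0, 0))"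
proof -
  have "(\<Sum>b'\<in>{b}. (h (\<sigma> (0, b, 0) (a, 0, 0)) (\<Phi> (d (0, b', 0))))\<^sup>2) / 1
      \<le> h (\<sigma> (0, b, 0) (a, 0, 0)) (\<sigma> (0, b, 0) (a, 0, 0))"
    using B b by (intro H.bessel) (auto simp: \<Phi>_metric \<xi>(1) isometric orthonormal_frame_def)
  then show ?thesis using B b by (simp add: \<sigma>_TP orthonormal_frame_def)
qed

lemma sin_pos: "0 < sin \<nu>"
  using \<nu> pi_gt_zero by (intro sin_gt_zero) linarith+

text \<open>Bessel for the vectors \<open>F k\<close>, the parts of \<open>\<Phi> (j k)\<close>
  orthogonal to the slant leaf. They are preferable to the unit vectors \<open>\<Phi> (j k)\<close>:
  normality of \<open>\<sigma>\<close> leaves the pairings unchanged, while division by the squared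
  length \<open>(sin \<nu>)\<^sup>2\<close>, less than 1, sharpens the estimate.\<close>

lemma \<sigma>_TS_bound:
  assumes B: "orthonormal_frame bS B" and c: "c \<in> B"
  shows "((bT G2 (\<tau> a))\<^sup>2 + (cos \<nu>)\<^sup>2 * (bT G2 a - \<beta> * bT r a)\<^sup>2) / (sin \<nu>)\<^sup>2
    \<le> h (\<sigma> (0, 0, c) (a, 0, 0)) (\<sigma> (0, 0, c) (a, 0, 0))"
proof -
  define j where "j c = d (0, 0, c)" for c
  have j_lin: "linear j"
    unfolding j_def by (rule linear_compose[OF _ linear_d, unfolded o_def]) (auto intro!: linearI)
  have jj: "h (j c) (j c') = bS c c'" for c c' by (simp add: j_def isometric)
  define t where "t c = (\<Sum>k\<in>B. h (\<Phi> (j c)) (j k) *\<^sub>R k)" for c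
  define F where "F c = \<Phi> (j c) - j (t c)" for c
  have t_lin: "linear t"
    unfolding t_def
    by (intro linear_compose_sum ballI linearI)
      (simp_all add: linear_add[OF j_lin] linear_add[OF linear_\<Phi>] linear_scale[OF j_lin] linear_scale[OF linear_\<Phi>] H.form_simps algebra_simps)
  have F_lin: "linear F"
    unfolding F_def
    by (intro linear_compose_sub linear_compose[OF t_lin j_lin, unfolded o_def] linear_compose[OF j_lin linear_\<Phi>, unfolded o_def])
  have Ft: "h (F c) (j c') = 0" for c c'
  proof -
    have "bS (t c) c' = (\<Sum>k\<in>B. h (\<Phi> (j c)) (j k) * bS c' k)"
      by (simp add: t_def S.form_simps S.sym[of _ c'])
    also have "\<dots> = h (\<Phi> (j c)) (j (\<Sum>k\<in>B. bS c' k *\<^sub>R k))"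
      by (simp add: linear_sum[OF j_lin] linear_scale[OF j_lin] H.form_simps mult.commute)
    also have "\<dots> = h (\<Phi> (j c)) (j c')" by (simp flip: S.frame_expansion[OF B])
    finally show ?thesis by (simp add: F_def H.form_simps jj)
  qed
  \<comment> \<open>Pythagoras: \<open>\<Phi> (j c)\<close> is as long as \<open>j c\<close>, and by
    the slant condition its part tangent to the slant leaf takes the fraction
    \<open>(cos \<nu>)\<^sup>2\<close> of the squared length.\<close>
  have norm_F: "h (F c) (F c) = (sin \<nu>)\<^sup>2 * bS c c" for c
  proof -
    have "bS (t c) (t c) = h (\<Phi> (j c)) (j (t c))"
      using Ft[of c "t c"] by (simp add: F_def H.form_simps jj)
    also have "\<dots> = (\<Sum>k\<in>B. (h (\<Phi> (j c)) (j k))\<^sup>2)"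
      by (simp add: t_def linear_sum[OF j_lin] linear_scale[OF j_lin] H.form_simps power2_eq_square)
    also have "\<dots> = (cos \<nu>)\<^sup>2 * bS c c" using slant[OF B, of c] by (simp add: j_def)
    finally have t: "bS (t c) (t c) = (cos \<nu>)\<^sup>2 * bS c c" .
    have "h (F c) (F c) = h (F c) (\<Phi> (j c))" using Ft[of c "t c"] by (subst (2) F_def) (simp add: H.form_simps)
    also have "\<dots> = h (\<Phi> (j c)) (\<Phi> (j c)) - h (\<Phi> (j c)) (j (t c))"
      by (simp add: F_def H.form_simps H.sym[of "j (t c)"])
    also have "h (\<Phi> (j c)) (\<Phi> (j c)) = bS c c" by (simp add: \<Phi>_metric jj) (simp add: j_def \<xi>(1) isometric)
    also have "h (\<Phi> (j c)) (j (t c)) = bS (t c) (t c)"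
      using Ft[of c "t c"] by (simp add: F_def H.form_simps jj)
    finally show ?thesis using t by (simp add: sin_squared_eq algebra_simps)
  qed
  have "h (F c) (F c') = (sin \<nu>)\<^sup>2 * bS c c'" for c c'
  proof (rule quadratic_form_polar[where q = "\<lambda>c c'. h (F c) (F c')" and r = "\<lambda>c c'. (sin \<nu>)\<^sup>2 * bS c c'"])
    show "bilinear (\<lambda>c c'. h (F c) (F c'))"
      using linear_compose[OF F_lin H.linear_left] linear_compose[OF F_lin H.linear_right]
      by (simp add: bilinear_def o_def)
    show "bilinear (\<lambda>c c'. (sin \<nu>)\<^sup>2 * bS c c')"
      by (auto simp: bilinear_def S.form_simps algebra_simps intro!: linearI)
    show "h (F u) (F v) = h (F v) (F u)" "(sin \<nu>)\<^sup>2 * bS u v = (sin \<nu>)\<^sup>2 * bS v u"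
      "h (F u) (F u) = (sin \<nu>)\<^sup>2 * bS u u" for u v
      using H.sym S.sym[of u v] norm_F by simp_all
  qed
  then have F_orth: "h (F i) (F k) = (if i = k then (sin \<nu>)\<^sup>2 else 0)" if "i \<in> B" "k \<in> B" for i k
    using B that by (simp add: orthonormal_frame_def)
  have fin: "finite B" using B by (simp add: orthonormal_frame_def)
  define s where "s = \<sigma> (0, 0, c) (a, 0, 0)"
  define m where "m k = h (\<Phi> (j c)) (j k)" for k
  \<comment> \<open>Skewness of \<open>\<Phi>\<close>. It separates the index \<open>k = c\<close>,
    which carries the gradient term, from the other indices, which carry the terms with
    \<open>m k\<close>; squaring produces no cross terms.\<close>
  have "m c = 0" using skew[of "j c" "j c"] H.sym[of "j c" "\<Phi> (j c)"] by (simp add: m_def)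
  have sF: "h s (F k) = - (if k = c then bT G2 (\<tau> a) else 0) + (bT G2 a - \<beta> * bT r a) * m k" if "k \<in> B" for k
  proof -
    have "h s (F k) = h s (\<Phi> (j k))" using \<sigma>_normal by (simp add: F_def H.form_simps s_def j_def)
    also have "\<dots> = - bS c k * bT G2 (\<tau> a) + (bT G2 a - \<beta> * bT r a) * m k"
      by (simp add: s_def j_def m_def \<sigma>_TS)
    finally show ?thesis using B that c by (auto simp: orthonormal_frame_def)
  qed
  have "(\<Sum>k\<in>B. (h s (F k))\<^sup>2)
      = (\<Sum>k\<in>B. (if k = c then (bT G2 (\<tau> a))\<^sup>2 else 0) + (bT G2 a - \<beta> * bT r a)\<^sup>2 * (m k)\<^sup>2)"
    using \<open>m c = 0\<close> by (intro sum.cong refl) (auto simp: sF power_mult_distrib)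
  also have "\<dots> = (bT G2 (\<tau> a))\<^sup>2 + (bT G2 a - \<beta> * bT r a)\<^sup>2 * (\<Sum>k\<in>B. (m k)\<^sup>2)"
    using fin c by (simp add: sum.distrib sum_distrib_left)
  also have "(\<Sum>k\<in>B. (m k)\<^sup>2) = (cos \<nu>)\<^sup>2"
    using slant[OF B, of c] B c by (simp add: m_def j_def orthonormal_frame_def)
  finally show ?thesis
    using H.bessel[OF fin F_orth, of s] sin_pos by (simp add: s_def mult.commute)
qed

section \<open>Frames adapted to the three factors\<close>

lemma sum_Un_images:
  assumes "finite BT" "finite BP" "finite BS" "0 \<notin> BT" "0 \<notin> BP" "0 \<notin> BS"
  shows "(\<Sum>u\<in>(\<lambda>a. (a, 0, 0)) ` BT \<union> (\<lambda>b. (0, b, 0)) ` BP \<union> (\<lambda>c. (0, 0, c)) ` BS. q u)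
    = (\<Sum>a\<in>BT. q (a, 0, 0)) + (\<Sum>b\<in>BP. q (0, b, 0)) + (\<Sum>c\<in>BS. q (0, 0, c) :: real)"
  using assms by (subst sum.union_disjoint; (subst sum.union_disjoint)?) (auto simp: sum.reindex inj_on_def)

lemma card_Un_images:
  assumes "finite BT" "finite BP" "finite BS" "0 \<notin> BT" "0 \<notin> BP" "0 \<notin> BS"
  shows "card ((\<lambda>a. (a, 0, 0)) ` BT \<union> (\<lambda>b. (0, b, 0)) ` BP \<union> (\<lambda>c. (0, 0, c)) ` BS) = card BT + card BP + card BS"
  using assms by (subst card_Un_disjoint; (subst card_Un_disjoint)?) (auto simp: card_image inj_on_def)

lemma inner_form_bL: "inner_form bL"
proof
  show "bilinear bL"
    by (auto simp: bilinear_def bL_def T.form_simps P.form_simps S.form_simps algebra_simps intro!: linearI)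
  show "bL u v = bL v u" for u v
    by (cases u; cases v) (simp add: bL_def T.sym P.sym S.sym)
  fix u :: "'e \<times> 'f \<times> 'h" assume "u \<noteq> 0"
  obtain a b c where u: "u = (a, b, c)" using prod_cases3 by blast
  have "0 \<le> bT a a" "0 \<le> bP b b" "0 \<le> bS c c" using T.nonneg P.nonneg S.nonneg by simp_all
  moreover have "0 < bT a a \<or> 0 < bP b b \<or> 0 < bS c c"
    using \<open>u \<noteq> 0\<close> T.pos P.pos S.pos unfolding u by (auto simp: zero_prod_def)
  ultimately show "0 < bL u u" by (auto simp: bL_def u)
qed

definition q where "q u v = h (\<sigma> u v) (\<sigma> u v)"

lemma q_sym: "q u v = q v u" and q_nonneg: "0 \<le> q u v" and q_zero: "q u v = 0 \<longleftrightarrow> \<sigma> u v = 0"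
  using \<sigma>_sym[of u v] by (simp_all add: q_def H.nonneg)

text \<open>Independence of the trace is applied to one slot at a time, with the other slot summed
  over a fixed frame.\<close>

lemma sum_q_independent:
  assumes B: "orthonormal_frame bL B" and C: "orthonormal_frame bL C"
  shows "(\<Sum>u\<in>B. \<Sum>v\<in>B. q u v) = (\<Sum>u\<in>C. \<Sum>v\<in>C. q u v)"
proof -
  interpret L: inner_form bL by (rule inner_form_bL)
  note \<sigma>s = bilinear_ladd[OF \<sigma>_bilinear] bilinear_lmul[OF \<sigma>_bilinear]
    bilinear_radd[OF \<sigma>_bilinear] bilinear_rmul[OF \<sigma>_bilinear]
  have "bilinear (\<lambda>u u'. \<Sum>v\<in>B. h (\<sigma> u v) (\<sigma> u' v))"
    unfolding bilinear_def
    by (intro conjI allI linearI) (simp_all add: \<sigma>s H.form_simps sum.distrib sum_distrib_left)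
  from L.frame_sum_independent[OF B C this]
  have "(\<Sum>u\<in>B. \<Sum>v\<in>B. q u v) = (\<Sum>u\<in>C. \<Sum>v\<in>B. q u v)" by (simp only: q_def)
  also have "\<dots> = (\<Sum>v\<in>B. \<Sum>u\<in>C. q u v)" by (rule sum.swap)
  also have "\<dots> = (\<Sum>v\<in>C. \<Sum>u\<in>C. q u v)"
    unfolding q_def
  proof (rule L.frame_sum_independent[where q = "\<lambda>v v'. \<Sum>u\<in>C. h (\<sigma> u v) (\<sigma> u v')", OF B C])
    show "bilinear (\<lambda>v v'. \<Sum>u\<in>C. h (\<sigma> u v) (\<sigma> u v'))"
      unfolding bilinear_def
      by (intro conjI allI linearI) (simp_all add: \<sigma>s H.form_simps sum.distrib sum_distrib_left)
  qed
  also have "\<dots> = (\<Sum>u\<in>C. \<Sum>v\<in>C. q u v)" by (rule sum.swap)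
  finally show ?thesis .
qed

text \<open>Frames of the factors join to a frame of the product. The off-diagonal blocks occur
  twice, by symmetry of \<open>\<sigma>\<close>, which is the origin of the factors 2.\<close>

lemma norm_sq_eq:
  assumes B: "orthonormal_frame bL B"
    and BT: "orthonormal_frame bT BT" and BP: "orthonormal_frame bP BP" and BS: "orthonormal_frame bS BS"
  shows "(\<Sum>u\<in>B. \<Sum>v\<in>B. q u v)
    = (\<Sum>a\<in>BT. \<Sum>a'\<in>BT. q (a, 0, 0) (a', 0, 0)) + (\<Sum>b\<in>BP. \<Sum>b'\<in>BP. q (0, b, 0) (0, b', 0))
      + (\<Sum>c\<in>BS. \<Sum>c'\<in>BS. q (0, 0, c) (0, 0, c')) + 2 * (\<Sum>b\<in>BP. \<Sum>c\<in>BS. q (0, b, 0) (0, 0, c))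
      + 2 * (\<Sum>b\<in>BP. \<Sum>a\<in>BT. q (0, b, 0) (a, 0, 0)) + 2 * (\<Sum>c\<in>BS. \<Sum>a\<in>BT. q (0, 0, c) (a, 0, 0))"
proof -
  let ?C = "(\<lambda>a. (a, 0, 0)) ` BT \<union> (\<lambda>b. (0, b, 0)) ` BP \<union> (\<lambda>c. (0, 0, c)) ` BS"
  \<comment> \<open>Unit vectors are nonzero, so the three embedded frames are pairwise
    disjoint.\<close>
  have fin: "finite BT" "finite BP" "finite BS" and nz: "0 \<notin> BT" "0 \<notin> BP" "0 \<notin> BS"
    using BT BP BS by (auto simp: orthonormal_frame_def) (metis T.zero_left P.zero_left S.zero_left zero_neq_one)+
  have "bT u v = (if u = v then 1 else 0)" if "u \<in> BT" "v \<in> BT" for u v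
    using BT that by (simp add: orthonormal_frame_def)
  moreover have "bP u v = (if u = v then 1 else 0)" if "u \<in> BP" "v \<in> BP" for u v
    using BP that by (simp add: orthonormal_frame_def)
  moreover have "bS u v = (if u = v then 1 else 0)" if "u \<in> BS" "v \<in> BS" for u v
    using BS that by (simp add: orthonormal_frame_def)
  moreover have "card ?C = DIM('e \<times> 'f \<times> 'h)"
    using BT BP BS card_Un_images[OF fin nz] by (simp add: orthonormal_frame_def)
  ultimately have "orthonormal_frame bL ?C"
    using fin nz by (auto simp: orthonormal_frame_def bL_def split: if_split_asm)
  from sum_q_independent[OF B this]
  have "(\<Sum>u\<in>B. \<Sum>v\<in>B. q u v) = (\<Sum>u\<in>?C. \<Sum>v\<in>?C. q u v)" .
  also have "\<dots> = (\<Sum>a\<in>BT. (\<Sum>a'\<in>BT. q (a, 0, 0) (a', 0, 0)) + (\<Sum>b\<in>BP. q (a, 0, 0) (0, b, 0)) + (\<Sum>c\<in>BS. q (a, 0, 0) (0, 0, c)))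
      + (\<Sum>b\<in>BP. (\<Sum>a\<in>BT. q (0, b, 0) (a, 0, 0)) + (\<Sum>b'\<in>BP. q (0, b, 0) (0, b', 0)) + (\<Sum>c\<in>BS. q (0, b, 0) (0, 0, c)))
      + (\<Sum>c\<in>BS. (\<Sum>a\<in>BT. q (0, 0, c) (a, 0, 0)) + (\<Sum>b\<in>BP. q (0, 0, c) (0, b, 0)) + (\<Sum>c'\<in>BS. q (0, 0, c) (0, 0, c')))"
    by (simp only: sum_Un_images[OF fin nz])
  also have "\<dots> = (\<Sum>a\<in>BT. \<Sum>a'\<in>BT. q (a, 0, 0) (a', 0, 0)) + (\<Sum>b\<in>BP. \<Sum>b'\<in>BP. q (0, b, 0) (0, b', 0))
      + (\<Sum>c\<in>BS. \<Sum>c'\<in>BS. q (0, 0, c) (0, 0, c')) + 2 * (\<Sum>b\<in>BP. \<Sum>c\<in>BS. q (0, b, 0) (0, 0, c))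
      + 2 * (\<Sum>b\<in>BP. \<Sum>a\<in>BT. q (0, b, 0) (a, 0, 0)) + 2 * (\<Sum>c\<in>BS. \<Sum>a\<in>BT. q (0, 0, c) (a, 0, 0))"
  proof -
    have swap: "(\<Sum>u\<in>X. \<Sum>v\<in>Y. q (i u) (k v)) = (\<Sum>v\<in>Y. \<Sum>u\<in>X. q (k v) (i u))"
      for X Y and i :: "'x \<Rightarrow> 'e \<times> 'f \<times> 'h" and k :: "'y \<Rightarrow> 'e \<times> 'f \<times> 'h"
      by (subst sum.swap) (intro sum.cong refl q_sym)
    show ?thesis
      by (simp only: sum.distrib swap[of _ _ BP BT] swap[of _ _ BS BT] swap[of _ _ BS BP])
  qed
  finally show ?thesis .
qed

text \<open>The right-hand side of the inequality in terms of dimensions: in the theorem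
  \<open>DIM('h)\<close> is \<open>2 * t3\<close>, so that \<open>2 * DIM('h)\<close> becomes
  \<open>4 * t3\<close>.\<close>

definition bound :: real where
  "bound = 2 * real DIM('f) * (bT G1 G1 - \<beta>\<^sup>2)
     + 2 * real DIM('h) * (1 / (sin \<nu>)\<^sup>2) * ((sin \<nu>)\<^sup>2 + 2 * (cos \<nu>)\<^sup>2) * (bT G2 G2 - \<beta>\<^sup>2)"

lemma mixed_bounds:
  assumes BT: "orthonormal_frame bT BT" and BP: "orthonormal_frame bP BP" and BS: "orthonormal_frame bS BS"
  shows "bound \<le> 2 * (\<Sum>b\<in>BP. \<Sum>a\<in>BT. q (0, b, 0) (a, 0, 0)) + 2 * (\<Sum>c\<in>BS. \<Sum>a\<in>BT. q (0, 0, c) (a, 0, 0))"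
proof -
  have "real DIM('f) * (bT G1 G1 - \<beta>\<^sup>2) = (\<Sum>b\<in>BP. \<Sum>a\<in>BT. (bT G1 (\<tau> a))\<^sup>2)"
    using BP by (simp add: sum_tau_sq[OF BT G_\<xi>(1)] orthonormal_frame_def)
  also have "\<dots> \<le> (\<Sum>b\<in>BP. \<Sum>a\<in>BT. q (0, b, 0) (a, 0, 0))"
    unfolding q_def by (intro sum_mono \<sigma>_TP_bound[OF BP])
  finally have 1: "real DIM('f) * (bT G1 G1 - \<beta>\<^sup>2) \<le> (\<Sum>b\<in>BP. \<Sum>a\<in>BT. q (0, b, 0) (a, 0, 0))" .
  \<comment> \<open>Written as \<open>1 + (cos \<nu>)\<^sup>2\<close>, the constant shows its two
    sources: the terms in \<open>\<tau> a\<close>, and the shifted terms with weight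
    \<open>(cos \<nu>)\<^sup>2\<close>.\<close>
  have "(sin \<nu>)\<^sup>2 + 2 * (cos \<nu>)\<^sup>2 = 1 + (cos \<nu>)\<^sup>2" by (simp add: sin_squared_eq)
  moreover have alg: "D * (1 / s) * (1 + c) * X = D * ((X + c * X) / s)" for D s c X :: real
    by (simp add: algebra_simps add_divide_distrib)
  ultimately have "real DIM('h) * (1 / (sin \<nu>)\<^sup>2) * ((sin \<nu>)\<^sup>2 + 2 * (cos \<nu>)\<^sup>2) * (bT G2 G2 - \<beta>\<^sup>2)
    = (\<Sum>c\<in>BS. ((bT G2 G2 - \<beta>\<^sup>2) + (cos \<nu>)\<^sup>2 * (bT G2 G2 - \<beta>\<^sup>2)) / (sin \<nu>)\<^sup>2)"
    using BS by (simp only: alg) (simp add: orthonormal_frame_def)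
  also have "\<dots> = (\<Sum>c\<in>BS. \<Sum>a\<in>BT. ((bT G2 (\<tau> a))\<^sup>2 + (cos \<nu>)\<^sup>2 * (bT G2 a - \<beta> * bT r a)\<^sup>2) / (sin \<nu>)\<^sup>2)"
    by (simp only: sum_divide_distrib[symmetric] sum.distrib sum_distrib_left[symmetric]
        sum_tau_sq[OF BT G_\<xi>(2)] sum_shift_sq[OF BT G_\<xi>(2)])
  also have "\<dots> \<le> (\<Sum>c\<in>BS. \<Sum>a\<in>BT. q (0, 0, c) (a, 0, 0))"
    unfolding q_def by (intro sum_mono \<sigma>_TS_bound[OF BS])
  finally show ?thesis using 1 by (simp add: bound_def)
qed

text \<open>The blocks that mix the first factor with the others already reach \<open>bound\<close>,
  and all other blocks are nonnegative. Equality leaves no room for the three pure blocks.\<close>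

lemma norm_sq_bound:
  assumes B: "orthonormal_frame bL B"
  shows "bound \<le> (\<Sum>u\<in>B. \<Sum>v\<in>B. q u v)"
    and "(\<Sum>u\<in>B. \<Sum>v\<in>B. q u v) = bound \<Longrightarrow> \<sigma> (a, 0, 0) (a', 0, 0) = 0"
    and "(\<Sum>u\<in>B. \<Sum>v\<in>B. q u v) = bound \<Longrightarrow> \<sigma> (0, b, 0) (0, b', 0) = 0"
    and "(\<Sum>u\<in>B. \<Sum>v\<in>B. q u v) = bound \<Longrightarrow> \<sigma> (0, 0, c) (0, 0, c') = 0"
proof -
  obtain BT BP BS where F: "orthonormal_frame bT BT" "orthonormal_frame bP BP" "orthonormal_frame bS BS"
    using T.orthonormal_frame_exists P.orthonormal_frame_exists S.orthonormal_frame_exists by metis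
  have fin: "finite BT" "finite BP" "finite BS" using F by (auto simp: orthonormal_frame_def)
  have nnT: "0 \<le> (\<Sum>a\<in>BT. \<Sum>a'\<in>BT. q (a, 0, 0) (a', 0, 0))"
    and nnP: "0 \<le> (\<Sum>b\<in>BP. \<Sum>b'\<in>BP. q (0, b, 0) (0, b', 0))"
    and nnS: "0 \<le> (\<Sum>c\<in>BS. \<Sum>c'\<in>BS. q (0, 0, c) (0, 0, c'))"
    and nnM: "0 \<le> (\<Sum>b\<in>BP. \<Sum>c\<in>BS. q (0, b, 0) (0, 0, c))"
    by (intro sum_nonneg q_nonneg)+
  show "bound \<le> (\<Sum>u\<in>B. \<Sum>v\<in>B. q u v)"
    unfolding norm_sq_eq[OF B F] using mixed_bounds[OF F] nnT nnP nnS nnM by linarith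
  assume eq: "(\<Sum>u\<in>B. \<Sum>v\<in>B. q u v) = bound"
  have zero: "(\<Sum>a\<in>BT. \<Sum>a'\<in>BT. q (a, 0, 0) (a', 0, 0)) = 0"
    "(\<Sum>b\<in>BP. \<Sum>b'\<in>BP. q (0, b, 0) (0, b', 0)) = 0"
    "(\<Sum>c\<in>BS. \<Sum>c'\<in>BS. q (0, 0, c) (0, 0, c')) = 0"
    using eq[unfolded norm_sq_eq[OF B F]] mixed_bounds[OF F] nnT nnP nnS nnM by linarith+
  \<comment> \<open>A vanishing sum of nonnegative terms gives zeros on pairs of frame vectors;
    bilinearity and spanning extend this to all vectors.\<close>
  have vanish: "\<sigma> (i u) (i v) = 0"
    if i: "linear i" and X: "finite X" "span X = UNIV" and 0: "(\<Sum>u\<in>X. \<Sum>v\<in>X. q (i u) (i v)) = 0"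
    for i :: "'x::euclidean_space \<Rightarrow> 'e \<times> 'f \<times> 'h" and X u v
  proof -
    have base: "\<sigma> (i u) (i v) = 0" if "u \<in> X" "v \<in> X" for u v
      using 0 X(1) that q_nonneg by (simp add: sum_nonneg_eq_0_iff sum_nonneg q_zero)
    have l1: "linear (\<lambda>u. \<sigma> (i u) (i v))" and l2: "linear (\<lambda>v. \<sigma> (i u) (i v))" for u v
    proof -
      have "linear (\<sigma> t)" "linear (\<lambda>u. \<sigma> u t)" for t using \<sigma>_bilinear unfolding bilinear_def by blast+
      from linear_compose[OF i this(2)] linear_compose[OF i this(1)]
      show "linear (\<lambda>u. \<sigma> (i u) (i v))" "linear (\<lambda>v. \<sigma> (i u) (i v))" by (simp_all only: o_def)
    qed
    have "\<sigma> (i u) (i v) = 0" if "v \<in> X" for u v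
      using linear_eq_0_on_span[OF l1 base[OF _ that]] X(2) by blast
    then show ?thesis using linear_eq_0_on_span[OF l2, of X u v] X(2) by blast
  qed
  show "\<sigma> (a, 0, 0) (a', 0, 0) = 0"
    by (rule vanish[OF _ fin(1) T.frame_span[OF F(1)] zero(1)]) (auto intro!: linearI)
  show "\<sigma> (0, b, 0) (0, b', 0) = 0"
    by (rule vanish[OF _ fin(2) P.frame_span[OF F(2)] zero(2)]) (auto intro!: linearI)
  show "\<sigma> (0, 0, c) (0, 0, c') = 0"
    by (rule vanish[OF _ fin(3) S.frame_span[OF F(3)] zero(3)]) (auto intro!: linearI)
qed

end

section \<open>Locally conformal almost cosymplectic manifolds\<close>

locale almost_cosymplectic = riemannian N g
  for N :: "('p::{t2_space,second_countable_topology}, 'n::euclidean_space) charts" and g +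
  fixes \<Phi> :: "'p \<Rightarrow> 'n \<Rightarrow> 'n" and \<xi> :: "'p \<Rightarrow> 'n" and \<eta> :: "'p \<Rightarrow> 'n \<Rightarrow> real" and \<beta> :: "'p \<Rightarrow> real"
  assumes lcac: "loc_conf_almost_cosymplectic N \<Phi> \<xi> \<eta> g \<beta>"
begin

lemma almost_contact: "almost_contact_metric N \<Phi> \<xi> \<eta> g"
  using lcac by (simp add: loc_conf_almost_cosymplectic_def)

lemma linear_\<Phi>: "linear (\<Phi> p)" and smooth_\<Phi>: "open U \<Longrightarrow> smooth_vf_on N U Z \<Longrightarrow> smooth_vf_on N U (\<lambda>q. \<Phi> q (Z q))"
  and smooth_\<xi>: "smooth_vf_on N UNIV \<xi>"
  and \<Phi>_sq: "\<Phi> p (\<Phi> p X) = - X + \<eta> p X *\<^sub>R \<xi> p" and \<eta>_\<xi> [simp]: "\<eta> p (\<xi> p) = 1"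
  and \<Phi>_\<xi> [simp]: "\<Phi> p (\<xi> p) = 0" and \<eta>_\<Phi> [simp]: "\<eta> p (\<Phi> p X) = 0"
  and \<Phi>_metric: "g p (\<Phi> p X) (\<Phi> p Y) = g p X Y - \<eta> p X * \<eta> p Y"
  using almost_contact by (auto simp: almost_contact_metric_def smooth_11_tensor_def)

lemma cov_\<Phi>: "open U \<Longrightarrow> smooth_vf_on N U Y \<Longrightarrow> p \<in> U \<Longrightarrow>
    cov N g (\<lambda>q. \<Phi> q (Y q)) p X = \<Phi> p (cov N g Y p X)
      + \<beta> p *\<^sub>R (g p (\<Phi> p X) (Y p) *\<^sub>R \<xi> p - \<eta> p (Y p) *\<^sub>R \<Phi> p X)"
  and cov_\<xi>: "cov N g \<xi> p X = \<beta> p *\<^sub>R (X - \<eta> p X *\<^sub>R \<xi> p)"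
  using lcac by (auto simp: loc_conf_almost_cosymplectic_def algebra_simps)

text \<open>Compatibility of \<open>g\<close> with \<open>\<Phi>\<close>, evaluated at \<xi>, which
  \<open>\<Phi>\<close> sends to zero.\<close>

lemma \<eta>_metric: "\<eta> p X = g p (\<xi> p) X"
proof -
  interpret G: inner_form "g p" by (rule inner_form)
  show ?thesis using \<Phi>_metric[of p "\<xi> p" X] by simp
qed

text \<open>Compatibility is applied to \<open>X\<close> and the image of \<open>Y\<close> under
  \<open>\<Phi>\<close>; expanding the square of \<open>\<Phi>\<close> leaves a \<xi>-term that is
  orthogonal to the image of \<open>X\<close>.\<close>

lemma \<Phi>_skew: "g p (\<Phi> p X) Y = - g p X (\<Phi> p Y)"
proof -
  interpret G: inner_form "g p" by (rule inner_form)
  have "g p (\<Phi> p X) (\<Phi> p (\<Phi> p Y)) = g p X (\<Phi> p Y)" by (simp add: \<Phi>_metric)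
  moreover have "g p (\<Phi> p X) (\<xi> p) = 0" using \<eta>_metric[of p "\<Phi> p X"] G.sym[of "\<xi> p"] by simp
  ultimately show ?thesis by (simp add: \<Phi>_sq G.form_simps)
qed

text \<open>Metric compatibility of the connection, combined with the structure equation for the
  covariant derivative of \<open>\<Phi>\<close>, in the coordinate form needed to differentiate
  along the submanifold.\<close>

lemma fundamental_form_derivative:
  "((\<lambda>q. g q (\<Phi> q (coord_field N p v q)) (coord_field N p w q)) \<circ> inv_chart N p) differentiable (at (chart N p p))"
  "dfun N (\<lambda>q. g q (\<Phi> q (coord_field N p v q)) (coord_field N p w q)) p u
    = g p (\<Phi> p (christoffel N g p u v)) w + g p (\<Phi> p v) (christoffel N g p u w)
      + \<beta> p * (g p (\<Phi> p u) v * \<eta> p w - \<eta> p v * g p (\<Phi> p u) w)"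
proof -
  interpret G: inner_form "g p" by (rule inner_form)
  note sm = smooth_vf_coord_field[of p v]
  note diff = smooth_vf_differentiable[OF smooth_\<Phi>[OF open_cdom sm] in_cdom]
  show "((\<lambda>q. g q (\<Phi> q (coord_field N p v q)) (coord_field N p w q)) \<circ> inv_chart N p) differentiable (at (chart N p p))"
    by (rule metric_cov(1)[OF diff])
  show "dfun N (\<lambda>q. g q (\<Phi> q (coord_field N p v q)) (coord_field N p w q)) p u
    = g p (\<Phi> p (christoffel N g p u v)) w + g p (\<Phi> p v) (christoffel N g p u w)
      + \<beta> p * (g p (\<Phi> p u) v * \<eta> p w - \<eta> p v * g p (\<Phi> p u) w)"
    unfolding metric_cov(2)[OF diff] cov_\<Phi>[OF open_cdom sm in_cdom] cov_coord_field
    by (simp add: G.form_simps flip: \<eta>_metric)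
qed

lemma \<xi>_derivative:
  "((\<lambda>q. g q (\<xi> q) (coord_field N p w q)) \<circ> inv_chart N p) differentiable (at (chart N p p))"
  "dfun N (\<lambda>q. g q (\<xi> q) (coord_field N p w q)) p u
    = \<beta> p * (g p u w - \<eta> p u * \<eta> p w) + g p (\<xi> p) (christoffel N g p u w)"
proof -
  interpret G: inner_form "g p" by (rule inner_form)
  note diff = smooth_vf_differentiable[OF smooth_\<xi> UNIV_I]
  show "((\<lambda>q. g q (\<xi> q) (coord_field N p w q)) \<circ> inv_chart N p) differentiable (at (chart N p p))"
    by (rule metric_cov(1)[OF diff])
  show "dfun N (\<lambda>q. g q (\<xi> q) (coord_field N p w q)) p u
    = \<beta> p * (g p u w - \<eta> p u * \<eta> p w) + g p (\<xi> p) (christoffel N g p u w)"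
    unfolding metric_cov(2)[OF diff] cov_\<xi> by (simp add: G.form_simps flip: \<eta>_metric)
qed

end

section \<open>Bi-warped product submanifolds\<close>

locale warped_submanifold = bi_warped L1 g1 L2 g2 L3 g3 f2 f3 + A: almost_cosymplectic N g \<Phi> \<xi> \<eta> \<beta>
    + I: immersed_submanifold "prod_charts L1 (prod_charts L2 L3)" N g \<iota>
  for L1 :: "('a::{t2_space,second_countable_topology}, 'e::euclidean_space) charts" and g1
    and L2 :: "('b::{t2_space,second_countable_topology}, 'f::euclidean_space) charts" and g2
    and L3 :: "('c::{t2_space,second_countable_topology}, 'h::euclidean_space) charts" and g3 f2 f3
    and N :: "('p::{t2_space,second_countable_topology}, 'n::euclidean_space) charts" and g \<Phi> \<xi> \<eta> \<beta> \<iota> +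
  fixes \<nu> :: real
  assumes isometric: "g (\<iota> p) (dmap L N \<iota> p u) (dmap L N \<iota> p v) = gL p u v"
    and slant_T: "slant_tangent_xi L1 N \<Phi> \<xi> g (\<lambda>x. \<iota> (x, y, z)) 0"
    and slant_S: "slant_orthogonal_xi L3 N \<Phi> \<xi> g (\<lambda>z. \<iota> (x, y, z)) \<nu>"
    and anti_invariant: "g (\<iota> p) (\<Phi> (\<iota> p) (dmap L N \<iota> p (0, b, 0))) (dmap L N \<iota> p t) = 0"
    and \<nu>: "0 < \<nu>" "\<nu> < pi / 2"
begin

abbreviation "d \<equiv> dmap L N \<iota>"

lemma pullback_eq: "pullback_metric L N g \<iota> = gL"
  by (simp add: pullback_metric_def isometric fun_eq_iff del: split_paired_All)

lemma isometric': "g (\<iota> (x, y, z)) (d (x, y, z) (a, b, c)) (d (x, y, z) (a', b', c'))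
    = g1 x a a' + (f2 x)\<^sup>2 * g2 y b b' + (f3 x)\<^sup>2 * g3 z c c'"
  by (simp add: isometric bi_warped_metric_def)

lemma zero_forms [simp]: "g1 x 0 v = 0" "g1 x v 0 = 0" "g2 y 0 w = 0" "g2 y w 0 = 0" "g3 z 0 t = 0" "g3 z t 0 = 0"
  using bilinear_lzero bilinear_rzero T.metric_bilinear P.metric_bilinear S.metric_bilinear by blast+

lemma leaf_T: "affine_leaf L N g \<iota> L1 (\<lambda>x. (x, y, z)) (\<lambda>u. (u, 0, 0)) (\<lambda>x. (0, chart L2 y y, chart L3 z z))"
  and leaf_P: "affine_leaf L N g \<iota> L2 (\<lambda>y. (x, y, z)) (\<lambda>u. (0, u, 0)) (\<lambda>y. (chart L1 x x, 0, chart L3 z z))"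
  and leaf_S: "affine_leaf L N g \<iota> L3 (\<lambda>z. (x, y, z)) (\<lambda>u. (0, 0, u)) (\<lambda>z. (chart L1 x x, chart L2 y y, 0))"
  by unfold_locales (auto intro!: continuous_intros linearI)

lemma dmap_leaf:
  "dmap L1 N (\<lambda>x. \<iota> (x, y, z)) x u = d (x, y, z) (u, 0, 0)"
  "dmap L3 N (\<lambda>z. \<iota> (x, y, z)) z w = d (x, y, z) (0, 0, w)"
  using affine_leaf.dmap_leaf[OF leaf_T, of y z x u] affine_leaf.dmap_leaf[OF leaf_S, of x y z w]
  by (simp_all add: o_def)

lemma linear_d: "linear (d p)"
  by (rule I.linear_dj)

lemma linear_leaf: "linear (\<lambda>u. d p (u, 0, 0))" "linear (\<lambda>u. d p (0, 0, u))"
  using linear_compose[OF _ linear_d[of p], unfolded o_def, of "\<lambda>u. (u, 0, 0)"]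
    linear_compose[OF _ linear_d[of p], unfolded o_def, of "\<lambda>u. (0, 0, u)"]
  by (simp_all add: linear_iff)

lemma inj_leaf: "inj (\<lambda>u. d p (u, 0, 0))" "inj (\<lambda>u. d p (0, 0, u))"
  using I.inj_dj[of p] by (auto simp: inj_def)

lemma \<xi>_tangent: "\<exists>r. \<xi> (\<iota> (x, y, z)) = d (x, y, z) (r, 0, 0)"
  using slant_T[of y z] by (auto simp: slant_tangent_xi_def tangent_space_def dmap_leaf)

text \<open>Slant angle 0 makes the projection of \<Phi>X to the leaf as long as \<Phi>X, so the
  remainder vanishes. Multiples of \<xi> lie outside the slant condition and are sent to
  zero.\<close>

lemma \<Phi>_tangent: "\<exists>a'. \<Phi> (\<iota> (x, y, z)) (d (x, y, z) (a, 0, 0)) = d (x, y, z) (a', 0, 0)"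
proof -
  let ?p = "\<iota> (x, y, z)"
  let ?A = "\<lambda>u. d (x, y, z) (u, 0, 0)"
  let ?X = "?A a"
  interpret G: inner_form "g ?p" by (rule A.inner_form)
  show ?thesis
  proof (cases "?X \<in> span {\<xi> ?p}")
    case True
    then obtain k where "?X = k *\<^sub>R \<xi> ?p" by (auto simp: span_singleton)
    then have "\<Phi> ?p ?X = d (x, y, z) (0, 0, 0)"
      using linear_0[OF linear_d] by (simp add: linear_scale[OF A.linear_\<Phi>] zero_prod_def)
    then show ?thesis by blast
  next
    case False
    have nz: "\<Phi> ?p ?X \<noteq> 0"
    proof
      assume "\<Phi> ?p ?X = 0"
      then have "?X = \<eta> ?p ?X *\<^sub>R \<xi> ?p" using A.\<Phi>_sq[of ?p ?X] linear_0[OF A.linear_\<Phi>] by simp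
      then show False using False by (metis span_base span_mul singletonI)
    qed
    have "angle_to_subspace (g ?p) (\<Phi> ?p ?X) (range ?A) = 0"
      using slant_T[of y z] False by (auto simp: slant_tangent_xi_def tangent_space_def dmap_leaf[abs_def])
    note ang = angle_to_range[OF A.inner_form linear_leaf(1) inj_leaf(1) nz this]
    obtain B where B: "orthonormal_frame (\<lambda>u v. g ?p (?A u) (?A v)) B"
      using inner_form.orthonormal_frame_exists[OF inner_form_pullback[OF A.inner_form linear_leaf(1) inj_leaf(1)]] by blast
    define w where "w = orth_proj (g ?p) (range ?A) (\<Phi> ?p ?X)"
    note w = norm_proj_range[OF A.inner_form linear_leaf(1) inj_leaf(1) B, of "\<Phi> ?p ?X", folded w_def]
    have "g ?p (\<Phi> ?p ?X - w) (\<Phi> ?p ?X - w) = 0"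
      using w(2) ang[folded w_def] G.sym[of w "\<Phi> ?p ?X"] by (simp add: G.form_simps)
    then have "\<Phi> ?p ?X = w" by simp
    then show ?thesis using w(1) by auto
  qed
qed

lemma \<Phi>_mixed: "g (\<iota> p) (\<Phi> (\<iota> p) (d p (a, 0, 0))) (d p (0, b, c)) = 0"
proof -
  obtain x y z where p: "p = (x, y, z)" using prod_cases3 by blast
  obtain a' where "\<Phi> (\<iota> p) (d p (a, 0, 0)) = d p (a', 0, 0)" using \<Phi>_tangent p by blast
  then show ?thesis by (simp add: p isometric')
qed

lemma \<xi>_mixed: "g (\<iota> p) (\<xi> (\<iota> p)) (d p (0, b, c)) = 0"
proof -
  obtain x y z where p: "p = (x, y, z)" using prod_cases3 by blast
  obtain r where "\<xi> (\<iota> p) = d p (r, 0, 0)" using \<xi>_tangent p by blast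
  then show ?thesis by (simp add: p isometric')
qed

text \<open>The squared length of a projection is the sum of the squared coefficients, which turns
  the slant angle into a sum over a frame. The zero vector, about which the angle condition says
  nothing, is treated apart.\<close>

lemma slant_sum:
  assumes B: "orthonormal_frame (\<lambda>c c'. (f3 x)\<^sup>2 * g3 z c c') B"
  shows "(\<Sum>k\<in>B. (g (\<iota> (x, y, z)) (\<Phi> (\<iota> (x, y, z)) (d (x, y, z) (0, 0, c))) (d (x, y, z) (0, 0, k)))\<^sup>2)
    = (cos \<nu>)\<^sup>2 * ((f3 x)\<^sup>2 * g3 z c c)"
proof -
  let ?p = "\<iota> (x, y, z)"
  let ?A = "\<lambda>u. d (x, y, z) (0, 0, u)"
  interpret G: inner_form "g ?p" by (rule A.inner_form)
  have len: "g ?p (\<Phi> ?p (?A c)) (\<Phi> ?p (?A c)) = (f3 x)\<^sup>2 * g3 z c c"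
    by (simp add: A.\<Phi>_metric A.\<eta>_metric \<xi>_mixed isometric')
  show ?thesis
  proof (cases "?A c = 0")
    case True
    then have "(f3 x)\<^sup>2 * g3 z c c = 0" using len linear_0[OF A.linear_\<Phi>, of ?p] by simp
    then show ?thesis using True linear_0[OF A.linear_\<Phi>, of ?p] by simp
  next
    case False
    have "(f3 x)\<^sup>2 * g3 z c c = g ?p (?A c) (?A c)" by (simp add: isometric')
    then have nz: "\<Phi> ?p (?A c) \<noteq> 0" using len G.pos[OF False] by auto
    have "angle_to_subspace (g ?p) (\<Phi> ?p (?A c)) (range ?A) = \<nu>"
      using slant_S[of x y] False by (auto simp: slant_orthogonal_xi_def tangent_space_def dmap_leaf[abs_def])
    note ang = angle_to_range[OF A.inner_form linear_leaf(2) inj_leaf(2) nz this]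
    have "orthonormal_frame (\<lambda>u v. g ?p (?A u) (?A v)) B" using B by (simp add: isometric')
    from norm_proj_range(3)[OF A.inner_form linear_leaf(2) inj_leaf(2) this, of "\<Phi> ?p (?A c)"] ang len
    show ?thesis by simp
  qed
qed

lemma gauss_tangent: "g (\<iota> p) (gauss L N g \<iota> p u v) (d p w) = gL p (christoffel L gL p u v) w"
  using I.christoffel_pullback(2)[of p u v w] by (simp add: pullback_eq isometric)

text \<open>Coordinate fields stay in their distribution throughout the chart. This makes
  orthogonality relations such as g(\<Phi>X, Z) = 0 identities on an open set, which can be
  differentiated.\<close>

lemma coord_field_T: "q \<in> cdom L p \<Longrightarrow> \<exists>a'. coord_field L p (a, 0, 0) q = (a', 0, 0)"
  and coord_field_PS: "q \<in> cdom L p \<Longrightarrow> \<exists>b' c'. coord_field L p (0, b, c) q = (0, b', c')"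
proof -
  assume q: "q \<in> cdom L p"
  obtain x y z where p: "p = (x, y, z)" using prod_cases3 by blast
  obtain x' y' z' where q': "q = (x', y', z')" using prod_cases3 by blast
  have c: "x' \<in> cdom L1 x" "y' \<in> cdom L2 y" "z' \<in> cdom L3 z" using q by (auto simp: p q')
  show "\<exists>a'. coord_field L p (a, 0, 0) q = (a', 0, 0)" "\<exists>b' c'. coord_field L p (0, b, c) q = (0, b', c')"
    unfolding p q' coord_field_L[OF c] using linear_0[OF T.linear_coord_field[OF c(1)]]
      linear_0[OF P.linear_coord_field[OF c(2)]] linear_0[OF S.linear_coord_field[OF c(3)]] by simp_all
qed

text \<open>The key identity comes from differentiating \<open>g(\<Phi>X, Z) = 0\<close> for \<open>X\<close> tangent to the first
  factor and \<open>Z\<close> orthogonal to it.\<close>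

lemma gauss_\<Phi>:
  assumes \<tau>: "\<Phi> (\<iota> p) (d p (a, 0, 0)) = d p (a', 0, 0)"
  shows "g (\<iota> p) (gauss L N g \<iota> p u (a, 0, 0)) (\<Phi> (\<iota> p) (d p (0, b, c)))
    = gL p (a', 0, 0) (christoffel L gL p u (0, b, c))
      - \<beta> (\<iota> p) * \<eta> (\<iota> p) (d p (a, 0, 0)) * g (\<iota> p) (\<Phi> (\<iota> p) (d p u)) (d p (0, b, c))"
proof -
  let ?p = "\<iota> p"
  interpret G: inner_form "g ?p" by (rule A.inner_form)
  have bil: "bilinear (\<lambda>v w. g q (\<Phi> q v) w)" for q
    using linear_compose[OF A.linear_\<Phi>, unfolded o_def] A.metric_bilinear[of q] by (auto simp: bilinear_def)
  define a0 where "a0 = (a, 0::'f, 0::'h)"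
  define b0 where "b0 = (0::'e, b, c)"
  have "dfun L (\<lambda>q. g (\<iota> q) (\<Phi> (\<iota> q) (d q (coord_field L p a0 q))) (d q (coord_field L p b0 q))) p u
      = dfun L (\<lambda>q. 0 :: real) p u"
  proof (rule fun_cong, rule I.M.dfun_cong[OF I.M.open_cdom I.M.in_cdom])
    fix q assume q: "q \<in> cdom L p"
    show "g (\<iota> q) (\<Phi> (\<iota> q) (d q (coord_field L p a0 q))) (d q (coord_field L p b0 q)) = 0"
    proof -
      obtain s t t' where "coord_field L p (a, 0, 0) q = (s, 0, 0)" "coord_field L p (0, b, c) q = (0, t, t')"
        using coord_field_T[OF q, of a] coord_field_PS[OF q, of b c] by blast
      then show ?thesis by (simp add: a0_def b0_def \<Phi>_mixed)
    qed
  qed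
  also have "\<dots> = 0" by (simp add: dfun_def o_def)
  finally have "0 = g ?p (\<Phi> ?p (gauss L N g \<iota> p u a0)) (d p b0) + g ?p (\<Phi> ?p (d p a0)) (gauss L N g \<iota> p u b0)
      + \<beta> ?p * (g ?p (\<Phi> ?p (d p u)) (d p a0) * \<eta> ?p (d p b0) - \<eta> ?p (d p a0) * g ?p (\<Phi> ?p (d p u)) (d p b0))"
    unfolding I.pullback_bilinear_derivative[of "\<lambda>q v w. g q (\<Phi> q v) w", OF bil A.fundamental_form_derivative(1)]
      A.fundamental_form_derivative(2)
    by (simp add: gauss_def linear_add[OF A.linear_\<Phi>] G.form_simps)
  \<comment> \<open>One of the two \<open>\<beta>\<close> terms disappears because \<xi> is tangent
    to the first factor.\<close>
  moreover have "\<eta> ?p (d p b0) = 0" by (simp add: A.\<eta>_metric b0_def \<xi>_mixed)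
  moreover have "g ?p (\<Phi> ?p (d p a0)) (gauss L N g \<iota> p u b0) = gL p (a', 0, 0) (christoffel L gL p u b0)"
    using \<tau> gauss_tangent[of p u b0 "(a', 0, 0)"] G.sym inner_form.sym[OF inner_form_L] by (metis a0_def)
  ultimately show ?thesis by (simp add: A.\<Phi>_skew a0_def b0_def)
qed

text \<open>The relation g(\<xi>, Z) = 0 is differentiated and the formula for the derivative of
  \<xi> inserted. As \<xi> is tangent to the submanifold, only the tangential part of
  \<open>gauss\<close> enters, an intrinsic quantity.\<close>

lemma gauss_\<xi>:
  assumes r: "\<xi> (\<iota> p) = d p (r, 0, 0)"
  shows "gL p (r, 0, 0) (christoffel L gL p (0, b, c) (0, b', c')) = - \<beta> (\<iota> p) * gL p (0, b, c) (0, b', c')"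
proof -
  let ?p = "\<iota> p"
  interpret G: inner_form "g ?p" by (rule A.inner_form)
  have lin: "linear (g q (\<xi> q))" for q using A.metric_bilinear[of q] by (simp add: bilinear_def)
  define u where "u = (0::'e, b, c)"
  define b0 where "b0 = (0::'e, b', c')"
  have "dfun L (\<lambda>q. g (\<iota> q) (\<xi> (\<iota> q)) (d q (coord_field L p b0 q))) p u = dfun L (\<lambda>q. 0 :: real) p u"
  proof (rule fun_cong, rule I.M.dfun_cong[OF I.M.open_cdom I.M.in_cdom])
    fix q assume q: "q \<in> cdom L p"
    show "g (\<iota> q) (\<xi> (\<iota> q)) (d q (coord_field L p b0 q)) = 0"
    proof -
      obtain t t' where "coord_field L p (0, b', c') q = (0, t, t')" using coord_field_PS[OF q, of b' c'] by blast
      then show ?thesis by (simp add: b0_def \<xi>_mixed)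
    qed
  qed
  also have "\<dots> = 0" by (simp add: dfun_def o_def)
  finally have "0 = \<beta> ?p * (g ?p (d p u) (d p b0) - \<eta> ?p (d p u) * \<eta> ?p (d p b0)) + g ?p (\<xi> ?p) (gauss L N g \<iota> p u b0)"
    unfolding I.pullback_linear_derivative[of "\<lambda>q. g q (\<xi> q)", OF lin A.\<xi>_derivative(1)] A.\<xi>_derivative(2)
    by (simp add: gauss_def G.form_simps)
  moreover have "\<eta> ?p (d p u) = 0" by (simp add: A.\<eta>_metric u_def \<xi>_mixed)
  moreover have "g ?p (\<xi> ?p) (gauss L N g \<iota> p u b0) = gL p (r, 0, 0) (christoffel L gL p u b0)"
    using r gauss_tangent[of p u b0 "(r, 0, 0)"] G.sym inner_form.sym[OF inner_form_L] by metis
  ultimately show ?thesis by (simp add: isometric u_def b0_def)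
qed

end

section \<open>Gradients, the data at a point and the inequality on the submanifold\<close>

context warped_submanifold
begin

lemma gL_apply: "gL (x, y, z) (a, b, c) (a', b', c') = g1 x a a' + (f2 x)\<^sup>2 * g2 y b b' + (f3 x)\<^sup>2 * g3 z c c'"
  by (simp add: bi_warped_metric_def)

definition log_grad :: "('a \<Rightarrow> real) \<Rightarrow> 'a \<Rightarrow> 'e" where
  "log_grad f x = (1 / f x) *\<^sub>R grad L1 g1 f x"

lemma log_grad:
  "g1 x (log_grad f2 x) v = dfun L1 f2 x v / f2 x" "g1 x (log_grad f3 x) v = dfun L1 f3 x v / f3 x"
  using T.grad[OF warping_differentiable(1)] T.grad[OF warping_differentiable(2)]
  by (simp_all add: log_grad_def inner_form.scale_left[OF T.inner_form])

text \<open>The function depends on the base point alone and the metric is a sum of blocks, so the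
  gradient has no fibre components and its base part is not affected by the warping.\<close>

lemma grad_log_eq:
  assumes f: "(f \<circ> inv_chart L1 x) differentiable (at (chart L1 x x))" "\<And>x. 0 < f x"
  shows "grad L gL (\<lambda>(x, y, z). ln (f x)) (x, y, z) = (log_grad f x, 0, 0)"
proof -
  have "((\<lambda>x. ln (f x)) \<circ> inv_chart L1 x has_derivative (\<lambda>u. dfun L1 f x u / f x)) (at (chart L1 x x))"
    using has_derivative_ln[OF _ dfun_has_derivative[OF f(1)]] f(2) by (simp add: o_def divide_inverse mult.commute)
  note D = this
  have "((\<lambda>q. ln (f (fst q))) \<circ> inv_chart L (x, y, z) has_derivative (\<lambda>v. dfun L1 f x (fst v) / f x))
      (at (chart L (x, y, z) (x, y, z)))"
    using prod_fst_has_derivative[OF T.smooth_manifold smooth_mfds(4), of "\<lambda>x. ln (f x)" x "(y, z)"] D dfun_eqI[OF D]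
    by (auto simp: differentiable_def)
  moreover have "(\<lambda>(x, y, z). ln (f x)) = (\<lambda>q :: 'a \<times> 'b \<times> 'c. ln (f (fst q)))" by auto
  ultimately have dl: "dfun L (\<lambda>(x, y, z). ln (f x)) (x, y, z) = (\<lambda>v. dfun L1 f x (fst v) / f x)"
    by (metis dfun_eqI)
  interpret G: inner_form "gL (x, y, z)" by (rule inner_form_L)
  have eq: "gL (x, y, z) (log_grad f x, 0, 0) v = dfun L (\<lambda>(x, y, z). ln (f x)) (x, y, z) v" for v
    by (cases v) (simp add: dl gL_apply log_grad_def inner_form.scale_left[OF T.inner_form] T.grad[OF f(1)])
  show ?thesis
    unfolding grad_def
  proof (rule the_equality)
    show "\<forall>v. gL (x, y, z) (log_grad f x, 0, 0) v = dfun L (\<lambda>(x, y, z). ln (f x)) (x, y, z) v" using eq by blast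
    show "w = (log_grad f x, 0, 0)" if "\<forall>v. gL (x, y, z) w v = dfun L (\<lambda>(x, y, z). ln (f x)) (x, y, z) v" for w
      by (rule G.form_ext) (simp only: eq that)
  qed
qed

lemma grad_log:
  "grad L gL (\<lambda>(x, y, z). ln (f2 x)) (x, y, z) = (log_grad f2 x, 0, 0)"
  "grad L gL (\<lambda>(x, y, z). ln (f3 x)) (x, y, z) = (log_grad f3 x, 0, 0)"
  by (intro grad_log_eq warping_differentiable warping_pos)+

lemma zero_christoffel [simp]:
  "christoffel L1 g1 x 0 v = 0" "christoffel L1 g1 x v 0 = 0" "christoffel L2 g2 y 0 w = 0" "christoffel L2 g2 y w 0 = 0"
  "christoffel L3 g3 z 0 t = 0" "christoffel L3 g3 z t 0 = 0" "dfun L1 f2 x 0 = 0" "dfun L1 f3 x 0 = 0"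
  using bilinear_lzero bilinear_rzero T.christoffel_bilinear P.christoffel_bilinear S.christoffel_bilinear
    linear_0[OF dfun_linear[OF warping_differentiable(1)]] linear_0[OF dfun_linear[OF warping_differentiable(2)]]
  by blast+

lemma christoffel_L_cases:
  "christoffel L gL (x, y, z) (a, 0, 0) (a', 0, 0) = (christoffel L1 g1 x a a', 0, 0)"
  "christoffel L gL (x, y, z) (0, b, 0) (0, b', 0) = (- (f2 x * g2 y b b') *\<^sub>R grad L1 g1 f2 x, christoffel L2 g2 y b b', 0)"
  "christoffel L gL (x, y, z) (0, 0, c) (0, 0, c') = (- (f3 x * g3 z c c') *\<^sub>R grad L1 g1 f3 x, 0, christoffel L3 g3 z c c')"
  "christoffel L gL (x, y, z) (0, b, 0) (a, 0, 0) = (0, (dfun L1 f2 x a / f2 x) *\<^sub>R b, 0)"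
  "christoffel L gL (x, y, z) (0, 0, c) (a, 0, 0) = (0, 0, (dfun L1 f3 x a / f3 x) *\<^sub>R c)"
  by (simp_all add: christoffel_L warped_christoffel_def)

lemma second_ff_gauss_L: "second_ff L N g \<iota> p u v = gauss L N g \<iota> p u v - d p (christoffel L gL p u v)"
  by (simp add: I.second_ff_gauss pullback_eq)

text \<open>For a nonzero fibre vector the base part of the Christoffel map is a multiple of the
  gradient of the warping function, so \<open>gauss_\<xi>\<close> becomes an equation for the
  derivative of that function along \<xi>, after division by the squared length of the
  vector.\<close>

lemma log_grad_\<xi>:
  assumes r: "\<xi> (\<iota> (x, y, z)) = d (x, y, z) (r, 0, 0)"
  shows "g1 x (log_grad f2 x) r = \<beta> (\<iota> (x, y, z))" "g1 x (log_grad f3 x) r = \<beta> (\<iota> (x, y, z))"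
proof -
  interpret T1: inner_form "g1 x" by (rule T.inner_form)
  obtain b :: 'f where b: "b \<in> Basis" using nonempty_Basis by blast
  obtain c :: 'h where c: "c \<in> Basis" using nonempty_Basis by blast
  have pos: "0 < g2 y b b" "0 < g3 z c c"
    using inner_form.pos[OF P.inner_form] inner_form.pos[OF S.inner_form] nonzero_Basis[OF b] nonzero_Basis[OF c] by blast+
  have "g1 x r (grad L1 g1 f2 x) = \<beta> (\<iota> (x, y, z)) * f2 x"
    using gauss_\<xi>[OF r, of b 0 b 0] pos(1)
    by (simp add: christoffel_L_cases gL_apply T1.form_simps power2_eq_square)
  moreover have "g1 x r (grad L1 g1 f3 x) = \<beta> (\<iota> (x, y, z)) * f3 x"
    using gauss_\<xi>[OF r, of 0 c 0 c] pos(2)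
    by (simp add: christoffel_L_cases gL_apply T1.form_simps power2_eq_square)
  ultimately show "g1 x (log_grad f2 x) r = \<beta> (\<iota> (x, y, z))" "g1 x (log_grad f3 x) r = \<beta> (\<iota> (x, y, z))"
    by (simp_all add: log_grad_def T1.form_simps T1.sym[of _ r])
qed

text \<open>The passage from geometry to linear algebra at one point. The fibre forms contain the
  warping factors, so frames for them are orthonormal in the induced metric.\<close>

lemma slant_point_exists:
  "\<exists>r \<tau>. slant_point (g1 x) (\<lambda>v w. (f2 x)\<^sup>2 * g2 y v w) (\<lambda>v w. (f3 x)\<^sup>2 * g3 z v w) (g (\<iota> (x, y, z)))
     (d (x, y, z)) (\<Phi> (\<iota> (x, y, z))) (\<xi> (\<iota> (x, y, z))) r \<tau> (second_ff L N g \<iota> (x, y, z))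
     (log_grad f2 x) (log_grad f3 x) (\<beta> (\<iota> (x, y, z))) \<nu>"
proof -
  define p where "p = (x, y, z)"
  obtain r where r: "\<xi> (\<iota> p) = d p (r, 0, 0)" using \<xi>_tangent p_def by blast
  obtain \<tau> where \<tau>: "\<And>a. \<Phi> (\<iota> p) (d p (a, 0, 0)) = d p (\<tau> a, 0, 0)"
    using \<Phi>_tangent[of x y z] p_def by metis
  interpret T1: inner_form "g1 x" by (rule T.inner_form)
  interpret G: inner_form "g (\<iota> p)" by (rule A.inner_form)
  have \<eta>: "\<eta> (\<iota> p) (d p (a, 0, 0)) = g1 x r a" for a
    using r by (simp add: A.\<eta>_metric p_def isometric')
  have "slant_point (g1 x) (\<lambda>v w. (f2 x)\<^sup>2 * g2 y v w) (\<lambda>v w. (f3 x)\<^sup>2 * g3 z v w) (g (\<iota> p))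
     (d p) (\<Phi> (\<iota> p)) (\<xi> (\<iota> p)) r \<tau> (second_ff L N g \<iota> p)
     (log_grad f2 x) (log_grad f3 x) (\<beta> (\<iota> p)) \<nu>"
  proof (intro slant_point.intro slant_point_axioms.intro)
    show "inner_form (g1 x)" "inner_form (g (\<iota> p))" by (rule T.inner_form A.inner_form)+
    show "inner_form (\<lambda>v w. (f2 x)\<^sup>2 * g2 y v w)" "inner_form (\<lambda>v w. (f3 x)\<^sup>2 * g3 z v w)"
      by (intro inner_form_scale P.inner_form S.inner_form; simp)+
    show "linear (d p)" "linear (\<Phi> (\<iota> p))" by (rule linear_d A.linear_\<Phi>)+
    show "g (\<iota> p) (d p (a, b, c)) (d p (a', b', c')) = g1 x a a' + (f2 x)\<^sup>2 * g2 y b b' + (f3 x)\<^sup>2 * g3 z c c'"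
      for a b c a' b' c' by (simp add: p_def isometric')
    show "g (\<iota> p) (\<Phi> (\<iota> p) X) Y = - g (\<iota> p) X (\<Phi> (\<iota> p) Y)" for X Y by (rule A.\<Phi>_skew)
    show "g (\<iota> p) (\<Phi> (\<iota> p) X) (\<Phi> (\<iota> p) Y) = g (\<iota> p) X Y - g (\<iota> p) (\<xi> (\<iota> p)) X * g (\<iota> p) (\<xi> (\<iota> p)) Y"
      for X Y by (simp add: A.\<Phi>_metric A.\<eta>_metric)
    show "\<xi> (\<iota> p) = d p (r, 0, 0)" by (rule r)
    show "g (\<iota> p) (\<xi> (\<iota> p)) (\<xi> (\<iota> p)) = 1" using A.\<eta>_\<xi>[of "\<iota> p"] by (simp add: A.\<eta>_metric)
    show "\<Phi> (\<iota> p) (d p (a, 0, 0)) = d p (\<tau> a, 0, 0)" for a by (rule \<tau>)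
    show "(\<Sum>k\<in>B. (g (\<iota> p) (\<Phi> (\<iota> p) (d p (0, 0, c))) (d p (0, 0, k)))\<^sup>2) = (cos \<nu>)\<^sup>2 * ((f3 x)\<^sup>2 * g3 z c c)"
      if "orthonormal_frame (\<lambda>v w. (f3 x)\<^sup>2 * g3 z v w) B" for B c
      using slant_sum[OF that, of y c] by (simp only: p_def)
    show "0 < \<nu>" "\<nu> < pi / 2" by (rule \<nu>)+
    show "bilinear (second_ff L N g \<iota> p)" by (rule I.second_ff_bilinear)
    show "second_ff L N g \<iota> p u v = second_ff L N g \<iota> p v u" for u v by (rule I.second_ff_sym)
    show "g (\<iota> p) (second_ff L N g \<iota> p u v) (d p w) = 0" for u v w by (rule I.second_ff_normal)
    show "g (\<iota> p) (second_ff L N g \<iota> p (0, b, 0) (a, 0, 0)) (\<Phi> (\<iota> p) (d p (0, b', 0)))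
        = - ((f2 x)\<^sup>2 * g2 y b b') * g1 x (log_grad f2 x) (\<tau> a)" for a b b'
    proof -
      \<comment> \<open>Anti-invariance removes both the tangential part of \<open>gauss\<close> and
        the \<open>\<beta>\<close> term of \<open>gauss_\<Phi>\<close>.\<close>
      have "g (\<iota> p) (d p t) (\<Phi> (\<iota> p) (d p (0, b', 0))) = 0" for t
        using anti_invariant[of p b' t] G.sym by simp
      then have "g (\<iota> p) (second_ff L N g \<iota> p (0, b, 0) (a, 0, 0)) (\<Phi> (\<iota> p) (d p (0, b', 0)))
          = gL p (\<tau> a, 0, 0) (christoffel L gL p (0, b, 0) (0, b', 0))"
        by (simp add: second_ff_gauss_L G.diff_left gauss_\<Phi>[OF \<tau>] anti_invariant)
      then show ?thesis
        by (simp add: p_def christoffel_L_cases gL_apply log_grad_def T1.form_simps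
            T1.sym[of "\<tau> a"] power2_eq_square)
    qed
    show "g (\<iota> p) (second_ff L N g \<iota> p (0, 0, c) (a, 0, 0)) (\<Phi> (\<iota> p) (d p (0, 0, c')))
        = - ((f3 x)\<^sup>2 * g3 z c c') * g1 x (log_grad f3 x) (\<tau> a)
          + (g1 x (log_grad f3 x) a - \<beta> (\<iota> p) * g1 x r a) * g (\<iota> p) (\<Phi> (\<iota> p) (d p (0, 0, c))) (d p (0, 0, c'))"
      for a c c'
    proof -
      \<comment> \<open>The derivative of \<open>ln f3\<close> along the base vector. The tangential
        part of \<open>gauss\<close> is \<open>?k\<close> times the slant vector, and its pairing
        joins the \<open>\<beta>\<close> term to give the shifted coefficient.\<close>
      let ?k = "dfun L1 f3 x a / f3 x"
      have "d p (0, 0, ?k *\<^sub>R c) = ?k *\<^sub>R d p (0, 0, c)" by (rule linear_scale[OF linear_leaf(2)])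
      then have "g (\<iota> p) (d p (christoffel L gL p (0, 0, c) (a, 0, 0))) (\<Phi> (\<iota> p) (d p (0, 0, c')))
          = - ?k * g (\<iota> p) (\<Phi> (\<iota> p) (d p (0, 0, c))) (d p (0, 0, c'))"
        by (simp add: p_def christoffel_L_cases G.scale_left[unfolded p_def] A.\<Phi>_skew)
      then have "g (\<iota> p) (second_ff L N g \<iota> p (0, 0, c) (a, 0, 0)) (\<Phi> (\<iota> p) (d p (0, 0, c')))
          = gL p (\<tau> a, 0, 0) (christoffel L gL p (0, 0, c) (0, 0, c'))
            + (?k - \<beta> (\<iota> p) * g1 x r a) * g (\<iota> p) (\<Phi> (\<iota> p) (d p (0, 0, c))) (d p (0, 0, c'))"
        by (simp add: second_ff_gauss_L G.diff_left gauss_\<Phi>[OF \<tau>] \<eta> algebra_simps)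
      also have "gL p (\<tau> a, 0, 0) (christoffel L gL p (0, 0, c) (0, 0, c'))
          = - ((f3 x)\<^sup>2 * g3 z c c') * g1 x (log_grad f3 x) (\<tau> a)"
        by (simp add: p_def christoffel_L_cases gL_apply log_grad_def T1.form_simps
            T1.sym[of "\<tau> a"] power2_eq_square)
      finally show ?thesis by (simp only: log_grad)
    qed
    show "g1 x (log_grad f2 x) r = \<beta> (\<iota> p)" "g1 x (log_grad f3 x) r = \<beta> (\<iota> p)"
      using log_grad_\<xi> r by (simp_all add: p_def)
  qed
  then show ?thesis unfolding p_def by blast
qed

definition ff_bound :: "'a \<times> 'b \<times> 'c \<Rightarrow> real" where
  "ff_bound = (\<lambda>(x, y, z). 2 * real DIM('f) * (g1 x (log_grad f2 x) (log_grad f2 x) - (\<beta> (\<iota> (x, y, z)))\<^sup>2)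
     + 2 * real DIM('h) * (1 / (sin \<nu>)\<^sup>2) * ((sin \<nu>)\<^sup>2 + 2 * (cos \<nu>)\<^sup>2)
       * (g1 x (log_grad f3 x) (log_grad f3 x) - (\<beta> (\<iota> (x, y, z)))\<^sup>2))"

lemma second_ff_norm_bound:
  "ff_bound (x, y, z) \<le> second_ff_norm_sq L N g \<iota> (x, y, z)"
  "second_ff_norm_sq L N g \<iota> (x, y, z) = ff_bound (x, y, z) \<Longrightarrow> second_ff L N g \<iota> (x, y, z) (a, 0, 0) (a', 0, 0) = 0"
  "second_ff_norm_sq L N g \<iota> (x, y, z) = ff_bound (x, y, z) \<Longrightarrow> second_ff L N g \<iota> (x, y, z) (0, b, 0) (0, b', 0) = 0"
  "second_ff_norm_sq L N g \<iota> (x, y, z) = ff_bound (x, y, z) \<Longrightarrow> second_ff L N g \<iota> (x, y, z) (0, 0, c) (0, 0, c') = 0"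
proof -
  obtain r \<tau> where "slant_point (g1 x) (\<lambda>v w. (f2 x)\<^sup>2 * g2 y v w) (\<lambda>v w. (f3 x)\<^sup>2 * g3 z v w) (g (\<iota> (x, y, z)))
     (d (x, y, z)) (\<Phi> (\<iota> (x, y, z))) (\<xi> (\<iota> (x, y, z))) r \<tau> (second_ff L N g \<iota> (x, y, z))
     (log_grad f2 x) (log_grad f3 x) (\<beta> (\<iota> (x, y, z))) \<nu>"
    using slant_point_exists by blast
  then interpret X: slant_point "g1 x" "\<lambda>v w. (f2 x)\<^sup>2 * g2 y v w" "\<lambda>v w. (f3 x)\<^sup>2 * g3 z v w" "g (\<iota> (x, y, z))"
     "d (x, y, z)" "\<Phi> (\<iota> (x, y, z))" "\<xi> (\<iota> (x, y, z))" r \<tau> "second_ff L N g \<iota> (x, y, z)"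
     "log_grad f2 x" "log_grad f3 x" "\<beta> (\<iota> (x, y, z))" \<nu> .
  have bL: "X.bL = gL (x, y, z)" by (simp add: X.bL_def bi_warped_metric_def)
  have bound: "X.bound = ff_bound (x, y, z)" by (simp add: X.bound_def ff_bound_def)
  define B where "B = (SOME B. orthonormal_frame (pullback_metric L N g \<iota> (x, y, z)) B)"
  have B: "orthonormal_frame X.bL B"
    unfolding B_def bL pullback_eq by (rule someI_ex[OF inner_form.orthonormal_frame_exists[OF inner_form_L]])
  have n: "second_ff_norm_sq L N g \<iota> (x, y, z) = (\<Sum>u\<in>B. \<Sum>v\<in>B. X.q u v)"
    by (simp add: second_ff_norm_sq_def Let_def B_def X.q_def)
  note X.norm_sq_bound[OF B, folded n, unfolded bound]
  then show "ff_bound (x, y, z) \<le> second_ff_norm_sq L N g \<iota> (x, y, z)"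
    "second_ff_norm_sq L N g \<iota> (x, y, z) = ff_bound (x, y, z) \<Longrightarrow> second_ff L N g \<iota> (x, y, z) (a, 0, 0) (a', 0, 0) = 0"
    "second_ff_norm_sq L N g \<iota> (x, y, z) = ff_bound (x, y, z) \<Longrightarrow> second_ff L N g \<iota> (x, y, z) (0, b, 0) (0, b', 0) = 0"
    "second_ff_norm_sq L N g \<iota> (x, y, z) = ff_bound (x, y, z) \<Longrightarrow> second_ff L N g \<iota> (x, y, z) (0, 0, c) (0, 0, c') = 0"
    by blast+
qed

section \<open>Second fundamental forms of the leaves\<close>

lemma second_ff_leaf_T:
  "second_ff L1 N g (\<lambda>x. \<iota> (x, y, z)) x u v = second_ff L N g \<iota> (x, y, z) (u, 0, 0) (v, 0, 0)"
proof -
  interpret F: affine_leaf L N g \<iota> L1 "\<lambda>x. (x, y, z)" "\<lambda>u. (u, 0, 0)" "\<lambda>x. (0, chart L2 y y, chart L3 z z)"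
    by (rule leaf_T)
  have "pullback_metric L1 N g (\<iota> \<circ> (\<lambda>x. (x, y, z))) = g1"
    by (intro ext) (simp only: F.pullback_metric_leaf pullback_eq, simp add: gL_apply)
  then show ?thesis
    using F.second_ff_leaf[of x u v] by (simp add: o_def second_ff_gauss_L christoffel_L_cases)
qed

text \<open>For the leaf only its own Christoffel term is subtracted from \<open>gauss\<close>, so
  the base component of the Christoffel map of \<open>L\<close> survives. That component is minus
  the leaf metric times \<open>log_grad f2 x\<close>, the umbilical term.\<close>

lemma second_ff_leaf_P:
  "second_ff L2 N g (\<lambda>y. \<iota> (x, y, z)) y u v = second_ff L N g \<iota> (x, y, z) (0, u, 0) (0, v, 0)
    - pullback_metric L2 N g (\<lambda>y. \<iota> (x, y, z)) y u v *\<^sub>R d (x, y, z) (log_grad f2 x, 0, 0)"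
proof -
  interpret F: affine_leaf L N g \<iota> L2 "\<lambda>y. (x, y, z)" "\<lambda>u. (0, u, 0)" "\<lambda>y. (chart L1 x x, 0, chart L3 z z)"
    by (rule leaf_P)
  have m: "pullback_metric L2 N g (\<iota> \<circ> (\<lambda>y. (x, y, z))) = (\<lambda>y u v. (f2 x)\<^sup>2 * g2 y u v)"
    by (intro ext) (simp only: F.pullback_metric_leaf pullback_eq, simp add: gL_apply)
  have c: "christoffel L2 (\<lambda>y u v. (f2 x)\<^sup>2 * g2 y u v) y = christoffel L2 g2 y"
    by (rule christoffel_eqI)
      (auto intro!: inner_form_scale P.inner_form P.is_christoffel_scale P.christoffel P.metric_coord_differentiable)
  have "(- (f2 x * g2 y u v) *\<^sub>R grad L1 g1 f2 x, christoffel L2 g2 y u v, 0::'h)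
    = (0, christoffel L2 g2 y u v, 0) - ((f2 x)\<^sup>2 * g2 y u v) *\<^sub>R (log_grad f2 x, 0, 0)"
    by (simp add: log_grad_def power2_eq_square)
  then have "d (x, y, z) (christoffel L gL (x, y, z) (0, u, 0) (0, v, 0))
    = d (x, y, z) (0, christoffel L2 g2 y u v, 0) - ((f2 x)\<^sup>2 * g2 y u v) *\<^sub>R d (x, y, z) (log_grad f2 x, 0, 0)"
    by (simp only: christoffel_L_cases linear_diff[OF linear_d] linear_scale[OF linear_d])
  then show ?thesis
    using F.second_ff_leaf[of y u v] m by (simp add: o_def second_ff_gauss_L c)
qed

lemma second_ff_leaf_S:
  "second_ff L3 N g (\<lambda>z. \<iota> (x, y, z)) z u v = second_ff L N g \<iota> (x, y, z) (0, 0, u) (0, 0, v)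
    - pullback_metric L3 N g (\<lambda>z. \<iota> (x, y, z)) z u v *\<^sub>R d (x, y, z) (log_grad f3 x, 0, 0)"
proof -
  interpret F: affine_leaf L N g \<iota> L3 "\<lambda>z. (x, y, z)" "\<lambda>u. (0, 0, u)" "\<lambda>z. (chart L1 x x, chart L2 y y, 0)"
    by (rule leaf_S)
  have m: "pullback_metric L3 N g (\<iota> \<circ> (\<lambda>z. (x, y, z))) = (\<lambda>z u v. (f3 x)\<^sup>2 * g3 z u v)"
    by (intro ext) (simp only: F.pullback_metric_leaf pullback_eq, simp add: gL_apply)
  have c: "christoffel L3 (\<lambda>z u v. (f3 x)\<^sup>2 * g3 z u v) z = christoffel L3 g3 z"
    by (rule christoffel_eqI)
      (auto intro!: inner_form_scale S.inner_form S.is_christoffel_scale S.christoffel S.metric_coord_differentiable)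
  have "(- (f3 x * g3 z u v) *\<^sub>R grad L1 g1 f3 x, 0::'f, christoffel L3 g3 z u v)
    = (0, 0, christoffel L3 g3 z u v) - ((f3 x)\<^sup>2 * g3 z u v) *\<^sub>R (log_grad f3 x, 0, 0)"
    by (simp add: log_grad_def power2_eq_square)
  then have "d (x, y, z) (christoffel L gL (x, y, z) (0, 0, u) (0, 0, v))
    = d (x, y, z) (0, 0, christoffel L3 g3 z u v) - ((f3 x)\<^sup>2 * g3 z u v) *\<^sub>R d (x, y, z) (log_grad f3 x, 0, 0)"
    by (simp only: christoffel_L_cases linear_diff[OF linear_d] linear_scale[OF linear_d])
  then show ?thesis
    using F.second_ff_leaf[of z u v] m by (simp add: o_def second_ff_gauss_L c)
qed

end

theorem theorem4p2:
  fixes N :: "('p::{t2_space,second_countable_topology}, 'n::euclidean_space) charts"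
    and \<Phi> :: "'p \<Rightarrow> 'n \<Rightarrow> 'n" and \<xi> :: "'p \<Rightarrow> 'n" and \<eta> :: "'p \<Rightarrow> 'n \<Rightarrow> real"
    and g :: "('p, 'n) metric" and \<beta> :: "'p \<Rightarrow> real"
    and LT :: "('a::{t2_space,second_countable_topology}, 'e::euclidean_space) charts"
    and LP :: "('b::{t2_space,second_countable_topology}, 'f::euclidean_space) charts"
    and LS :: "('c::{t2_space,second_countable_topology}, 'h::euclidean_space) charts"
    and gT :: "('a, 'e) metric" and gP :: "('b, 'f) metric" and gS :: "('c, 'h) metric"
    and \<phi>1 \<phi>2 :: "'a \<Rightarrow> real"
    and \<iota> :: "'a \<times> 'b \<times> 'c \<Rightarrow> 'p"
    and \<nu> :: real and t2 t3 :: nat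
    and L :: "('a \<times> 'b \<times> 'c, 'e \<times> 'f \<times> 'h) charts"
    and gL :: "('a \<times> 'b \<times> 'c, 'e \<times> 'f \<times> 'h) metric"
    and grad1 grad2 :: "'a \<times> 'b \<times> 'c \<Rightarrow> 'e \<times> 'f \<times> 'h"
  assumes ambient: "loc_conf_almost_cosymplectic N \<Phi> \<xi> \<eta> g \<beta>"
    and submanifold: "bi_warped_submanifold LT gT LP gP LS gS \<phi>1 \<phi>2 N \<Phi> \<xi> g \<iota> \<nu>"
    and L: "L = prod_charts LT (prod_charts LP LS)"
    and gL: "gL = bi_warped_metric gT gP gS \<phi>1 \<phi>2"
    and mixed_totally_geodesic: "\<forall>p v w. second_ff L N g \<iota> p (0, v, 0) (0, 0, w) = 0"
    and t2: "t2 = DIM('f)" and t3: "2 * t3 = DIM('h)"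
    and grad1: "grad1 = grad L gL (\<lambda>(x, y, z). ln (\<phi>1 x))"
    and grad2: "grad2 = grad L gL (\<lambda>(x, y, z). ln (\<phi>2 x))"
  shows "(\<forall>p. second_ff_norm_sq L N g \<iota> p \<ge>
            2 * real t2 * (gL p (grad1 p) (grad1 p) - (\<beta> (\<iota> p))\<^sup>2)
            + 4 * real t3 * (1 / (sin \<nu>)\<^sup>2) * ((sin \<nu>)\<^sup>2 + 2 * (cos \<nu>)\<^sup>2)
              * (gL p (grad2 p) (grad2 p) - (\<beta> (\<iota> p))\<^sup>2)) \<and>
         ((\<forall>p. second_ff_norm_sq L N g \<iota> p =
            2 * real t2 * (gL p (grad1 p) (grad1 p) - (\<beta> (\<iota> p))\<^sup>2)
            + 4 * real t3 * (1 / (sin \<nu>)\<^sup>2) * ((sin \<nu>)\<^sup>2 + 2 * (cos \<nu>)\<^sup>2)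
              * (gL p (grad2 p) (grad2 p) - (\<beta> (\<iota> p))\<^sup>2)) \<longrightarrow>
          (\<forall>y z. totally_geodesic LT N g (\<lambda>x. \<iota> (x, y, z))) \<and>
          (\<forall>x z. totally_umbilical LP N g (\<lambda>y. \<iota> (x, y, z))
                   (\<lambda>y. - dmap L N \<iota> (x, y, z) (grad1 (x, y, z)))) \<and>
          (\<forall>x y. totally_umbilical LS N g (\<lambda>z. \<iota> (x, y, z))
                   (\<lambda>z. - dmap L N \<iota> (x, y, z) (grad2 (x, y, z)))))"
proof -
  note sub = submanifold[unfolded bi_warped_submanifold_def Let_def isometric_immersion_def]
  have N: "riemannian_manifold N g"
    using ambient by (simp add: loc_conf_almost_cosymplectic_def almost_contact_metric_def)
  have mfds: "smooth_manifold LT" "smooth_manifold LP" "smooth_manifold LS" "smooth_manifold N"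
    using sub N by (auto simp: riemannian_manifold_def)
  interpret W: warped_submanifold LT gT LP gP LS gS \<phi>1 \<phi>2 N g \<Phi> \<xi> \<eta> \<beta> \<iota> \<nu>
    using sub N mfds ambient by unfold_locales (auto intro: smooth_manifold_prod)
  have bound: "2 * real t2 * (gL p (grad1 p) (grad1 p) - (\<beta> (\<iota> p))\<^sup>2)
      + 4 * real t3 * (1 / (sin \<nu>)\<^sup>2) * ((sin \<nu>)\<^sup>2 + 2 * (cos \<nu>)\<^sup>2) * (gL p (grad2 p) (grad2 p) - (\<beta> (\<iota> p))\<^sup>2)
      = W.ff_bound p" for p
  proof -
    obtain x y z where p: "p = (x, y, z)" using prod_cases3 by blast
    \<comment> \<open>This converts the factor \<open>2 * real DIM('h)\<close> of
      \<open>ff_bound\<close> into \<open>4 * real t3\<close>.\<close>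
    have "real DIM('h) = 2 * real t3" by (simp flip: t3)
    then show ?thesis
      unfolding grad1 grad2 gL L p W.grad_log by (simp add: W.ff_bound_def W.gL_apply t2)
  qed
  show ?thesis
    unfolding bound L
  proof (intro conjI allI impI)
    show "W.ff_bound p \<le> second_ff_norm_sq W.L N g \<iota> p" for p
      using W.second_ff_norm_bound(1)[of "fst p" "fst (snd p)" "snd (snd p)"] by simp
  next
    assume eq: "\<forall>p. second_ff_norm_sq W.L N g \<iota> p = W.ff_bound p"
    show "totally_geodesic LT N g (\<lambda>x. \<iota> (x, y, z))" for y z
      using eq W.second_ff_norm_bound(2) by (simp add: totally_geodesic_def W.second_ff_leaf_T)
    show "totally_umbilical LP N g (\<lambda>y. \<iota> (x, y, z)) (\<lambda>y. - dmap W.L N \<iota> (x, y, z) (grad1 (x, y, z)))" for x z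
      using eq W.second_ff_norm_bound(3) unfolding grad1 gL L W.grad_log
      by (simp add: totally_umbilical_def W.second_ff_leaf_P)
    show "totally_umbilical LS N g (\<lambda>z. \<iota> (x, y, z)) (\<lambda>z. - dmap W.L N \<iota> (x, y, z) (grad2 (x, y, z)))" for x y
      using eq W.second_ff_norm_bound(4) unfolding grad2 gL L W.grad_log
      by (simp add: totally_umbilical_def W.second_ff_leaf_S)
  qed
qed

end
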